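(* Let $\nu$ be a Borel probability measure on $\mathcal O(\mathbb C^m,0)$ with compact support. (i) If $\nu$ is attracting, then the origin lies in the random Fatou set, and for $\mu$-almost every $\omega\in\Omega$ there is a neighbourhood $V_\omega$ of the origin such that $f^n_\omega$ is defined on $V_\omega$ for all $n$ and $f^n_\omega(z)\to 0$ for every $z\in V_\omega$. (ii) If $\nu$ is repelling, then the origin does not lie in the random Fatou set. (iii) If $\nu$ is neutral, then the origin lies in the random Fatou set if and only if all germs in $\mathrm{supp}(\nu)$ are simultaneously linearizable and the semigroup of differentials $$dS_\nu=\{df^n_\omega(0)\,:\,\omega\in\Omega,\ n\in\mathbb N\}$$ is conjugate (by a single matrix in $GL(m,\mathbb C)$) to a sub-semigroup of the unitary group $U(m)$.
   Context: $\mathcal O(\mathbb C^m,0)$ is the space of germs at $0$ of holomorphic maps $\mathbb C^m\to\mathbb C^m$ fixing the origin, with the inductive limit topology: fix a strictly decreasing sequence $\varepsilon_n\to 0$, let $X_n$ be the space of bounded holomorphic maps on the open ball $\mathbb B_{\varepsilon_n}$ centred at $0$ with metric $d_n(f,g)=\sup_{\|z\|\le\varepsilon_n}\|f(z)-g(z)\|$, regarded as a subset of germs; a set $U$ of germs is open iff $U\cap X_n$ is $d_n$-open for every $n$. Random setting: $\Omega=\mathrm{supp}(\nu)^{\mathbb N}$ with the product $\sigma$-algebra and $\mu=\nu^{\otimes\mathbb N}$; for $\omega=(f_1,f_2,\dots)\in\Omega$ put $f^n_\omega=f_n\circ\cdots\circ f_1$ and $\mathcal F_\omega=\{f^n_\omega\}_{n\ge1}$.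 The origin lies in the random Fatou set if for $\mu$-a.e. $\omega$ there is a neighbourhood of $0$ on which all $f^n_\omega$ are defined and holomorphic and form a normal family. Lyapunov classification: for a compactly supported probability measure $\eta$ on $\mathrm{Mat}(m,\mathbb C)$ and i.i.d. products $M^n_\omega=M_n\cdots M_1$ ($M_i$ i.i.d. with law $\eta$), by Oseledets' theorem there are constants $\kappa_1>\dots>\kappa_s\ge-\infty$ (Lyapunov indices) with multiplicities $\alpha_1,\dots,\alpha_s$, $\sum\alpha_i=m$, such that a.s. $((M^n_\omega)^*M^n_\omega)^{1/(2n)}$ converges to a Hermitian matrix with eigenvalues $e^{\kappa_i}$ of multiplicity $\alpha_i$. $\eta$ is attracting if $\kappa_1<0$, repelling if $\kappa_1>0$, neutral if the spectrum is $\{(0,m)\}$ (i.e. $s=1$, $\kappa_1=0$), semi-neutral if $\kappa_1=0$ and $\alpha_1\neq m$. A measure $\nu$ on germs is attracting/repelling/neutral/semi-neutral if $(d_0)_*\nu$ is, where $d_0(f)=df(0)$. Germs $f_i$ are simultaneously linearizable if there is $\varphi\in\mathcal O(\mathbb C^m,0)$, locally invertible at $0$, with $\varphi\circ f_i=df_i(0)\cdot\varphi$ for all $i$. *)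

theory Defs
  imports "HOL-Analysis.Analysis" "HOL-Probability.Probability"
begin

section \<open>Several complex variables: holomorphy, germs\<close>

type_synonym 'm cvec = "complex ^ 'm"
type_synonym 'm cmat = "complex ^ 'm ^ 'm"

text \<open>Holomorphic on U: complex Frechet differentiable at every point of U
  (real derivative which is complex linear).\<close>
definition holo_on :: "'m::finite cvec set \<Rightarrow> ('m cvec \<Rightarrow> 'm cvec) \<Rightarrow> bool" where
  "holo_on U f \<longleftrightarrow> (\<forall>z\<in>U. \<exists>L. (f has_derivative L) (at z) \<and> (\<forall>c x. L (c *s x) = c *s L x))"

text \<open>The germ at 0 of a map: all maps agreeing with it on a neighbourhood of 0.\<close>
definition germ_of :: "('m::finite cvec \<Rightarrow> 'm cvec) \<Rightarrow> ('m cvec \<Rightarrow> 'm cvec) set" where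
  "germ_of f = {h. \<exists>e>0. \<forall>z\<in>ball 0 e. h z = f z}"

text \<open>The space O(C^m,0) of germs at 0 of holomorphic maps fixing the origin.\<close>
definition Germs :: "('m::finite cvec \<Rightarrow> 'm cvec) set set" where
  "Germs = {germ_of f | f. \<exists>r>0. holo_on (ball 0 r) f \<and> f 0 = 0}"

text \<open>A chosen representative of a germ.\<close>
definition rep :: "('m::finite cvec \<Rightarrow> 'm cvec) set \<Rightarrow> ('m cvec \<Rightarrow> 'm cvec)" where
  "rep F = (SOME f. f \<in> F)"

text \<open>Complex Jacobian matrix at 0 (entry i j = i-th component of df(0) e_j).\<close>
definition dmat :: "('m::finite cvec \<Rightarrow> 'm cvec) \<Rightarrow> 'm cmat" where
  "dmat f = (\<chi> i j. (frechet_derivative f (at 0) (axis j 1)) $ i)"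

text \<open>d_0(f) = df(0) for a germ f.\<close>
definition d0 :: "('m::finite cvec \<Rightarrow> 'm cvec) set \<Rightarrow> 'm cmat" where
  "d0 F = dmat (rep F)"

section \<open>Inductive limit topology on germs\<close>

text \<open>X_n: bounded holomorphic maps on the ball B_{eps n} fixing 0
  (normalised to be 0 off the ball, so that each map is a single function).\<close>
definition Xsp :: "(nat \<Rightarrow> real) \<Rightarrow> nat \<Rightarrow> ('m::finite cvec \<Rightarrow> 'm cvec) set" where
  "Xsp eps n = {f. holo_on (ball 0 (eps n)) f \<and> bounded (f ` ball 0 (eps n)) \<and> f 0 = 0
                   \<and> (\<forall>z. z \<notin> ball 0 (eps n) \<longrightarrow> f z = 0)}"

text \<open>The sup metric d_n on X_n.\<close>
definition dX :: "(nat \<Rightarrow> real) \<Rightarrow> nat \<Rightarrow> ('m::finite cvec \<Rightarrow> 'm cvec) \<Rightarrow> ('m cvec \<Rightarrow> 'm cvec) \<Rightarrow> real" where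
  "dX eps n f g = (SUP z\<in>ball 0 (eps n). norm (f z - g z))"

text \<open>U is open iff U \<inter> X_n is d_n-open in X_n for every n.\<close>
definition germ_open :: "(nat \<Rightarrow> real) \<Rightarrow> ('m::finite cvec \<Rightarrow> 'm cvec) set set \<Rightarrow> bool" where
  "germ_open eps U \<longleftrightarrow> U \<subseteq> Germs \<and>
     (\<forall>n. \<forall>f\<in>Xsp eps n. germ_of f \<in> U \<longrightarrow>
        (\<exists>\<delta>>0. \<forall>g\<in>Xsp eps n. dX eps n f g < \<delta> \<longrightarrow> germ_of g \<in> U))"

definition germ_topology :: "(nat \<Rightarrow> real) \<Rightarrow> ('m::finite cvec \<Rightarrow> 'm cvec) set topology" where
  "germ_topology eps = topology (germ_open eps)"


text \<open>Borel sigma algebra of a topology, topological support of a measure.\<close>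
definition borel_of :: "'a topology \<Rightarrow> 'a measure" where
  "borel_of T = sigma (topspace T) {U. openin T U}"

definition supp_of :: "'a topology \<Rightarrow> 'a measure \<Rightarrow> 'a set" where
  "supp_of T M = {x \<in> topspace T. \<forall>U. openin T U \<and> x \<in> U \<longrightarrow> emeasure M U > 0}"

section \<open>Random iteration\<close>

text \<open>compo g n = g (n-1) o ... o g 0 (so f^n_omega = f_n o ... o f_1 with f_i = omega (i-1)).\<close>
fun compo :: "(nat \<Rightarrow> ('a \<Rightarrow> 'a)) \<Rightarrow> nat \<Rightarrow> 'a \<Rightarrow> 'a" where
  "compo g 0 = id"
| "compo g (Suc n) = g n \<circ> compo g n"

text \<open>Normal family on V: every sequence in the family has a subsequence converging
  locally uniformly (uniformly on compact subsets) on V.\<close>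
definition normal_family :: "'m::finite cvec set \<Rightarrow> ('m cvec \<Rightarrow> 'm cvec) set \<Rightarrow> bool" where
  "normal_family V F \<longleftrightarrow> (\<forall>s::nat \<Rightarrow> _. (\<forall>k. s k \<in> F) \<longrightarrow>
     (\<exists>r h. strict_mono r \<and> (\<forall>K. compact K \<and> K \<subseteq> V \<longrightarrow> uniform_limit K (\<lambda>k. s (r k)) h sequentially)))"

text \<open>g is a sequence of holomorphic representatives (on open sets U k containing 0) of the
  germs omega k, such that all compositions f^n_omega = compo g n are defined on V.\<close>
definition defined_on :: "'m::finite cvec set \<Rightarrow> (nat \<Rightarrow> ('m cvec \<Rightarrow> 'm cvec) set) \<Rightarrow>
    (nat \<Rightarrow> 'm cvec set) \<Rightarrow> (nat \<Rightarrow> ('m cvec \<Rightarrow> 'm cvec)) \<Rightarrow> bool" where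
  "defined_on V \<omega> U g \<longleftrightarrow> (\<forall>k. open (U k) \<and> 0 \<in> U k \<and> holo_on (U k) (g k) \<and> g k \<in> \<omega> k)
     \<and> (\<forall>n. \<forall>z\<in>V. compo g n z \<in> U n)"

text \<open>The origin is in the Fatou set of the sequence omega.\<close>
definition fatou_at_0 :: "(nat \<Rightarrow> ('m::finite cvec \<Rightarrow> 'm cvec) set) \<Rightarrow> bool" where
  "fatou_at_0 \<omega> \<longleftrightarrow> (\<exists>V U g. open V \<and> 0 \<in> V \<and> defined_on V \<omega> U g
       \<and> (\<forall>n\<ge>1. holo_on V (compo g n))
       \<and> normal_family V {compo g n | n. n \<ge> 1})"

text \<open>The origin lies in the random Fatou set of nu.\<close>
definition random_fatou_0 :: "('m::finite cvec \<Rightarrow> 'm cvec) set measure \<Rightarrow> bool" where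
  "random_fatou_0 \<nu> \<longleftrightarrow> (AE \<omega> in PiM UNIV (\<lambda>_. \<nu>). fatou_at_0 \<omega>)"

section \<open>Lyapunov classification\<close>

definition adjointC :: "'m::finite cmat \<Rightarrow> 'm cmat" where
  "adjointC A = (\<chi> i j. cnj (A $ j $ i))"

definition cinner :: "'m::finite cvec \<Rightarrow> 'm cvec \<Rightarrow> complex" where
  "cinner x y = (\<Sum>i\<in>UNIV. cnj (x $ i) * y $ i)"

definition hermitian_psd :: "'m::finite cmat \<Rightarrow> bool" where
  "hermitian_psd Y \<longleftrightarrow> adjointC Y = Y \<and> (\<forall>x. Re (cinner x (Y *v x)) \<ge> 0)"

definition mpow :: "'m::finite cmat \<Rightarrow> nat \<Rightarrow> 'm cmat" where
  "mpow Y k = (((**) Y) ^^ k) (mat 1)"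

text \<open>The (unique) positive semidefinite Hermitian k-th root.\<close>
definition mroot :: "nat \<Rightarrow> 'm::finite cmat \<Rightarrow> 'm cmat" where
  "mroot k X = (THE Y. hermitian_psd Y \<and> mpow Y k = X)"

definition eigenval :: "'m::finite cmat \<Rightarrow> complex \<Rightarrow> bool" where
  "eigenval A c \<longleftrightarrow> (\<exists>x. x \<noteq> 0 \<and> A *v x = c *s x)"

text \<open>M^n_omega = M_n ... M_1 with M_i = omega (i-1).\<close>
fun mprod :: "(nat \<Rightarrow> 'm::finite cmat) \<Rightarrow> nat \<Rightarrow> 'm cmat" where
  "mprod M 0 = mat 1"
| "mprod M (Suc n) = M n ** mprod M n"

text \<open>Oseledets limit: ((M^n)^* M^n)^(1/(2n)) converges to L.
  Its eigenvalues are the e^{kappa_i}; kappa_1 is the log of the largest.\<close>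
definition oseledets_lim :: "(nat \<Rightarrow> 'm::finite cmat) \<Rightarrow> 'm cmat \<Rightarrow> bool" where
  "oseledets_lim M L \<longleftrightarrow> ((\<lambda>n. mroot (2*n) (adjointC (mprod M n) ** mprod M n)) \<longlonglongrightarrow> L)"

text \<open>attracting: kappa_1 < 0, i.e. every e^{kappa_i} < 1.\<close>
definition attracting_mat :: "'m::finite cmat measure \<Rightarrow> bool" where
  "attracting_mat \<eta> \<longleftrightarrow> (AE M in PiM UNIV (\<lambda>_. \<eta>). \<exists>L. oseledets_lim M L \<and>
       (\<forall>c. eigenval L c \<longrightarrow> cmod c < 1))"

text \<open>repelling: kappa_1 > 0, i.e. some e^{kappa_i} > 1.\<close>
definition repelling_mat :: "'m::finite cmat measure \<Rightarrow> bool" where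
  "repelling_mat \<eta> \<longleftrightarrow> (AE M in PiM UNIV (\<lambda>_. \<eta>). \<exists>L. oseledets_lim M L \<and>
       (\<exists>c. eigenval L c \<and> cmod c > 1))"

text \<open>neutral: spectrum {(0,m)}, i.e. every e^{kappa_i} = 1.\<close>
definition neutral_mat :: "'m::finite cmat measure \<Rightarrow> bool" where
  "neutral_mat \<eta> \<longleftrightarrow> (AE M in PiM UNIV (\<lambda>_. \<eta>). \<exists>L. oseledets_lim M L \<and>
       (\<forall>c. eigenval L c \<longrightarrow> c = 1))"

definition attracting :: "('m::finite cvec \<Rightarrow> 'm cvec) set measure \<Rightarrow> bool" where
  "attracting \<nu> \<longleftrightarrow> attracting_mat (distr \<nu> borel d0)"

definition repelling :: "('m::finite cvec \<Rightarrow> 'm cvec) set measure \<Rightarrow> bool" where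
  "repelling \<nu> \<longleftrightarrow> repelling_mat (distr \<nu> borel d0)"

definition neutral :: "('m::finite cvec \<Rightarrow> 'm cvec) set measure \<Rightarrow> bool" where
  "neutral \<nu> \<longleftrightarrow> neutral_mat (distr \<nu> borel d0)"

section \<open>Linearization and unitary conjugacy\<close>

text \<open>The germs in S are simultaneously linearizable: a holomorphic germ phi fixing 0,
  invertible (as a germ) at 0, with phi o f = df(0) . phi near 0 for all f in S.\<close>
definition simult_linearizable :: "('m::finite cvec \<Rightarrow> 'm cvec) set set \<Rightarrow> bool" where
  "simult_linearizable S \<longleftrightarrow> (\<exists>\<phi> \<psi> r s. r > 0 \<and> s > 0 \<and>
      holo_on (ball 0 r) \<phi> \<and> \<phi> 0 = 0 \<and> holo_on (ball 0 s) \<psi> \<and> \<psi> 0 = 0 \<and>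
      (\<forall>\<^sub>F z in nhds 0. \<psi> (\<phi> z) = z) \<and> (\<forall>\<^sub>F w in nhds 0. \<phi> (\<psi> w) = w) \<and>
      (\<forall>F\<in>S. \<forall>f\<in>F. \<forall>\<^sub>F z in nhds 0. \<phi> (f z) = d0 F *v \<phi> z))"

definition unitary_grp :: "'m::finite cmat set" where
  "unitary_grp = {A. A ** adjointC A = mat 1 \<and> adjointC A ** A = mat 1}"

text \<open>dS_nu = { d f^n_omega(0) : omega in Omega, n \<ge> 1 }.\<close>
definition dS :: "('m::finite cvec \<Rightarrow> 'm cvec) set set \<Rightarrow> 'm cmat set" where
  "dS Supp = {dmat (compo (\<lambda>k. rep (\<omega> k)) n) | \<omega> n. (\<forall>i. \<omega> i \<in> Supp) \<and> n \<ge> 1}"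

definition conj_to_unitary :: "'m::finite cmat set \<Rightarrow> bool" where
  "conj_to_unitary D \<longleftrightarrow> (\<exists>P Q :: 'm cmat. P ** Q = mat 1 \<and> Q ** P = mat 1 \<and>
      (\<forall>A\<in>D. P ** A ** Q \<in> unitary_grp))"

end

theory Submission
  imports Defs "HOL-Complex_Analysis.Complex_Analysis"
begin

text \<open>
Compactness of the support puts all its germs on one ball with one bound, so Cauchy estimates, Montel's
theorem and a quantitative open mapping theorem hold with uniform constants.

Attracting case: a negative top exponent makes \<open>E ln (\<parallel>M\<^sup>N\<parallel> + \<delta>) < 0\<close> for some block length \<open>N\<close>; then some
moment \<open>E (\<parallel>M\<^sup>N\<parallel> + \<delta>)\<^sup>s\<close> is below 1, the products over consecutive blocks tend to 0 almost surely, and they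
dominate the nonlinear orbits near the origin.

Repelling case: normality bounds the differentials, by the Cauchy estimates.

Neutral case: in the Fatou set the products of \<open>|det df\<^sub>i(0)|\<close> are bounded and grow subexponentially, which forces
\<open>|det df(0)| = 1\<close> on the support. The differentials of a typical orbit are then uniformly invertible, so its
iterates cover a fixed ball, and all shifts of that orbit are stable on it. Every finite word in the support is
approximated along a typical orbit, so all words are stable on one ball. The circumcentre of the orbit
of the standard Hermitian form, resp. of the identity map under \<open>\<phi> \<mapsto> dg(0)\<^sup>-\<^sup>1 \<phi> \<circ> g\<close>, is an invariant form, resp.
a linearizing map; no Haar measure is needed.
\<close>

section \<open>Self-adjoint maps and positive semidefinite roots\<close>

text \<open>Only two scalars are read off the Oseledets limit: its operator norm, which is the
  growth rate of the norms, and its determinant. As \<open>mroot\<close> is a definite description,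
  existence and uniqueness of positive semidefinite roots must be settled before either is
  accessible. The summand \<delta> of the attracting case has two tasks: it keeps the logarithm
  bounded when products degenerate (exponents may be minus infinity), and it absorbs the quadratic
  Taylor error of a block. The obstacle in the neutral case is that a Fatou neighbourhood depends on
  \<omega>; control of determinants makes it uniform. The words form only a semigroup. The
  circumcentre minimises a supremum over all of its elements, and acting by one element merely
  restricts that supremum to fewer terms, so near minimisers go to near minimisers. Two near
  minimisers are close after the action of just one uncontrolled element; uniform bounds on inverses
  undo that action for forms, and for maps one also needs a ball covered by all words.\<close>

lemma selfadjoint_max_eigenvector:
  fixes f :: "'a::euclidean_space \<Rightarrow> 'a"
  assumes lin: "linear f" and sa: "\<And>x y. inner (f x) y = inner x (f y)"
    and W: "subspace W" "W \<noteq> {0}" "\<And>x. x \<in> W \<Longrightarrow> f x \<in> W"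
  obtains v l where "v \<in> W" "norm v = 1" "f v = l *\<^sub>R v"
    "\<And>x. x \<in> W \<Longrightarrow> inner x (f x) \<le> l * (norm x)\<^sup>2"
proof -
  have cont: "continuous_on S f" for S
    using lin by (simp add: linear_continuous_on linear_linear)
  define K where "K = sphere 0 1 \<inter> W"
  have "compact K" unfolding K_def
    using closed_subspace[OF W(1)] by (simp add: compact_Int_closed)
  moreover have "K \<noteq> {}"
  proof -
    obtain w where w: "w \<in> W" "w \<noteq> 0" using W subspace_0 by blast
    then have "(1 / norm w) *\<^sub>R w \<in> K"
      unfolding K_def using W(1) by (simp add: subspace_scale)
    then show ?thesis by auto
  qed
  moreover have "continuous_on K (\<lambda>x. inner x (f x))"
    by (intro continuous_intros cont)
  ultimately obtain v where v: "v \<in> K" "\<And>x. x \<in> K \<Longrightarrow> inner x (f x) \<le> inner v (f v)"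
    using continuous_attains_sup by metis
  define l where "l = inner v (f v)"
  have le: "inner x (f x) \<le> l * (norm x)\<^sup>2" if "x \<in> W" for x
  proof (cases "x = 0")
    case True then show ?thesis using linear_0[OF lin] by simp
  next
    case False
    then have "(1 / norm x) *\<^sub>R x \<in> K"
      unfolding K_def using that W(1) by (simp add: subspace_scale)
    from v(2)[OF this] have "inner x (f x) / (norm x)\<^sup>2 \<le> l"
      by (simp add: l_def linear_scale[OF lin] power2_eq_square)
    then show ?thesis using False by (simp add: field_simps)
  qed
  \<comment> \<open>The residual of the eigenvalue equation. Moving the maximiser v to v + t w
    changes l |x|^2 - <x, f x> from 0 to 2 t |w|^2 + t^2 c, which can be nonnegative for all t only
    if w = 0.\<close>
  define w where "w = l *\<^sub>R v - f v"
  have vW: "v \<in> W" "norm v = 1" using v(1) by (auto simp: K_def)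
  then have wW: "w \<in> W" unfolding w_def using W by (simp add: subspace_diff subspace_scale)
  define c where "c = l * (norm w)\<^sup>2 - inner w (f w)"
  have Q: "0 \<le> 2 * t * (norm w)\<^sup>2 + t\<^sup>2 * c" for t
  proof -
    have "v + t *\<^sub>R w \<in> W" using W vW wW by (simp add: subspace_add subspace_scale)
    from le[OF this] have *: "0 \<le> l * (norm (v + t *\<^sub>R w))\<^sup>2 - inner (v + t *\<^sub>R w) (f (v + t *\<^sub>R w))"
      by simp
    have n: "(norm (v + t *\<^sub>R w))\<^sup>2 = 1 + 2 * t * inner w v + t\<^sup>2 * (norm w)\<^sup>2"
      using vW(2) unfolding norm_eq_square power2_norm_eq_inner
      by (simp add: inner_add inner_commute power2_eq_square algebra_simps norm_eq_1)
    have i: "inner (v + t *\<^sub>R w) (f (v + t *\<^sub>R w))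
             = l + 2 * t * inner w (f v) + t\<^sup>2 * inner w (f w)"
      using sa[of v w]
      by (simp add: linear_add[OF lin] linear_scale[OF lin] inner_add inner_commute
          l_def power2_eq_square algebra_simps)
    have ww: "(norm w)\<^sup>2 = l * inner w v - inner w (f v)"
      unfolding power2_norm_eq_inner by (subst (2) w_def) (simp add: inner_diff_right)
    from * show ?thesis unfolding n i ww c_def by (simp add: algebra_simps)
  qed
  have "(norm w)\<^sup>2 = 0"
  proof (rule ccontr)
    assume nz: "(norm w)\<^sup>2 \<noteq> 0"
    define b where "b = (norm w)\<^sup>2"
    have b: "b > 0" using nz by (simp add: b_def)
    \<comment> \<open>The vertex of the parabola 2 t b + t^2 (|c| + 1), which dominates the one in
      \<open>Q\<close>.\<close>
    define t where "t = - b / (\<bar>c\<bar> + 1)"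
    have cp: "\<bar>c\<bar> + 1 > 0" by simp
    have "2 * t * b + t\<^sup>2 * c \<le> 2 * t * b + t\<^sup>2 * (\<bar>c\<bar> + 1)"
      by (intro add_left_mono mult_left_mono) auto
    also have "\<dots> = - b\<^sup>2 / (\<bar>c\<bar> + 1)"
    proof -
      have "2 * (- b / k) * b + (- b / k)\<^sup>2 * k = - b\<^sup>2 / k" if "k > 0" for k :: real
        using that by (simp add: field_simps power2_eq_square)
      from this[OF cp] show ?thesis by (simp add: t_def)
    qed
    also have "\<dots> < 0" using b cp by (simp add: field_simps)
    finally show False using Q[of t] by (simp add: b_def)
  qed
  then have "f v = l *\<^sub>R v" by (simp add: w_def)
  then show ?thesis using that vW le by blast
qed

text \<open>The orthogonal complement of the eigenvectors is invariant; were it nonzero, maximising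
  the Rayleigh quotient on it would produce another eigenvector, orthogonal to itself.\<close>

lemma selfadjoint_eigenvectors_span:
  fixes f :: "'a::euclidean_space \<Rightarrow> 'a"
  assumes lin: "linear f" and sa: "\<And>x y. inner (f x) y = inner x (f y)"
  shows "span {v. \<exists>l. f v = l *\<^sub>R v} = UNIV"
proof (rule ccontr)
  let ?E = "span {v. \<exists>l. f v = l *\<^sub>R v}"
  assume "?E \<noteq> UNIV"
  define W where "W = {x. \<forall>e\<in>?E. inner e x = 0}"
  have subW: "subspace W"
    unfolding W_def subspace_def by (auto simp: inner_add_right)
  have Einv: "f e \<in> ?E" if "e \<in> ?E" for e
    using that
  proof (induction rule: span_induct_alt)
    case base then show ?case using linear_0[OF lin] by (simp add: span_zero)
  next
    case (step c x y)
    then obtain l where "f x = l *\<^sub>R x" by auto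
    then have "f (c *\<^sub>R x + y) = (c * l) *\<^sub>R x + f y"
      by (simp add: linear_add[OF lin] linear_scale[OF lin])
    moreover have "(c * l) *\<^sub>R x \<in> ?E" using step(1) by (simp add: span_base span_scale)
    ultimately show ?case using step(2) by (simp add: span_add)
  qed
  have Winv: "f x \<in> W" if "x \<in> W" for x
    using that Einv unfolding W_def by (simp flip: sa)
  have "W \<noteq> {0}"
  proof -
    obtain x where "x \<noteq> 0" "\<And>y. y \<in> ?E \<Longrightarrow> orthogonal x y"
    proof (rule orthogonal_to_subspace_exists_gen[of "{v. \<exists>l. f v = l *\<^sub>R v}" UNIV])
      show "?E \<subset> span UNIV" using \<open>?E \<noteq> UNIV\<close> by auto
    qed blast
    then show ?thesis unfolding W_def by (auto simp: orthogonal_def inner_commute)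
  qed
  from selfadjoint_max_eigenvector[OF lin sa subW this Winv]
  obtain v l where v: "v \<in> W" "norm v = 1" "f v = l *\<^sub>R v" by blast
  then have "v \<in> ?E" by (auto intro: span_base)
  with v(1) have "inner v v = 0" by (auto simp: W_def)
  then show False using v(2) by simp
qed

text \<open>One eigenvector per eigenvalue gives an orthogonal, hence independent, family.
  Finiteness is what permits interpolation on the spectrum.\<close>

lemma selfadjoint_eigenvalues_finite:
  fixes f :: "'a::euclidean_space \<Rightarrow> 'a"
  assumes sa: "\<And>x y. inner (f x) y = inner x (f y)"
  shows "finite {l. \<exists>v. v \<noteq> 0 \<and> f v = l *\<^sub>R v}"
proof -
  let ?L = "{l. \<exists>v. v \<noteq> 0 \<and> f v = l *\<^sub>R v}"
  have "\<forall>l\<in>?L. \<exists>v. v \<noteq> 0 \<and> f v = l *\<^sub>R v" by simp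
  then obtain e where e: "\<And>l. l \<in> ?L \<Longrightarrow> e l \<noteq> 0 \<and> f (e l) = l *\<^sub>R e l"
    using bchoice by (metis (no_types, lifting))
  have orth: "inner (e l) (e m) = 0" if "l \<in> ?L" "m \<in> ?L" "l \<noteq> m" for l m
    using sa[of "e l" "e m"] e[OF that(1)] e[OF that(2)] that(3) by simp
  have inj: "inj_on e ?L"
    by (rule inj_onI) (metis (no_types, lifting) e inner_eq_zero_iff orth)
  have "pairwise orthogonal (e ` ?L)"
    unfolding pairwise_def orthogonal_def using orth by (metis (no_types, lifting) imageE)
  moreover have "0 \<notin> e ` ?L" using e by (metis (no_types, lifting) imageE)
  ultimately have "independent (e ` ?L)" by (rule pairwise_orthogonal_independent)
  then have "finite (e ` ?L)" by (rule independent_imp_finite)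
  then show ?thesis using inj finite_imageD by blast
qed

section \<open>Hermitian matrices as self-adjoint real maps: functional calculus and roots\<close>

lemma inner_complex_eq_Re: "inner (x::complex) y = Re (cnj x * y)"
  by (simp add: inner_complex_def)

text \<open>Complex vectors are treated as a real Euclidean space, where Hermitian matrices are
  self-adjoint, so that the real spectral results apply to them.\<close>

lemma inner_eq_Re_cinner: "inner x y = Re (cinner x y)"
  by (simp add: cinner_def inner_vec_def inner_complex_eq_Re)

lemma cinner_adjointC: "cinner (A *v x) y = cinner x (adjointC A *v y)"
proof -
  have "cinner (A *v x) y = (\<Sum>i\<in>UNIV. \<Sum>j\<in>UNIV. cnj (A $ i $ j) * cnj (x $ j) * y $ i)"
    by (simp add: cinner_def matrix_vector_mult_def sum_distrib_right)
  also have "\<dots> = (\<Sum>j\<in>UNIV. \<Sum>i\<in>UNIV. cnj (A $ i $ j) * cnj (x $ j) * y $ i)"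
    by (rule sum.swap)
  also have "\<dots> = cinner x (adjointC A *v y)"
    by (simp add: cinner_def matrix_vector_mult_def adjointC_def sum_distrib_left mult_ac)
  finally show ?thesis .
qed

lemma inner_adjointC: "inner (A *v x) y = inner x (adjointC A *v y)"
  by (simp add: inner_eq_Re_cinner cinner_adjointC)

lemma adjointC_adjointC [simp]: "adjointC (adjointC A) = A"
  by (simp add: adjointC_def vec_eq_iff)

lemma adjointC_mult: "adjointC (A ** B) = adjointC B ** adjointC (A::'m::finite cmat)"
  by (simp add: adjointC_def matrix_matrix_mult_def vec_eq_iff mult.commute)

lemma adjointC_mat_1 [simp]: "adjointC (mat 1 :: 'm::finite cmat) = mat 1"
  by (simp add: adjointC_def mat_def vec_eq_iff)

lemma det_adjointC: "det (adjointC A) = cnj (det A)"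
proof -
  have "det (adjointC A) = det (\<chi> i j. cnj (A $ i $ j))"
    by (subst det_transpose[symmetric]) (simp add: transpose_def adjointC_def)
  also have "\<dots> = cnj (det A)"
    by (simp add: det_def)
  finally show ?thesis .
qed

lemma matrix_vector_scaleR: "(A::'m::finite cmat) *v (c *\<^sub>R x) = c *\<^sub>R (A *v x)"
  using linear_scale[OF matrix_vector_mul_linear] by blast

lemma scaleR_matrix_vector: "(c *\<^sub>R (A::'m::finite cmat)) *v x = c *\<^sub>R (A *v x)"
  by (simp add: matrix_vector_mult_def vec_eq_iff scaleR_sum_right)

lemma scaleR_eq_smult: "c *\<^sub>R (x::'m::finite cvec) = complex_of_real c *s x"
  by (simp add: vec_eq_iff scaleR_conv_of_real[where 'a = complex])

lemma hermitian_selfadjoint: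
  "adjointC H = H \<Longrightarrow> inner (H *v x) y = inner x (H *v y)"
  by (simp add: inner_adjointC)

lemma hermitian_psd_inner: "hermitian_psd Y \<longleftrightarrow> adjointC Y = Y \<and> (\<forall>x. 0 \<le> inner x (Y *v x))"
  by (simp add: hermitian_psd_def inner_eq_Re_cinner)

lemma hermitian_psd_adjoint_mult: "hermitian_psd (adjointC A ** A)"
  by (simp add: hermitian_psd_inner adjointC_mult flip: matrix_vector_mul_assoc inner_adjointC)

lemma matrix_eqI_span:
  fixes A B :: "'m::finite cmat"
  assumes "span S = UNIV" "\<And>v. v \<in> S \<Longrightarrow> A *v v = B *v v"
  shows "A = B"
proof -
  have "A *v v = B *v v" for v
    by (rule linear_eq_on_span[of "(*v) A" "(*v) B" S v]) (use assms in auto)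
  then show ?thesis by (simp add: matrix_eq)
qed

text \<open>N is the product of the factors H - a over a in S, and n is the same polynomial in a
  scalar. Recording only the action on eigenvectors avoids a theory of matrix polynomials.\<close>

lemma matrix_annihilating_eigenvalues:
  fixes H :: "'m::finite cmat"
  assumes "finite S"
  shows "\<exists>N n. (\<forall>l v. H *v v = l *\<^sub>R v \<longrightarrow> N *v v = n l *\<^sub>R v) \<and> (\<forall>l. n l = 0 \<longleftrightarrow> l \<in> (S::real set))"
  using assms
proof (induction S)
  case empty
  have "(\<forall>l v. H *v v = l *\<^sub>R v \<longrightarrow> mat 1 *v v = 1 *\<^sub>R v) \<and> (\<forall>l. (1::real) = 0 \<longleftrightarrow> l \<in> {})" by simp
  then show ?case by (intro exI[of _ "mat 1"] exI[of _ "\<lambda>_. 1"]) simp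
next
  case (insert a S)
  then obtain N n where N: "\<And>l v. H *v v = l *\<^sub>R v \<Longrightarrow> N *v v = n l *\<^sub>R v" "\<And>l. n l = 0 \<longleftrightarrow> l \<in> S"
    by auto
  let ?N = "H ** N - a *\<^sub>R N"
  have "?N *v v = ((l - a) * n l) *\<^sub>R v" if "H *v v = l *\<^sub>R v" for l v
    using that N(1)[OF that]
    by (simp add: matrix_vector_mult_diff_rdistrib scaleR_matrix_vector matrix_vector_scaleR
        algebra_simps flip: matrix_vector_mul_assoc)
  moreover have "(l - a) * n l = 0 \<longleftrightarrow> l \<in> insert a S" for l using N(2)[of l] by auto
  ultimately show ?case by (intro exI[of _ ?N] exI[of _ "\<lambda>l. (l - a) * n l"]) simp
qed

text \<open>Newton interpolation: at a new node a, a multiple of the polynomial that vanishes on S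
  corrects the value without disturbing the earlier ones.\<close>

lemma matrix_interpolating_eigenvalues:
  fixes H :: "'m::finite cmat" and p :: "real \<Rightarrow> real"
  assumes "finite S"
  shows "\<exists>T t. (\<forall>l v. H *v v = l *\<^sub>R v \<longrightarrow> T *v v = t l *\<^sub>R v) \<and> (\<forall>l\<in>S. t l = p l)"
  using assms
proof (induction S)
  case empty
  have "(\<forall>l v. H *v v = l *\<^sub>R v \<longrightarrow> mat 1 *v v = 1 *\<^sub>R v)" by simp
  then show ?case by (intro exI[of _ "mat 1"] exI[of _ "\<lambda>_. 1"]) simp
next
  case (insert a S)
  then obtain T t where T: "\<And>l v. H *v v = l *\<^sub>R v \<Longrightarrow> T *v v = t l *\<^sub>R v" "\<And>l. l \<in> S \<Longrightarrow> t l = p l"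
    by blast
  obtain N n where N: "\<And>l v. H *v v = l *\<^sub>R v \<Longrightarrow> N *v v = n l *\<^sub>R v" "\<And>l. n l = 0 \<longleftrightarrow> l \<in> S"
    using matrix_annihilating_eigenvalues[OF insert(1), of H] by blast
  define c where "c = (p a - t a) / n a"
  have na: "n a \<noteq> 0" using N(2) insert(2) by blast
  have "(T + c *\<^sub>R N) *v v = (t l + c * n l) *\<^sub>R v" if "H *v v = l *\<^sub>R v" for l v
    using T(1)[OF that] N(1)[OF that]
    by (simp add: matrix_vector_mult_add_rdistrib scaleR_matrix_vector algebra_simps)
  moreover have "t l + c * n l = p l" if "l \<in> insert a S" for l
    using that T(2) N(2) na insert(2) by (cases "l = a") (auto simp: c_def)
  ultimately show ?case by (intro exI[of _ "T + c *\<^sub>R N"] exI[of _ "\<lambda>l. t l + c * n l"]) simp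
qed

text \<open>T is p(H) for an arbitrary function p, because p need only be interpolated on the finite
  spectrum. Eigenvectors for different eigenvalues are orthogonal, so T is symmetric on a spanning
  set.\<close>

lemma hermitian_functional_calculus:
  fixes H :: "'m::finite cmat" and p :: "real \<Rightarrow> real"
  assumes H: "adjointC H = H"
  obtains T where "adjointC T = T" "\<And>l v. H *v v = l *\<^sub>R v \<Longrightarrow> T *v v = p l *\<^sub>R v"
proof -
  let ?L = "{l. \<exists>v. v \<noteq> 0 \<and> H *v v = l *\<^sub>R v}"
  let ?E = "{v. \<exists>l. H *v v = l *\<^sub>R v}"
  have fin: "finite ?L"
    by (rule selfadjoint_eigenvalues_finite) (rule hermitian_selfadjoint[OF H])
  obtain T t where T: "\<And>l v. H *v v = l *\<^sub>R v \<Longrightarrow> T *v v = t l *\<^sub>R v" "\<And>l. l \<in> ?L \<Longrightarrow> t l = p l"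
    using matrix_interpolating_eigenvalues[OF fin, of H p] by blast
  have Tp: "T *v v = p l *\<^sub>R v" if "H *v v = l *\<^sub>R v" for l v
    using T(1)[of v l] T(2)[of l] that by (cases "v = 0") auto
  have sp: "span ?E = UNIV"
    using selfadjoint_eigenvectors_span[of "(*v) H"] hermitian_selfadjoint[OF H] by simp
  have inn: "inner u (T *v v) = inner u (adjointC T *v v)" if uv: "u \<in> ?E" "v \<in> ?E" for u v
  proof -
    obtain l m where lm: "H *v u = l *\<^sub>R u" "H *v v = m *\<^sub>R v" using uv by auto
    show ?thesis
    proof (cases "l = m")
      case True
      then show ?thesis using Tp[OF lm(1)] Tp[OF lm(2)] by (simp flip: inner_adjointC)
    next
      case False
      then have "inner u v = 0" using hermitian_selfadjoint[OF H, of u v] lm by simp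
      then show ?thesis using Tp[OF lm(1)] Tp[OF lm(2)] by (simp flip: inner_adjointC)
    qed
  qed
  have "T = adjointC T"
  proof (rule matrix_eqI_span[OF sp])
    fix v assume v: "v \<in> ?E"
    let ?d = "T *v v - adjointC T *v v"
    have "inner x ?d = 0" if "x \<in> span ?E" for x
      using that
    proof (induction rule: span_induct_alt)
      case (step c x y)
      then show ?case using inn[OF step(1) v] by (simp add: inner_add_left inner_diff_right)
    qed simp
    then have "inner ?d ?d = 0" using sp by blast
    then show "T *v v = adjointC T *v v" by simp
  qed
  then show ?thesis using that Tp by metis
qed

lemma mpow_Suc: "mpow Y (Suc k) = Y ** mpow Y k"
  by (simp add: mpow_def)

lemma mpow_0: "mpow Y 0 = mat 1"
  by (simp add: mpow_def)

lemma mpow_eigenvector: "Y *v v = l *\<^sub>R v \<Longrightarrow> mpow Y k *v v = (l ^ k) *\<^sub>R v"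
  by (induction k) (auto simp: mpow_Suc mpow_0 matrix_vector_scaleR simp flip: matrix_vector_mul_assoc)

lemma hermitian_psd_eigenvalue_nonneg:
  assumes "hermitian_psd Y" "Y *v v = l *\<^sub>R v" "v \<noteq> 0"
  shows "0 \<le> l"
proof -
  have "0 \<le> l * inner v v" using assms by (metis hermitian_psd_inner inner_scaleR_right)
  then show ?thesis using assms(3) by (metis inner_gt_zero_iff mult_less_0_iff not_le)
qed

lemma hermitian_psd_root_ex1:
  fixes X :: "'m::finite cmat"
  assumes X: "hermitian_psd X" and k: "0 < k"
  shows "\<exists>!Y. hermitian_psd Y \<and> mpow Y k = X"
proof -
  have H: "adjointC X = X" using X by (simp add: hermitian_psd_def)
  \<comment> \<open>A square root of \<open>root k\<close> is taken first so that T = S ** S is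
    visibly positive semidefinite.\<close>
  obtain S where S: "adjointC S = S" "\<And>l v. X *v v = l *\<^sub>R v \<Longrightarrow> S *v v = sqrt (root k l) *\<^sub>R v"
    using hermitian_functional_calculus[OF H, of "\<lambda>l. sqrt (root k l)"] by blast
  define T where "T = S ** S"
  have T: "T *v v = root k l *\<^sub>R v" if "X *v v = l *\<^sub>R v" for l v
  proof (cases "v = 0")
    case False
    then have "0 \<le> root k l" using hermitian_psd_eigenvalue_nonneg[OF X that] k by simp
    then show ?thesis
      using S(2)[OF that] by (simp add: T_def matrix_vector_scaleR flip: matrix_vector_mul_assoc)
  qed simp
  have spanE: "span {v. \<exists>l. Y *v v = l *\<^sub>R v} = UNIV" if "hermitian_psd Y" for Y :: "'m cmat"
    using selfadjoint_eigenvectors_span[of "(*v) Y"] hermitian_selfadjoint[of Y] that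
    by (simp add: hermitian_psd_def)
  have "hermitian_psd T" unfolding T_def using hermitian_psd_adjoint_mult[of S] S(1) by simp
  moreover have "mpow T k = X"
  proof (rule matrix_eqI_span[OF spanE[OF X]], clarify)
    fix v l assume v: "X *v v = l *\<^sub>R v"
    show "mpow T k *v v = X *v v"
    proof (cases "v = 0")
      case False
      then have "0 \<le> l" using hermitian_psd_eigenvalue_nonneg[OF X v] by simp
      then show ?thesis using mpow_eigenvector[OF T[OF v], of k] v k by simp
    qed simp
  qed
  \<comment> \<open>Uniqueness: an eigenvector of Y for l is one of X for l^k, and T acts on it by
    the k-th root of l^k, that is, by l.\<close>
  moreover have "Y = T" if Y: "hermitian_psd Y" "mpow Y k = X" for Y
  proof (rule matrix_eqI_span[OF spanE[OF Y(1)]], clarify)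
    fix v l assume v: "Y *v v = l *\<^sub>R v"
    show "Y *v v = T *v v"
    proof (cases "v = 0")
      case False
      then have "0 \<le> l" using hermitian_psd_eigenvalue_nonneg[OF Y(1) v] by simp
      then show ?thesis
        using T[of v "l ^ k"] mpow_eigenvector[OF v, of k] Y(2) v k
        by (simp add: real_root_power_cancel)
    qed simp
  qed
  ultimately show ?thesis by blast
qed

lemma mroot:
  fixes X :: "'m::finite cmat"
  assumes "hermitian_psd X" "0 < k"
  shows "hermitian_psd (mroot k X)" "mpow (mroot k X) k = X"
  using theI'[OF hermitian_psd_root_ex1[OF assms]] unfolding mroot_def by auto

section \<open>Operator norm and determinant of the Oseledets roots\<close>

abbreviation opnorm :: "'m::finite cmat \<Rightarrow> real" where
  "opnorm A \<equiv> onorm ((*v) A)"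

lemma norm_mult_le_opnorm: "norm (A *v x) \<le> opnorm A * norm (x::'m::finite cvec)"
  by (rule onorm) simp

lemma opnorm_nonneg: "0 \<le> opnorm (A::'m::finite cmat)"
  by (rule onorm_pos_le) simp

lemma opnorm_mult_le: "opnorm (A ** B) \<le> opnorm A * opnorm (B::'m::finite cmat)"
  using onorm_compose[of "(*v) A" "(*v) B"] by (simp add: o_def matrix_vector_mul_assoc)

text \<open>The squared norm is the top eigenvalue l of R R. For a unit eigenvector v, the vector w
  = R v - sqrt l v satisfies R w = - sqrt l w, which positivity allows only if w or l
  vanishes.\<close>

lemma hermitian_psd_opnorm_eigenvector:
  assumes R: "hermitian_psd (R::'m::finite cmat)"
  obtains v where "norm v = 1" "R *v v = opnorm R *\<^sub>R v"
proof -
  have H: "adjointC R = R" using R by (simp add: hermitian_psd_def)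
  let ?f = "\<lambda>x. R *v (R *v x)"
  have lin: "linear ?f"
    using linear_compose[of "(*v) R" "(*v) R"] by (simp add: o_def)
  have sa: "inner (?f x) y = inner x (?f y)" for x y
    by (simp add: hermitian_selfadjoint[OF H])
  have nt: "UNIV \<noteq> {0::'m cvec}"
    by (metis UNIV_I singletonD zero_neq_one)
  obtain v l where v: "norm v = 1" "?f v = l *\<^sub>R v" and
    le: "\<And>x. inner x (?f x) \<le> l * (norm x)\<^sup>2"
    by (rule selfadjoint_max_eigenvector[OF lin sa subspace_UNIV nt]) auto
  have sq: "(norm (R *v x))\<^sup>2 = inner x (?f x)" for x
    by (simp add: hermitian_selfadjoint[OF H] power2_norm_eq_inner)
  have "inner v v = 1" using v(1) by (simp add: norm_eq_1)
  then have lv: "(norm (R *v v))\<^sup>2 = l" using sq[of v] v by simp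
  then have l0: "0 \<le> l" by (metis zero_le_power2)
  have "norm (R *v x) \<le> sqrt l * norm x" for x
    using le[of x] unfolding sq[symmetric]
    by (metis norm_ge_zero power2_le_imp_le power_mult_distrib real_sqrt_ge_zero real_sqrt_pow2 l0 mult_nonneg_nonneg)
  then have "opnorm R \<le> sqrt l" by (intro onorm_bound) (auto simp: l0)
  moreover have "sqrt l \<le> opnorm R"
    using norm_mult_le_opnorm[of R v] v(1) lv by (metis mult.right_neutral norm_ge_zero real_sqrt_unique)
  ultimately have op: "opnorm R = sqrt l" by simp
  define w where "w = R *v v - sqrt l *\<^sub>R v"
  have "R *v w = - sqrt l *\<^sub>R w"
    using v(2) l0 by (simp add: w_def matrix_vector_mult_diff_distrib matrix_vector_scaleR algebra_simps)
  then have "sqrt l = 0 \<or> w = 0"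
    using hermitian_psd_eigenvalue_nonneg[OF R] l0
    by (metis neg_0_le_iff_le order_antisym real_sqrt_ge_zero)
  moreover have "w = 0" if "sqrt l = 0"
    using lv that l0 by (simp add: w_def)
  ultimately have "R *v v = opnorm R *\<^sub>R v" by (auto simp: w_def op)
  then show ?thesis using that v(1) by blast
qed

lemma opnorm_adjoint_mult: "opnorm (adjointC A ** A) = (opnorm (A::'m::finite cmat))\<^sup>2"
proof (rule antisym)
  let ?R = "adjointC A ** A"
  have sq: "(norm (A *v x))\<^sup>2 = inner x (?R *v x)" for x
    by (simp add: power2_norm_eq_inner inner_adjointC matrix_vector_mul_assoc)
  obtain v where v: "norm v = 1" "?R *v v = opnorm ?R *\<^sub>R v"
    using hermitian_psd_opnorm_eigenvector[OF hermitian_psd_adjoint_mult] by blast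
  have "opnorm ?R = (norm (A *v v))\<^sup>2" using sq[of v] v by (simp add: norm_eq_1)
  also have "\<dots> \<le> (opnorm A)\<^sup>2"
    using norm_mult_le_opnorm[of A v] v(1) by (intro power_mono) auto
  finally show "opnorm ?R \<le> (opnorm A)\<^sup>2" .
  have "norm (A *v x) \<le> sqrt (opnorm ?R) * norm x" for x
  proof -
    have "(norm (A *v x))\<^sup>2 \<le> norm x * (opnorm ?R * norm x)"
      unfolding sq using norm_cauchy_schwarz[of x "?R *v x"] norm_mult_le_opnorm[of ?R x]
      by (meson mult_left_mono norm_ge_zero order_trans)
    then have "(norm (A *v x))\<^sup>2 \<le> (sqrt (opnorm ?R) * norm x)\<^sup>2"
      by (simp add: power_mult_distrib opnorm_nonneg power2_eq_square mult_ac)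
    then show ?thesis by (rule power2_le_imp_le) (simp add: opnorm_nonneg)
  qed
  then have "opnorm A \<le> sqrt (opnorm ?R)" by (intro onorm_bound) (auto simp: opnorm_nonneg)
  then show "(opnorm A)\<^sup>2 \<le> opnorm ?R"
    using opnorm_nonneg[of A] by (metis opnorm_nonneg power_mono real_sqrt_pow2)
qed

text \<open>Equality rather than submultiplicativity, because a top eigenvector of R is an
  eigenvector of all its powers.\<close>

lemma opnorm_mpow:
  assumes "hermitian_psd (R::'m::finite cmat)"
  shows "opnorm (mpow R k) = opnorm R ^ k"
proof (rule antisym)
  have 1: "onorm (\<lambda>x::'m cvec. x) \<le> 1" by (rule onorm_bound) auto
  show "opnorm (mpow R k) \<le> opnorm R ^ k"
  proof (induction k)
    case (Suc k)
    have "opnorm (mpow R (Suc k)) \<le> opnorm R * opnorm (mpow R k)"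
      by (simp add: mpow_Suc opnorm_mult_le)
    also have "\<dots> \<le> opnorm R * opnorm R ^ k" using Suc by (simp add: mult_left_mono opnorm_nonneg)
    finally show ?case by simp
  qed (use 1 in \<open>simp add: mpow_0\<close>)
  obtain v where v: "norm v = 1" "R *v v = opnorm R *\<^sub>R v"
    using hermitian_psd_opnorm_eigenvector[OF assms] by blast
  show "opnorm R ^ k \<le> opnorm (mpow R k)"
    using norm_mult_le_opnorm[of "mpow R k" v] mpow_eigenvector[OF v(2), of k] v(1)
    by (simp add: opnorm_nonneg)
qed

text \<open>\<open>opnorm_adjoint_mult\<close> contributes a square, which cancels the factor 2 in
  the order of the root.\<close>

lemma opnorm_mroot_adjoint_mult:
  fixes A :: "'m::finite cmat"
  assumes "0 < n"
  shows "opnorm (mroot (2*n) (adjointC A ** A)) = root n (opnorm A)"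
proof -
  let ?R = "mroot (2*n) (adjointC A ** A)"
  have R: "hermitian_psd ?R" "mpow ?R (2*n) = adjointC A ** A"
    using mroot[OF hermitian_psd_adjoint_mult, of "2*n" A] assms by auto
  have "(opnorm ?R ^ n)\<^sup>2 = (opnorm A)\<^sup>2"
    using opnorm_mpow[OF R(1), of "2*n"] R(2) opnorm_adjoint_mult[of A]
    by (simp add: power_mult[symmetric] mult.commute)
  then have "opnorm ?R ^ n = opnorm A"
    by (metis opnorm_nonneg power2_eq_iff_nonneg zero_le_power)
  then show ?thesis using assms by (metis opnorm_nonneg real_root_power_cancel)
qed

lemma det_mpow: "det (mpow Y k) = det Y ^ k"
  by (induction k) (auto simp: mpow_Suc mpow_0 det_mul)

lemma det_mroot_adjoint_mult:
  fixes A :: "'m::finite cmat"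
  assumes "0 < n"
  shows "cmod (det (mroot (2*n) (adjointC A ** A))) = root n (cmod (det A))"
proof -
  let ?R = "mroot (2*n) (adjointC A ** A)"
  have R: "hermitian_psd ?R" "mpow ?R (2*n) = adjointC A ** A"
    using mroot[OF hermitian_psd_adjoint_mult, of "2*n" A] assms by auto
  have "cmod (det ?R) ^ (2 * n) = (cmod (det A))\<^sup>2"
    using arg_cong[OF R(2), of "\<lambda>X. cmod (det X)"]
    by (simp add: det_mpow det_mul det_adjointC norm_mult norm_power power2_eq_square)
  then have "(cmod (det ?R) ^ n)\<^sup>2 = (cmod (det A))\<^sup>2"
    by (metis mult.commute power_mult)
  then have "cmod (det ?R) ^ n = cmod (det A)"
    by (simp add: power2_eq_iff_nonneg)
  then show ?thesis using assms by (metis norm_ge_zero real_root_power_cancel)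
qed

lemma bounded_bilinear_matrix_vector:
  "bounded_bilinear (\<lambda>(A::'m::finite cmat) x. A *v x)"
proof -
  have "linear (\<lambda>A::'m cmat. A *v x)" for x
    by (intro linearI matrix_vector_mult_add_rdistrib scaleR_matrix_vector)
  then have "bilinear (\<lambda>(A::'m cmat) x. A *v x)"
    by (simp add: bilinear_def)
  then show ?thesis by (simp add: bilinear_conv_bounded_bilinear)
qed

lemma bounded_bilinear_matrix_mult:
  "bounded_bilinear (\<lambda>(A::'m::finite cmat) B :: 'm cmat. A ** B)"
proof -
  have "linear (\<lambda>A::'m cmat. A ** B)" "linear (\<lambda>A::'m cmat. B ** A)" for B :: "'m cmat"
    by (intro linearI; simp add: matrix_matrix_mult_def vec_eq_iff sum.distrib distrib_left distrib_right scaleR_sum_right)+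
  then have "bilinear (\<lambda>(A::'m cmat) B :: 'm cmat. A ** B)"
    by (simp add: bilinear_def)
  then show ?thesis by (simp add: bilinear_conv_bounded_bilinear)
qed

lemmas tendsto_matrix_vector [tendsto_intros] =
  bounded_bilinear.tendsto[OF bounded_bilinear_matrix_vector]
lemmas tendsto_matrix_mult [tendsto_intros] =
  bounded_bilinear.tendsto[OF bounded_bilinear_matrix_mult]
lemmas continuous_on_matrix_vector [continuous_intros] =
  bounded_bilinear.continuous_on[OF bounded_bilinear_matrix_vector]
lemmas continuous_on_matrix_mult [continuous_intros] =
  bounded_bilinear.continuous_on[OF bounded_bilinear_matrix_mult]

lemma opnorm_le_norm:
  "\<exists>K>0. \<forall>A::'m::finite cmat. opnorm A \<le> K * norm A"
proof -
  obtain K where K: "0 < K" "\<And>(A::'m cmat) x. norm (A *v x) \<le> norm A * norm x * K"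
    using bounded_bilinear.pos_bounded[OF bounded_bilinear_matrix_vector] by blast
  have "opnorm A \<le> K * norm A" for A :: "'m cmat"
    by (rule onorm_bound) (use K in \<open>auto simp: mult_ac intro: mult_nonneg_nonneg\<close>)
  with K(1) show ?thesis by blast
qed

lemma opnorm_triangle: "opnorm (A + B) \<le> opnorm A + opnorm (B::'m::finite cmat)"
  using onorm_triangle[of "(*v) A" "(*v) B"] by (simp add: matrix_vector_mult_add_rdistrib[abs_def])

lemma continuous_on_opnorm [continuous_intros]:
  assumes "continuous_on S f"
  shows "continuous_on S (\<lambda>x. opnorm (f x :: 'm::finite cmat))"
proof -
  obtain K where K: "0 < K" "\<And>A::'m cmat. opnorm A \<le> K * norm A" using opnorm_le_norm by blast
  have lip: "\<bar>opnorm A - opnorm B\<bar> \<le> K * norm (A - B)" for A B :: "'m cmat"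
    using opnorm_triangle[of "A - B" B] opnorm_triangle[of "B - A" A] K(2)[of "A - B"] K(2)[of "B - A"]
    by (simp add: norm_minus_commute abs_le_iff)
  have "continuous_on UNIV (opnorm :: 'm cmat \<Rightarrow> real)"
    unfolding continuous_on_iff
  proof (intro ballI allI impI)
    fix A :: "'m cmat" and e :: real assume "0 < e"
    then show "\<exists>d>0. \<forall>B\<in>UNIV. dist B A < d \<longrightarrow> dist (opnorm B) (opnorm A) < e"
      using lip K(1)
      by (intro exI[of _ "e / K"]) (auto simp: dist_norm field_simps intro: le_less_trans)
  qed
  then show ?thesis using continuous_on_compose2[OF _ assms] by blast
qed

lemma continuous_on_det [continuous_intros]:
  assumes "continuous_on S f"
  shows "continuous_on S (\<lambda>x. det (f x :: 'm::finite cmat))"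
  unfolding det_def by (intro continuous_intros assms)

lemma continuous_on_adjointC [continuous_intros]:
  assumes "continuous_on S f"
  shows "continuous_on S (\<lambda>x. adjointC (f x :: 'm::finite cmat))"
  unfolding adjointC_def by (intro continuous_intros assms)

lemma norm_smult: "norm (c *s (x::'m::finite cvec)) = cmod c * norm x"
  by (simp add: norm_vec_def norm_mult L2_set_right_distrib)

lemma eigenval_le_opnorm:
  assumes "eigenval (L::'m::finite cmat) c"
  shows "cmod c \<le> opnorm L"
proof -
  obtain x where "x \<noteq> 0" "L *v x = c *s x" using assms by (auto simp: eigenval_def)
  then show ?thesis using norm_mult_le_opnorm[of L x] by (simp add: norm_smult)
qed

lemma hermitian_psd_limit:
  assumes "Y \<longlonglongrightarrow> (L::'m::finite cmat)" "eventually (\<lambda>n. hermitian_psd (Y n)) sequentially"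
  shows "hermitian_psd L"
proof -
  have "closed {Y::'m cmat. adjointC Y = Y \<and> (\<forall>x. 0 \<le> inner x (Y *v x))}"
    by (intro closed_Collect_conj closed_Collect_all closed_Collect_eq closed_Collect_le continuous_intros)
  then have "closed {Y::'m cmat. hermitian_psd Y}" by (simp add: hermitian_psd_inner)
  from Lim_in_closed_set[OF this _ _ assms(1)] assms(2) show ?thesis by simp
qed

lemma oseledets_lim_psd:
  assumes "oseledets_lim M (L::'m::finite cmat)"
  shows "hermitian_psd L"
  using assms unfolding oseledets_lim_def
  by (rule hermitian_psd_limit)
    (auto intro!: eventually_sequentiallyI[of 1] mroot hermitian_psd_adjoint_mult)

text \<open>Identifies the growth rate of the norms with \<open>opnorm L\<close>, the exponential of
  the top Lyapunov index. The attracting and repelling hypotheses enter only through this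
  number.\<close>

lemma oseledets_lim_opnorm:
  assumes "oseledets_lim M (L::'m::finite cmat)"
  shows "(\<lambda>n. root n (opnorm (mprod M n))) \<longlonglongrightarrow> opnorm L"
proof -
  have "continuous_on UNIV (opnorm :: 'm cmat \<Rightarrow> real)" by (intro continuous_intros)
  then have "(\<lambda>n. opnorm (mroot (2*n) (adjointC (mprod M n) ** mprod M n))) \<longlonglongrightarrow> opnorm L"
    using continuous_on_tendsto_compose[OF _ assms[unfolded oseledets_lim_def], of UNIV opnorm] by simp
  then show ?thesis
    by (rule Lim_transform_eventually)
      (rule eventually_sequentiallyI[of 1], simp add: opnorm_mroot_adjoint_mult)
qed

lemma hermitian_psd_eigenval_opnorm:
  assumes "hermitian_psd (L::'m::finite cmat)"
  shows "eigenval L (of_real (opnorm L))"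
proof -
  obtain v where v: "norm v = 1" "L *v v = opnorm L *\<^sub>R v"
    using hermitian_psd_opnorm_eigenvector[OF assms] by blast
  moreover have "v \<noteq> 0" using v(1) by auto
  ultimately show ?thesis unfolding eigenval_def scaleR_eq_smult by blast
qed

text \<open>L is Hermitian with 1 as its only eigenvalue, hence the identity; continuity of the
  determinant does the rest.\<close>

lemma oseledets_lim_neutral_det:
  assumes "oseledets_lim M (L::'m::finite cmat)" "\<And>c. eigenval L c \<Longrightarrow> c = 1"
  shows "(\<lambda>n. root n (cmod (det (mprod M n)))) \<longlonglongrightarrow> 1"
proof -
  have psd: "hermitian_psd L" using assms(1) by (rule oseledets_lim_psd)
  then have sp: "span {v. \<exists>l. L *v v = l *\<^sub>R v} = UNIV"
    using selfadjoint_eigenvectors_span[of "(*v) L"] hermitian_selfadjoint[of L]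
    by (simp add: hermitian_psd_def)
  have "L = mat 1"
  proof (rule matrix_eqI_span[OF sp], clarify)
    fix v l assume v: "L *v v = l *\<^sub>R v"
    show "L *v v = mat 1 *v v"
    proof (cases "v = 0")
      case False
      then have "eigenval L (of_real l)" using v unfolding eigenval_def scaleR_eq_smult by blast
      from assms(2)[OF this] show ?thesis using v by simp
    qed simp
  qed
  moreover have "continuous_on UNIV (\<lambda>A::'m cmat. cmod (det A))" by (intro continuous_intros)
  ultimately have "(\<lambda>n. cmod (det (mroot (2*n) (adjointC (mprod M n) ** mprod M n)))) \<longlonglongrightarrow> cmod (det (mat 1 :: 'm cmat))"
    using continuous_on_tendsto_compose[OF _ assms(1)[unfolded oseledets_lim_def], of UNIV "\<lambda>A. cmod (det A)"]
    by simp
  then have "(\<lambda>n. root n (cmod (det (mprod M n)))) \<longlonglongrightarrow> cmod (det (mat 1 :: 'm cmat))"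
    by (rule Lim_transform_eventually)
      (rule eventually_sequentiallyI[of 1], simp add: det_mroot_adjoint_mult)
  then show ?thesis by simp
qed

section \<open>Holomorphic maps of several variables\<close>

definition jac :: "('m::finite cvec \<Rightarrow> 'm cvec) \<Rightarrow> 'm cvec \<Rightarrow> 'm cmat" where
  "jac f z = (\<chi> i j. (frechet_derivative f (at z) (axis j 1)) $ i)"

lemma dmat_eq_jac: "dmat f = jac f 0"
  by (simp add: dmat_def jac_def)

lemma complex_linear_eq_matrix:
  assumes "linear L" "\<And>c x. L (c *s x) = c *s L (x::'m::finite cvec)"
  shows "L x = (\<chi> i j. L (axis j 1) $ i) *v x"
proof -
  have "L x = L (\<Sum>j\<in>UNIV. x $ j *s axis j 1)"
    by (simp add: basis_expansion)
  also have "\<dots> = (\<Sum>j\<in>UNIV. x $ j *s L (axis j 1))"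
    by (simp add: linear_sum[OF assms(1)] assms(2))
  finally show ?thesis
    by (simp add: matrix_vector_mult_def vec_eq_iff mult.commute)
qed

lemma jac_eqI:
  assumes "(f has_derivative (*v) A) (at (z::'m::finite cvec))"
  shows "jac f z = A"
proof -
  have "frechet_derivative f (at z) = (*v) A"
    using assms frechet_derivative_at by metis
  moreover have "(A *v axis j 1) $ i = A $ i $ j" for i j
    by (simp add: matrix_vector_mult_def axis_def if_distrib cong: if_cong)
  ultimately show ?thesis
    by (simp add: jac_def vec_eq_iff)
qed

lemma holo_on_has_derivative:
  assumes "holo_on U f" "z \<in> U"
  shows "(f has_derivative (*v) (jac f z)) (at (z::'m::finite cvec))"
proof -
  obtain L where L: "(f has_derivative L) (at z)" "\<And>c x. L (c *s x) = c *s L x"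
    using assms unfolding holo_on_def by blast
  have lin: "linear L" using L(1) has_derivative_linear by blast
  have "L = (*v) (\<chi> i j. L (axis j 1) $ i)"
    by (rule ext) (rule complex_linear_eq_matrix[OF lin L(2)])
  with L(1) have *: "(f has_derivative (*v) (\<chi> i j. L (axis j 1) $ i)) (at z)" by simp
  then show ?thesis using jac_eqI[OF *] by simp
qed

lemma holo_onI:
  assumes "\<And>z. z \<in> U \<Longrightarrow> (f has_derivative (*v) (A z)) (at (z::'m::finite cvec))"
  shows "holo_on U f"
  unfolding holo_on_def
  using assms vec.scale by blast

lemma holo_on_subset: "holo_on U f \<Longrightarrow> V \<subseteq> U \<Longrightarrow> holo_on V f"
  by (auto simp: holo_on_def)

lemma holo_on_imp_continuous_on: "holo_on U f \<Longrightarrow> continuous_on U f"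
  by (intro continuous_at_imp_continuous_on ballI has_derivative_continuous[OF holo_on_has_derivative])

lemma has_derivative_cong_near:
  assumes "\<forall>\<^sub>F w in nhds z. f w = g w" "(f has_derivative L) (at z)"
  shows "(g has_derivative L) (at z)"
proof -
  obtain S where "open S" "z \<in> S" "\<And>w. w \<in> S \<Longrightarrow> f w = g w"
    using assms(1) by (auto simp: eventually_nhds)
  then show ?thesis using has_derivative_transform_within_open[OF assms(2)] by blast
qed

lemma holo_on_cong:
  assumes "open U" "\<And>z. z \<in> U \<Longrightarrow> f z = g z" "holo_on U f"
  shows "holo_on U g"
  by (rule holo_onI[where A = "jac f"])
    (rule has_derivative_transform_within_open[OF holo_on_has_derivative[OF assms(3)] assms(1) _ assms(2)])

lemma holo_on_matrix_vector: "holo_on U ((*v) (A::'m::finite cmat))"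
  by (rule holo_onI[where A = "\<lambda>_. A"]) (simp add: bounded_linear_imp_has_derivative)

lemma holo_on_id: "holo_on U (id :: 'm::finite cvec \<Rightarrow> _)"
proof (rule holo_onI[where A = "\<lambda>_. mat 1"])
  have "(*v) (mat 1 :: 'm cmat) = (\<lambda>x. x)" by auto
  then show "(id has_derivative (*v) (mat 1)) (at (z::'m cvec))" for z by (simp add: id_def)
qed

lemma jac_compose:
  assumes "(f has_derivative (*v) A) (at (z::'m::finite cvec))" "(g has_derivative (*v) B) (at (f z))"
  shows "((\<lambda>x. g (f x)) has_derivative (*v) (B ** A)) (at z)"
  using has_derivative_compose[OF assms] by (simp add: matrix_vector_mul_assoc)

lemma holo_on_compose:
  assumes "holo_on U f" "holo_on V g" "\<And>z. z \<in> U \<Longrightarrow> f z \<in> V"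
  shows "holo_on U (\<lambda>z. g (f (z::'m::finite cvec)))"
  by (rule holo_onI, rule jac_compose)
    (rule holo_on_has_derivative[OF assms(1)] holo_on_has_derivative[OF assms(2)], (rule assms(3))?, assumption)+

lemma holo_on_diff:
  assumes "holo_on U f" "holo_on U g"
  shows "holo_on U (\<lambda>z. f z - g (z::'m::finite cvec))"
    and "z \<in> U \<Longrightarrow> jac (\<lambda>z. f z - g z) z = jac f z - jac g z"
proof -
  have *: "((\<lambda>z. f z - g z) has_derivative (*v) (jac f z - jac g z)) (at z)" if "z \<in> U" for z
    using has_derivative_diff[OF holo_on_has_derivative[OF assms(1) that] holo_on_has_derivative[OF assms(2) that]]
    by (simp add: matrix_vector_mult_diff_rdistrib[abs_def])
  show "holo_on U (\<lambda>z. f z - g (z::'m::finite cvec))" by (rule holo_onI) (rule *)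
  show "z \<in> U \<Longrightarrow> jac (\<lambda>z. f z - g z) z = jac f z - jac g z" by (rule jac_eqI) (rule *)
qed

lemma holo_on_shift:
  assumes "holo_on U f" "\<And>z. z \<in> V \<Longrightarrow> z + a \<in> U"
  shows "holo_on V (\<lambda>z. f (z + (a::'m::finite cvec)))"
    and "z \<in> V \<Longrightarrow> jac (\<lambda>z. f (z + a)) z = jac f (z + a)"
proof -
  have *: "((\<lambda>z. f (z + a)) has_derivative (*v) (jac f (z + a))) (at z)" if "z \<in> V" for z
  proof -
    have "((\<lambda>z. z + a) has_derivative (\<lambda>z. z)) (at z)" by (auto intro!: derivative_eq_intros)
    from has_derivative_compose[OF this, of f] holo_on_has_derivative[OF assms(1) assms(2)[OF that]]
    show ?thesis by simp
  qed
  show "holo_on V (\<lambda>z. f (z + a))" by (rule holo_onI) (rule *)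
  show "z \<in> V \<Longrightarrow> jac (\<lambda>z. f (z + a)) z = jac f (z + a)" by (rule jac_eqI) (rule *)
qed

section \<open>Cauchy, Taylor, identity theorem, Weierstrass and Montel by restriction to complex
  lines\<close>

lemma norm_nth_le_norm: "cmod (x $ i) \<le> norm (x::'m::finite cvec)"
  by (rule Finite_Cartesian_Product.norm_nth_le)

lemma norm_le_CARD:
  fixes x :: "'m::finite cvec"
  assumes "\<And>i. cmod (x $ i) \<le> B"
  shows "norm x \<le> real CARD('m) * B"
proof -
  have "norm x \<le> (\<Sum>i\<in>UNIV. cmod (x $ i))"
    unfolding norm_vec_def by (rule L2_set_le_sum) simp
  also have "\<dots> \<le> (\<Sum>i\<in>(UNIV::'m set). B)" by (rule sum_mono) (rule assms)
  finally show ?thesis by simp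
qed

text \<open>The bridge to one variable: every component along a complex line is holomorphic in t, so
  the one-dimensional Cauchy, Taylor and continuation theorems become available.\<close>

lemma holo_on_line_derivative:
  fixes a v :: "'m::finite cvec"
  assumes "holo_on U f" "a + t *s v \<in> U"
  shows "((\<lambda>t. f (a + t *s v) $ i) has_field_derivative (jac f (a + t *s v) *v v) $ i) (at (t::complex))"
proof -
  have bl: "bounded_linear (\<lambda>t. t *s (v::'m cvec))"
  proof (rule bounded_linear_intro[where K = "norm v"])
    show "(x + y) *s v = x *s v + y *s v" for x y by (simp add: vec.scale_left_distrib)
    show "(r *\<^sub>R x) *s v = r *\<^sub>R (x *s v)" for r x by (simp add: vec_eq_iff)
    show "norm (x *s v) \<le> norm x * norm v" for x by (simp add: norm_smult)
  qed
  have "((\<lambda>t. a + t *s v) has_derivative (\<lambda>h. h *s v)) (at t)"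
    using has_derivative_add[OF has_derivative_const[of a] bounded_linear_imp_has_derivative[OF bl]] by simp
  from has_derivative_compose[OF this holo_on_has_derivative[OF assms]]
  have "((\<lambda>t. f (a + t *s v)) has_derivative (\<lambda>h. jac f (a + t *s v) *v (h *s v))) (at t)" .
  from has_derivative_compose[OF this bounded_linear_imp_has_derivative[OF bounded_linear_vec_nth]]
  have "((\<lambda>t. f (a + t *s v) $ i) has_derivative (\<lambda>h. (jac f (a + t *s v) *v (h *s v)) $ i)) (at t)" .
  moreover have "(\<lambda>h. (jac f (a + t *s v) *v (h *s v)) $ i) = (*) ((jac f (a + t *s v) *v v) $ i)"
    by (rule ext) (simp add: vec.scale mult.commute)
  ultimately show ?thesis
    by (simp add: has_field_derivative_def)
qed

lemma in_ball_line:
  assumes "norm v * cmod t < s"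
  shows "z + t *s v \<in> ball z s"
  using assms by (simp add: dist_norm norm_smult mult.commute)

text \<open>The factor 2 comes from using circles of half the admissible radius, the dimension from estimating
  componentwise.\<close>

lemma holo_on_cauchy_bound:
  fixes f :: "'m::finite cvec \<Rightarrow> 'm cvec"
  assumes f: "holo_on (ball z s) f" and s: "0 < s" and R: "\<And>w. w \<in> ball z s \<Longrightarrow> norm (f w) \<le> R"
  shows "opnorm (jac f z) \<le> 2 * real CARD('m) * R / s"
proof -
  have R0: "0 \<le> R" using R[of z] s by (meson centre_in_ball norm_ge_zero order_trans)
  have "cmod ((jac f z *v v) $ i) \<le> 2 * R * norm v / s" for v i
  proof (cases "v = 0")
    case False
    define \<rho> where "\<rho> = s / (2 * norm v)"
    have \<rho>: "0 < \<rho>" using False s by (simp add: \<rho>_def)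
    define h where "h t = f (z + t *s v) $ i" for t
    have inb: "z + t *s v \<in> ball z s" if "cmod t \<le> \<rho>" for t
      using that False s by (intro in_ball_line) (simp add: \<rho>_def field_simps)
    have d: "(h has_field_derivative (jac f (z + t *s v) *v v) $ i) (at t)" if "cmod t \<le> \<rho>" for t
      unfolding h_def by (rule holo_on_line_derivative[OF f inb[OF that]])
    have "cmod ((deriv ^^ 1) h 0) \<le> fact 1 * R / \<rho> ^ 1"
    proof (rule Cauchy_inequality)
      show "h holomorphic_on ball 0 \<rho>"
        unfolding holomorphic_on_open[OF open_ball] by (intro ballI exI, rule d) simp
      show "continuous_on (cball 0 \<rho>) h"
        by (intro continuous_at_imp_continuous_on ballI DERIV_isCont[OF d]) simp
      show "cmod (h x) \<le> R" if "cmod (0 - x) = \<rho>" for x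
        using R[OF inb, of x] norm_nth_le_norm[of "f (z + x *s v)" i] that by (simp add: h_def)
    qed (rule \<rho>)
    moreover have "deriv h 0 = (jac f z *v v) $ i" using DERIV_imp_deriv[OF d[of 0]] \<rho> by simp
    ultimately show ?thesis by (simp add: \<rho>_def mult_ac)
  qed simp
  then have "norm (jac f z *v v) \<le> real CARD('m) * (2 * R * norm v / s)" for v
    by (rule norm_le_CARD)
  then have "norm (jac f z *v v) \<le> 2 * real CARD('m) * R / s * norm v" for v
    by (simp add: mult_ac)
  then show ?thesis using s R0 by (intro onorm_bound) auto
qed

lemma holo_on_lipschitz:
  fixes f :: "'m::finite cvec \<Rightarrow> 'm cvec"
  assumes f: "holo_on (ball 0 s) f" and s: "s' < s" and R: "\<And>w. w \<in> ball 0 s \<Longrightarrow> norm (f w) \<le> R"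
    and zw: "z \<in> cball 0 s'" "w \<in> cball 0 s'"
  shows "norm (f z - f w) \<le> 2 * real CARD('m) * R / (s - s') * norm (z - w)"
proof (rule differentiable_bound[where S = "cball 0 s'" and f' = "\<lambda>x. (*v) (jac f x)"])
  fix x :: "'m cvec" assume x: "x \<in> cball 0 s'"
  have "ball x (s - s') \<subseteq> ball 0 s"
    using x by (auto simp: ball_subset_ball_iff dist_norm)
  then show "opnorm (jac f x) \<le> 2 * real CARD('m) * R / (s - s')"
    using s R by (intro holo_on_cauchy_bound holo_on_subset[OF f]) auto
  show "(f has_derivative (*v) (jac f x)) (at x within cball 0 s')"
    using x s by (intro has_derivative_at_withinI[OF holo_on_has_derivative[OF f]]) auto
qed (use zw in auto)

text \<open>Taylor expansion from t = 0 to t = 1 on the line through z. As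
  \<open>norm z \<le> s / 4\<close>, the radius \<rho> = s / (2 |z|) is at least 2, so discs of
  radius \<rho> about points of the unit disc stay in the domain, and the Cauchy bound
  \<open>2 * R / \<rho>\<^sup>2\<close> for the second derivative is quadratic in z.\<close>

lemma holo_on_taylor_bound:
  fixes f :: "'m::finite cvec \<Rightarrow> 'm cvec"
  assumes f: "holo_on (ball 0 s) f" and s: "0 < s" and R: "\<And>w. w \<in> ball 0 s \<Longrightarrow> norm (f w) \<le> R"
    and f0: "f 0 = 0" and z: "norm z \<le> s / 4"
  shows "norm (f z - jac f 0 *v z) \<le> 8 * real CARD('m) * R / s\<^sup>2 * (norm z)\<^sup>2"
proof (cases "z = 0")
  case False
  have R0: "0 \<le> R" using R[of 0] s by (meson centre_in_ball norm_ge_zero order_trans)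
  define \<rho> where "\<rho> = s / (2 * norm z)"
  have \<rho>: "2 \<le> \<rho>" using z False s by (simp add: \<rho>_def field_simps)
  have "cmod ((f z - jac f 0 *v z) $ i) \<le> 8 * R / s\<^sup>2 * (norm z)\<^sup>2" for i
  proof -
    define h where "h t = f (0 + t *s z) $ i" for t
    have inb: "0 + t *s z \<in> ball 0 s" if "cmod t < 2 * \<rho>" for t
      using that False s by (intro in_ball_line) (simp add: \<rho>_def field_simps)
    have d: "(h has_field_derivative (jac f (0 + t *s z) *v z) $ i) (at t)" if "cmod t < 2 * \<rho>" for t
      unfolding h_def by (rule holo_on_line_derivative[OF f inb[OF that]])
    have hol: "h holomorphic_on ball 0 (2 * \<rho>)"
      unfolding holomorphic_on_open[OF open_ball] by (intro ballI exI, rule d) simp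
    have sub: "cball t \<rho> \<subseteq> ball 0 (2 * \<rho>)" if "cmod t \<le> 1" for t
      using that \<rho> by (auto simp: cball_subset_ball_iff dist_norm)
    have "cmod ((deriv ^^ 0) h 1 - (\<Sum>k\<le>1. (deriv ^^ k) h 0 * (1 - 0) ^ k / fact k))
        \<le> (2 * R / \<rho>\<^sup>2) * cmod (1 - 0) ^ Suc 1 / fact 1"
    proof (rule complex_Taylor[where S = "cball 0 1" and f = "\<lambda>k. (deriv ^^ k) h"])
      fix k :: nat and t :: complex assume t: "t \<in> cball 0 1"
      have tb: "t \<in> ball 0 (2 * \<rho>)" using t \<rho> by auto
      have "((deriv ^^ k) h has_field_derivative deriv ((deriv ^^ k) h) t) (at t)"
        using holomorphic_higher_deriv[OF hol] tb holomorphic_derivI by blast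
      then show "((deriv ^^ k) h has_field_derivative (deriv ^^ Suc k) h t) (at t within cball 0 1)"
        by (simp add: has_field_derivative_at_within)
      have "cmod ((deriv ^^ 2) h t) \<le> fact 2 * R / \<rho> ^ 2"
      proof (rule Cauchy_inequality)
        show "h holomorphic_on ball t \<rho>"
          using holomorphic_on_subset[OF hol] sub[of t] t ball_subset_cball by (metis mem_cball_0 order_trans)
        show "continuous_on (cball t \<rho>) h"
          using holomorphic_on_imp_continuous_on[OF hol] sub[of t] t continuous_on_subset
          by (metis mem_cball_0)
        show "cmod (h x) \<le> R" if "cmod (t - x) = \<rho>" for x
        proof -
          have "x \<in> ball 0 (2 * \<rho>)" using that sub[of t] t by (auto simp: dist_norm)
          then show ?thesis
            using R[OF inb, of x] norm_nth_le_norm[of "f (0 + x *s z)" i] by (simp add: h_def)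
        qed
      qed (use \<rho> in auto)
      then show "cmod ((deriv ^^ Suc 1) h t) \<le> 2 * R / \<rho>\<^sup>2" by (simp add: numeral_2_eq_2)
    qed auto
    moreover have "(2 * R / \<rho>\<^sup>2) = 8 * R / s\<^sup>2 * (norm z)\<^sup>2"
      using s False by (simp add: \<rho>_def field_simps power2_eq_square)
    moreover have "deriv h 0 = (jac f 0 *v z) $ i" using DERIV_imp_deriv[OF d[of 0]] \<rho> by simp
    moreover have "h 0 = 0" "h 1 = f z $ i" by (simp_all add: h_def f0)
    ultimately show ?thesis by simp
  qed
  then have "norm (f z - jac f 0 *v z) \<le> real CARD('m) * (8 * R / s\<^sup>2 * (norm z)\<^sup>2)"
    by (rule norm_le_CARD)
  then show ?thesis by (simp add: mult_ac)
qed (use f0 in simp)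

text \<open>Analytic continuation along the complex line through z, starting from a disc about t =
  0. It makes representatives of one germ interchangeable on a common ball.\<close>

lemma holo_on_identity:
  fixes f g :: "'m::finite cvec \<Rightarrow> 'm cvec"
  assumes f: "holo_on (ball 0 s) f" and g: "holo_on (ball 0 s) g"
    and ev: "\<forall>\<^sub>F z in nhds 0. f z = g z" and z: "z \<in> ball 0 s"
  shows "f z = g z"
proof (cases "z = 0")
  case True
  then show ?thesis using eventually_nhds_x_imp_x[OF ev] by simp
next
  case False
  obtain e where e: "e > 0" "\<And>w. norm w < e \<Longrightarrow> f w = g w"
    using ev by (auto simp: eventually_nhds_metric)
  have s: "0 < s" using z by (simp add: le_less_trans[OF norm_ge_zero])
  define \<rho> where "\<rho> = s / norm z"
  have \<rho>: "1 < \<rho>" using z False by (simp add: \<rho>_def)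
  have inb: "0 + t *s z \<in> ball 0 s" if "cmod t < \<rho>" for t
    using that False s by (intro in_ball_line) (simp add: \<rho>_def field_simps)
  show ?thesis
  proof (subst vec_eq_iff, rule allI)
    fix i
    have hol: "(\<lambda>t. F (0 + t *s z) $ i) holomorphic_on ball 0 \<rho>" if "holo_on (ball 0 s) F"
      for F :: "'m cvec \<Rightarrow> 'm cvec"
      unfolding holomorphic_on_open[OF open_ball] by (intro ballI exI, rule holo_on_line_derivative[OF that inb]) simp
    define \<sigma> where "\<sigma> = min \<rho> (e / norm z)"
    have "f (0 + 1 *s z) $ i = g (0 + 1 *s z) $ i"
    proof (rule analytic_continuation_open[of "ball 0 \<sigma>" "ball 0 \<rho>" "\<lambda>t. f (0 + t *s z) $ i" "\<lambda>t. g (0 + t *s z) $ i"])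
      have "0 < \<sigma>" using e(1) False \<rho> by (simp add: \<sigma>_def)
      then show "ball (0::complex) \<sigma> \<noteq> {}" by simp
      show "f (0 + t *s z) $ i = g (0 + t *s z) $ i" if "t \<in> ball 0 \<sigma>" for t
      proof -
        have "cmod t < e / norm z" using that by (simp add: \<sigma>_def)
        then have "norm (t *s z) < e" using False by (simp add: norm_smult pos_less_divide_eq)
        then show ?thesis using e(2) by simp
      qed
    qed (use \<rho> hol f g in \<open>auto simp: \<sigma>_def\<close>)
    then show "f z $ i = g z $ i" by simp
  qed
qed

text \<open>Weierstrass: on a smaller ball, Cauchy estimates turn uniform convergence of the maps
  into a uniform Cauchy condition on the Jacobians, and then limit and derivative may be
  exchanged.\<close>

lemma holo_on_uniform_limit:
  fixes f :: "nat \<Rightarrow> 'm::finite cvec \<Rightarrow> 'm cvec"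
  assumes f: "\<And>n. holo_on (ball 0 s) (f n)" and lim: "uniform_limit (ball 0 s) f g sequentially"
  shows "holo_on (ball 0 s) g"
    and "z \<in> ball 0 s \<Longrightarrow> (\<lambda>n. jac (f n) z) \<longlonglongrightarrow> jac g z"
proof -
  have main: "\<exists>A. (\<lambda>n. jac (f n) z) \<longlonglongrightarrow> A \<and> (g has_derivative (*v) A) (at z)" if z: "z \<in> ball 0 s" for z
  proof -
    define s' where "s' = (norm z + s) / 2"
    have s': "norm z < s'" "s' < s" using z by (auto simp: s'_def)
    define d where "d = s - s'"
    have d: "d > 0" using s' by (simp add: d_def)
    define K where "K = 2 * real CARD('m) / d"
    have K: "K > 0" using d by (simp add: K_def)
    have sub: "ball x d \<subseteq> ball 0 s" if "x \<in> ball 0 s'" for x :: "'m cvec"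
      using that by (auto simp: ball_subset_ball_iff dist_norm d_def)
    have C: "\<exists>N. \<forall>n\<ge>N. \<forall>m\<ge>N. \<forall>x\<in>ball 0 s'. opnorm (jac (f n) x - jac (f m) x) \<le> e" if e: "e > 0" for e
    proof -
      have "\<forall>\<^sub>F n in sequentially. \<forall>x\<in>ball 0 s. dist (f n x) (g x) < e / (2 * K)"
        using lim e K by (simp add: uniform_limit_iff)
      then obtain N where N: "\<And>n x. n \<ge> N \<Longrightarrow> x \<in> ball 0 s \<Longrightarrow> dist (f n x) (g x) < e / (2 * K)"
        unfolding eventually_sequentially by blast
      have "opnorm (jac (f n) x - jac (f m) x) \<le> e" if nm: "n \<ge> N" "m \<ge> N" and x: "x \<in> ball 0 s'" for n m x
      proof -
        have xs: "x \<in> ball 0 s" using x s' by auto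
        have le: "norm (f n w - f m w) \<le> e / K" if "w \<in> ball x d" for w
        proof -
          have "w \<in> ball 0 s" using that sub[OF x] by blast
          from N[OF nm(1) this] N[OF nm(2) this]
          have "dist (f n w) (f m w) < e / (2 * K) + e / (2 * K)"
            using dist_triangle2[of "f n w" "f m w" "g w"] by linarith
          then show ?thesis using K by (simp add: dist_norm field_simps)
        qed
        have "opnorm (jac (\<lambda>z. f n z - f m z) x) \<le> 2 * real CARD('m) * (e / K) / d"
          by (rule holo_on_cauchy_bound[OF holo_on_subset[OF holo_on_diff(1)[OF f f] sub[OF x]] d]) (rule le)
        also have "\<dots> = e" using d by (simp add: K_def)
        finally show ?thesis using holo_on_diff(2)[OF f f xs] by simp
      qed
      then show ?thesis by blast
    qed
    have conv: "\<exists>A. (\<lambda>n. jac (f n) x) \<longlonglongrightarrow> A" if x: "x \<in> ball 0 s'" for x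
    proof -
      have "\<exists>l. (\<lambda>n. jac (f n) x $ i $ j) \<longlonglongrightarrow> l" for i j
        unfolding convergent_eq_Cauchy
      proof (rule CauchyI)
        fix e :: real assume e: "e > 0"
        then obtain N where N: "\<And>n m. n \<ge> N \<Longrightarrow> m \<ge> N \<Longrightarrow> opnorm (jac (f n) x - jac (f m) x) \<le> e / 2"
          using C[of "e/2"] x by (metis half_gt_zero)
        have "norm (jac (f m) x $ i $ j - jac (f n) x $ i $ j) < e" if "m \<ge> N" "n \<ge> N" for m n
        proof -
          let ?A = "jac (f m) x - jac (f n) x"
          have "cmod (?A $ i $ j) = cmod ((?A *v axis j 1) $ i)"
            by (simp add: matrix_vector_mult_def axis_def if_distrib cong: if_cong)
          also have "\<dots> \<le> opnorm ?A * norm (axis j 1 :: 'm cvec)"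
            using norm_nth_le_norm norm_mult_le_opnorm by (rule order_trans)
          also have "\<dots> < e" using N[OF that] e by (simp add: norm_axis_1)
          finally show ?thesis by simp
        qed
        then show "\<exists>N. \<forall>m\<ge>N. \<forall>n\<ge>N. norm (jac (f m) x $ i $ j - jac (f n) x $ i $ j) < e" by blast
      qed
      then obtain a where a: "\<And>i j. (\<lambda>n. jac (f n) x $ i $ j) \<longlonglongrightarrow> a i j" by metis
      have "(\<lambda>n. jac (f n) x) \<longlonglongrightarrow> (\<chi> i j. a i j)"
        by (intro vec_tendstoI) (simp add: a)
      then show ?thesis by blast
    qed
    then obtain A where A: "\<And>x. x \<in> ball 0 s' \<Longrightarrow> (\<lambda>n. jac (f n) x) \<longlonglongrightarrow> A x" by metis
    have "\<exists>G. \<forall>x\<in>ball 0 s'. (\<lambda>n. f n x) \<longlonglongrightarrow> G x \<and> (G has_derivative (*v) (A x)) (at x within ball 0 s')"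
    proof (rule has_derivative_sequence[where f = f and f' = "\<lambda>n x. (*v) (jac (f n) x)"])
      show "z \<in> ball 0 s'" using s' by simp
      show "(\<lambda>n. f n z) \<longlonglongrightarrow> g z" using tendsto_uniform_limitI[OF lim z] .
      show "(f n has_derivative (*v) (jac (f n) x)) (at x within ball 0 s')" if "x \<in> ball 0 s'" for n x
        using that s' by (intro has_derivative_at_withinI[OF holo_on_has_derivative[OF f]]) auto
      fix e :: real assume "e > 0"
      then obtain N where N: "\<And>n m x. n \<ge> N \<Longrightarrow> m \<ge> N \<Longrightarrow> x \<in> ball 0 s' \<Longrightarrow> opnorm (jac (f n) x - jac (f m) x) \<le> e"
        using C by metis
      have "norm (jac (f n) x *v h - A x *v h) \<le> e * norm h" if n: "n \<ge> N" and x: "x \<in> ball 0 s'" for n x h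
      proof (rule Lim_bounded)
        show "(\<lambda>m. norm (jac (f n) x *v h - jac (f m) x *v h)) \<longlonglongrightarrow> norm (jac (f n) x *v h - A x *v h)"
          by (intro tendsto_intros A x)
        show "\<forall>m\<ge>N. norm (jac (f n) x *v h - jac (f m) x *v h) \<le> e * norm h"
        proof (intro allI impI)
          fix m assume "m \<ge> N"
          have "norm (jac (f n) x *v h - jac (f m) x *v h) \<le> opnorm (jac (f n) x - jac (f m) x) * norm h"
            using norm_mult_le_opnorm[of "jac (f n) x - jac (f m) x" h]
            by (simp add: matrix_vector_mult_diff_rdistrib)
          also have "\<dots> \<le> e * norm h" using N[OF n \<open>m \<ge> N\<close> x] by (simp add: mult_right_mono)
          finally show "norm (jac (f n) x *v h - jac (f m) x *v h) \<le> e * norm h" .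
        qed
      qed
      then show "\<forall>\<^sub>F n in sequentially. \<forall>x\<in>ball 0 s'. \<forall>h. norm (jac (f n) x *v h - A x *v h) \<le> e * norm h"
        unfolding eventually_sequentially by blast
    qed (rule convex_ball)
    then obtain G where G: "\<And>x. x \<in> ball 0 s' \<Longrightarrow> (\<lambda>n. f n x) \<longlonglongrightarrow> G x"
       "\<And>x. x \<in> ball 0 s' \<Longrightarrow> (G has_derivative (*v) (A x)) (at x within ball 0 s')" by blast
    have zs: "z \<in> ball 0 s'" using s' by simp
    have "G x = g x" if x: "x \<in> ball 0 s'" for x
    proof -
      have "x \<in> ball 0 s" using x s' by auto
      then show ?thesis using LIMSEQ_unique[OF G(1)[OF x] tendsto_uniform_limitI[OF lim]] by blast
    qed
    moreover have "(G has_derivative (*v) (A z)) (at z)"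
      using G(2)[OF zs] at_within_open[OF zs open_ball] by simp
    ultimately have "(g has_derivative (*v) (A z)) (at z)"
      using has_derivative_transform_within_open[OF _ open_ball zs] by blast
    then show ?thesis using A[OF zs] by blast
  qed
  show "holo_on (ball 0 s) g"
  proof (rule holo_onI)
    fix z :: "'m cvec" assume "z \<in> ball 0 s"
    then obtain A where "(g has_derivative (*v) A) (at z)" using main by blast
    moreover from this have "jac g z = A" by (rule jac_eqI)
    ultimately show "(g has_derivative (*v) (jac g z)) (at z)" by simp
  qed
  show "z \<in> ball 0 s \<Longrightarrow> (\<lambda>n. jac (f n) z) \<longlonglongrightarrow> jac g z"
    using main[of z] jac_eqI by metis
qed

text \<open>A common bound gives a common Lipschitz constant on the smaller ball, so Arzela-Ascoli
  applies.\<close>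

lemma holo_on_montel:
  fixes f :: "nat \<Rightarrow> 'm::finite cvec \<Rightarrow> 'm cvec"
  assumes f: "\<And>n. holo_on (ball 0 s) (f n)" and R: "\<And>n w. w \<in> ball 0 s \<Longrightarrow> norm (f n w) \<le> R"
    and s: "s' < s"
  shows "\<exists>k h. strict_mono (k::nat \<Rightarrow> nat) \<and> uniform_limit (cball 0 s') (\<lambda>n. f (k n)) h sequentially"
proof -
  define X where "X = 2 * real CARD('m) * R / (s - s')"
  define L where "L = \<bar>X\<bar> + 1"
  have lip: "norm (f n x - f n y) \<le> L * norm (x - y)" if "x \<in> cball 0 s'" "y \<in> cball 0 s'" for n x y
  proof -
    have "norm (f n x - f n y) \<le> X * norm (x - y)"
      unfolding X_def by (rule holo_on_lipschitz[OF f s R that])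
    also have "\<dots> \<le> L * norm (x - y)" by (intro mult_right_mono) (auto simp: L_def)
    finally show ?thesis .
  qed
  have L: "L > 0" by (simp add: L_def)
  have "\<exists>g k. continuous_on (cball 0 s') g \<and> strict_mono (k::nat \<Rightarrow> nat) \<and>
     (\<forall>e>0. \<exists>N. \<forall>n x. n \<ge> N \<and> x \<in> cball 0 s' \<longrightarrow> norm (f (k n) x - g x) < e)"
  proof (rule Arzela_Ascoli[of "cball 0 s'" f R])
    show "norm (f n x) \<le> R" if "x \<in> cball 0 s'" for n x using that s R by auto
    show "\<exists>d. 0 < d \<and> (\<forall>n y. y \<in> cball 0 s' \<and> norm (x - y) < d \<longrightarrow> norm (f n x - f n y) < e)"
      if x: "x \<in> cball 0 s'" and e: "0 < e" for x e
      using L e lip[OF x] by (intro exI[of _ "e / L"]) (auto simp: field_simps intro: le_less_trans)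
  qed auto
  then obtain g k where k: "strict_mono (k::nat \<Rightarrow> nat)"
    "\<And>e. e > 0 \<Longrightarrow> \<exists>N. \<forall>n x. n \<ge> N \<and> x \<in> cball 0 s' \<longrightarrow> norm (f (k n) x - g x) < e" by blast
  have "uniform_limit (cball 0 s') (\<lambda>n. f (k n)) g sequentially"
    unfolding uniform_limit_iff eventually_sequentially dist_norm using k(2) by blast
  then show ?thesis using k(1) by blast
qed

section \<open>Quantitative open mapping and local inverse\<close>

lemma matrix_left_inverse_bound:
  fixes A :: "'m::finite cmat"
  assumes c: "0 < c" "\<And>x. c * norm x \<le> norm (A *v x)"
  obtains B where "B ** A = mat 1" "A ** B = mat 1" "opnorm B \<le> 1 / c"
proof -
  have "inj ((*v) A)"
  proof (rule injI)
    fix x y assume "A *v x = A *v y"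
    then have "A *v (x - y) = 0" by (simp add: matrix_vector_mult_diff_distrib)
    then show "x = y" using c(2)[of "x - y"] c(1) by (simp add: mult_le_0_iff)
  qed
  then obtain B where B: "B ** A = mat 1" using matrix_left_invertible_injective[of A] by blast
  then have B': "A ** B = mat 1" using matrix_left_right_inverse by blast
  have "norm (B *v x) \<le> 1 / c * norm x" for x
    using c(2)[of "B *v x"] c(1) by (simp add: B' matrix_vector_mul_assoc field_simps)
  then have "opnorm B \<le> 1 / c" using c(1) by (intro onorm_bound) auto
  with B B' that show ?thesis by blast
qed

text \<open>The radius is fixed before g so that it can serve all iterates at once. With B the
  inverse of the Jacobian at 0, B g differs from the identity by a quadratic term, and Brouwer's
  theorem gives the preimages.\<close>

lemma holo_on_open_mapping:
  assumes pos: "0 < s" "0 < R" "0 < c" "0 < s'"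
  shows "\<exists>\<rho>>0. \<forall>g :: 'm::finite cvec \<Rightarrow> 'm cvec. holo_on (ball 0 s) g \<and> g 0 = 0 \<and>
    (\<forall>w\<in>ball 0 s. norm (g w) \<le> R) \<and> (\<forall>x. c * norm x \<le> norm (jac g 0 *v x))
    \<longrightarrow> ball 0 \<rho> \<subseteq> g ` ball 0 s'"
proof -
  define C where "C = 8 * real CARD('m) * R / s\<^sup>2"
  have C: "C > 0" using pos by (simp add: C_def)
  \<comment> \<open>On \<open>cball 0 e\<close> the error of B g against the identity is at most C
    e^2 / c \<le> e / 2. The choice \<rho> = c e / 2 below bounds B w by the other half of e, as
    Brouwer's theorem requires.\<close>
  define e where "e = min (min (s / 4) (s' / 2)) (c / (2 * C))"
  have "e \<le> c / (2 * C)" unfolding e_def by simp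
  then have e4: "C * e \<le> c / 2" using C by (simp add: field_simps)
  have e: "0 < e" "e \<le> s / 4" "e < s'" "C * e \<le> c / 2"
    using pos C e4 by (auto simp: e_def)
  define \<rho> where "\<rho> = c * e / 2"
  have "ball 0 \<rho> \<subseteq> g ` ball 0 s'" if g: "holo_on (ball 0 s) g" "g 0 = 0" "\<And>w. w \<in> ball 0 s \<Longrightarrow> norm (g w) \<le> R"
    "\<And>x. c * norm x \<le> norm (jac g 0 *v x)" for g :: "'m cvec \<Rightarrow> 'm cvec"
  proof
    fix w :: "'m cvec" assume w: "w \<in> ball 0 \<rho>"
    obtain B where B: "B ** jac g 0 = mat 1" "jac g 0 ** B = mat 1" "opnorm B \<le> 1 / c"
      using matrix_left_inverse_bound[OF pos(3) g(4)] by blast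
    have Bn: "norm (B *v x) \<le> norm x / c" for x
      using norm_mult_le_opnorm[of B x] mult_right_mono[OF B(3), of "norm x"] by simp
    have es: "cball 0 e \<subseteq> ball (0::'m cvec) s" using e(2) pos(1) by auto
    have "\<exists>y\<in>cball 0 e. B *v g y = B *v w"
    proof (rule brouwer_surjective_cball[where S = "{B *v w}"])
      show "continuous_on (cball 0 e) (\<lambda>y. B *v g y)"
        by (intro continuous_intros continuous_on_subset[OF holo_on_imp_continuous_on[OF g(1)] es])
      fix x y assume x: "x \<in> {B *v w}" and y: "y \<in> cball (0::'m cvec) e"
      have y': "norm y \<le> e" using y by simp
      have "y - B *v g y = B *v (jac g 0 *v y - g y)"
        by (simp add: matrix_vector_mult_diff_distrib matrix_vector_mul_assoc B)
      then have "norm (y - B *v g y) \<le> norm (g y - jac g 0 *v y) / c"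
        using Bn by (metis norm_minus_commute)
      also have "\<dots> \<le> (C * (norm y)\<^sup>2) / c"
        using holo_on_taylor_bound[OF g(1) pos(1) g(3) g(2), of y] y' e(2) pos(3)
        by (intro divide_right_mono) (auto simp: C_def)
      also have "\<dots> \<le> (C * e\<^sup>2) / c"
        using y' C pos(3) by (intro divide_right_mono mult_left_mono power_mono) auto
      also have "\<dots> = (C * e) * e / c" by (simp add: power2_eq_square)
      also have "\<dots> \<le> (c / 2) * e / c" using e pos(3) by (intro divide_right_mono mult_right_mono) auto
      also have "\<dots> = e / 2" using pos(3) by simp
      finally have 1: "norm (y - B *v g y) \<le> e / 2" .
      have "norm (B *v w) \<le> \<rho> / c"
      proof -
        have "norm w / c \<le> \<rho> / c" using w pos(3) by (intro divide_right_mono) auto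
        then show ?thesis using Bn[of w] by linarith
      qed
      then have "norm x \<le> e / 2" using x pos(3) by (simp add: \<rho>_def)
      with 1 show "x + (y - B *v g y) \<in> cball 0 e"
        using norm_triangle_ineq[of x "y - B *v g y"] by simp
    qed (use e in auto)
    then obtain y where y: "y \<in> cball 0 e" "B *v g y = B *v w" by blast
    then have "jac g 0 *v (B *v g y) = jac g 0 *v (B *v w)" by simp
    then have "g y = w" by (simp add: matrix_vector_mul_assoc B)
    then show "w \<in> g ` ball 0 s'" using y(1) e(3) by auto
  qed
  moreover have "\<rho> > 0" using pos e by (simp add: \<rho>_def)
  ultimately show ?thesis by blast
qed

text \<open>Cauchy's estimate is applied to the map f x - f (x + (w - z)): it is small by the
  Lipschitz bound, and its Jacobian at z is the difference of the two Jacobians.\<close>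

lemma holo_on_continuous_jac:
  fixes f :: "'m::finite cvec \<Rightarrow> 'm cvec"
  assumes f: "holo_on (ball 0 s) f" and R: "\<And>w. w \<in> ball 0 s \<Longrightarrow> norm (f w) \<le> R"
    and s: "0 < s" and z: "z \<in> ball 0 (s/4)" and w: "w \<in> ball 0 (s/4)"
  shows "opnorm (jac f z - jac f w) \<le> (2 * real CARD('m) / (s / 4)) * (2 * real CARD('m) * R / (s / 4)) * norm (z - w)"
proof -
  let ?a = "w - z"
  have nz: "norm z < s/4" "norm w < s/4" using z w by auto
  have in1: "x + ?a \<in> cball 0 (3 * s/4)" "x \<in> cball 0 (3 * s/4)" if "x \<in> ball z (s/4)" for x
  proof -
    have "norm (x - z) < s/4" using that by (simp add: dist_norm norm_minus_commute)
    moreover have "norm (x + ?a) \<le> norm (x - z) + norm w"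
      using norm_triangle_ineq[of "x - z" w] by (simp add: algebra_simps)
    moreover have "norm x \<le> norm (x - z) + norm z"
      using norm_triangle_ineq[of "x - z" z] by simp
    ultimately have "norm (x + ?a) \<le> 3 * s/4" "norm x \<le> 3 * s/4" using nz s by linarith+
    then show "x + ?a \<in> cball 0 (3 * s/4)" "x \<in> cball 0 (3 * s/4)" by simp_all
  qed
  have in2: "cball 0 (3 * s/4) \<subseteq> ball (0::'m cvec) s" using s by auto
  have zb: "z \<in> ball z (s/4)" using s by simp
  have h1: "holo_on (ball z (s/4)) f" using in1 in2 by (intro holo_on_subset[OF f]) blast
  have h2: "holo_on (ball z (s/4)) (\<lambda>x. f (x + ?a))"
    using in1 in2 by (intro holo_on_shift(1)[OF f]) blast
  have "opnorm (jac (\<lambda>x. f x - f (x + ?a)) z) \<le> 2 * real CARD('m) * (2 * real CARD('m) * R / (s / 4) * norm (z - w)) / (s / 4)"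
  proof (rule holo_on_cauchy_bound[OF holo_on_diff(1)[OF h1 h2]])
    fix x assume x: "x \<in> ball z (s / 4)"
    have "norm (f x - f (x + ?a)) \<le> 2 * real CARD('m) * R / (s - 3 * s/4) * norm (x - (x + ?a))"
      using in1[OF x] s by (intro holo_on_lipschitz[OF f _ R]) auto
    then show "norm (f x - f (x + ?a)) \<le> 2 * real CARD('m) * R / (s / 4) * norm (z - w)"
      by (simp add: algebra_simps)
  qed (use s in simp)
  moreover have "jac (\<lambda>x. f x - f (x + ?a)) z = jac f z - jac f w"
  proof -
    have "jac (\<lambda>x. f (x + ?a)) z = jac f (z + ?a)"
      by (rule holo_on_shift(2)[OF f _ zb]) (use in1 in2 in blast)
    then show ?thesis using holo_on_diff(2)[OF h1 h2 zb] by simp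
  qed
  ultimately show ?thesis by (simp add: mult_ac)
qed

text \<open>The real inverse function theorem needs a Jacobian that is continuous in operator norm,
  which \<open>holo_on_continuous_jac\<close> supplies. The inverse is holomorphic because the
  inverse of a complex linear bijection is complex linear.\<close>

lemma holo_on_local_inverse:
  fixes \<phi> :: "'m::finite cvec \<Rightarrow> 'm cvec"
  assumes f: "holo_on (ball 0 s) \<phi>" and R: "\<And>w. w \<in> ball 0 s \<Longrightarrow> norm (\<phi> w) \<le> R"
    and s: "0 < s" and f0: "\<phi> 0 = 0" and j: "jac \<phi> 0 = mat 1"
  obtains \<psi> t where "0 < t" "holo_on (ball 0 t) \<psi>" "\<psi> 0 = 0"
    "\<forall>\<^sub>F z in nhds 0. \<psi> (\<phi> z) = z" "\<forall>\<^sub>F w in nhds 0. \<phi> (\<psi> w) = w"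
proof -
  define f' where "f' z = Blinfun ((*v) (jac \<phi> z))" for z
  have app: "blinfun_apply (f' z) = (*v) (jac \<phi> z)" for z
    unfolding f'_def by (rule bounded_linear_Blinfun_apply) simp
  define K where "K = (2 * real CARD('m) / (s / 4)) * (2 * real CARD('m) * R / (s / 4))"
  have lip: "dist (f' z) (f' w) \<le> K * dist z w" if "z \<in> ball 0 (s/4)" "w \<in> ball 0 (s/4)" for z w
  proof -
    have "norm (f' z - f' w) = opnorm (jac \<phi> z - jac \<phi> w)"
      by (simp add: norm_blinfun.rep_eq minus_blinfun.rep_eq app matrix_vector_mult_diff_rdistrib[abs_def])
    then show ?thesis using holo_on_continuous_jac[OF f R s that] by (simp add: K_def dist_norm)
  qed
  have "0 \<le> K" using R[of 0] s by (auto simp: K_def intro!: mult_nonneg_nonneg divide_nonneg_nonneg intro: order_trans[OF norm_ge_zero])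
  then have cont: "continuous_on (ball 0 (s/4)) f'"
    using lip by (intro lipschitz_on_continuous_on[where L = K] lipschitz_onI) auto
  have inv: "id_blinfun o\<^sub>L f' 0 = id_blinfun"
    by (rule blinfun_eqI) (simp add: app j)
  show ?thesis
  proof (rule inverse_function_theorem[of "ball 0 (s/4)" \<phi> f' 0 id_blinfun])
    show "(\<phi> has_derivative blinfun_apply (f' x)) (at x)" if "x \<in> ball 0 (s/4)" for x
      unfolding app using that s by (intro holo_on_has_derivative[OF f]) auto
    fix U V :: "'m cvec set" and \<psi> :: "'m cvec \<Rightarrow> 'm cvec" and g' :: "'m cvec \<Rightarrow> 'm cvec \<Rightarrow> 'm cvec"
    assume U: "open U" "U \<subseteq> ball 0 (s/4)" "0 \<in> U" and V: "open V" "\<phi> 0 \<in> V" and hom: "homeomorphism U V \<phi> \<psi>"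
      and g: "\<And>y. y \<in> V \<Longrightarrow> (\<psi> has_derivative g' y) (at y)"
      and g': "\<And>y. y \<in> V \<Longrightarrow> g' y = inv (blinfun_apply (f' (\<psi> y)))"
      and bij: "\<And>y. y \<in> V \<Longrightarrow> bij (blinfun_apply (f' (\<psi> y)))"
    obtain t where t: "0 < t" "ball 0 t \<subseteq> V" using V f0 by (metis open_contains_ball)
    have hol: "holo_on (ball 0 t) \<psi>"
      unfolding holo_on_def
    proof (intro ballI exI conjI allI)
      fix y :: "'m cvec" assume "y \<in> ball 0 t"
      then have y: "y \<in> V" using t by blast
      show "(\<psi> has_derivative g' y) (at y)" by (rule g[OF y])
      fix c x
      let ?L = "(*v) (jac \<phi> (\<psi> y))"
      have b: "bij ?L" using bij[OF y] by (simp add: app)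
      have "?L (c *s inv ?L x) = c *s x"
        using surj_f_inv_f[OF bij_is_surj[OF b]] by (simp add: vec.scale)
      then have "inv ?L (c *s x) = c *s inv ?L x" using inv_f_f[OF bij_is_inj[OF b]] by metis
      then show "g' y (c *s x) = c *s g' y x" by (simp add: g'[OF y] app)
    qed
    have 0: "\<psi> 0 = 0" using homeomorphism_apply1[OF hom U(3)] f0 by simp
    show ?thesis
    proof (rule that[OF t(1) hol 0])
      show "\<forall>\<^sub>F z in nhds 0. \<psi> (\<phi> z) = z"
        using U(1,3) homeomorphism_apply1[OF hom] by (auto simp: eventually_nhds)
      show "\<forall>\<^sub>F w in nhds 0. \<phi> (\<psi> w) = w"
        using V f0 homeomorphism_apply2[OF hom] by (auto simp: eventually_nhds)
    qed
  qed (use s cont inv in auto)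
qed

section \<open>The inductive limit topology on germs\<close>

lemma mem_germ_of: "h \<in> germ_of f \<longleftrightarrow> (\<forall>\<^sub>F z in nhds 0. h z = f z)"
  by (auto simp: germ_of_def eventually_nhds_metric Ball_def dist_commute)

lemma germ_of_eq_iff: "germ_of f = germ_of g \<longleftrightarrow> (\<forall>\<^sub>F z in nhds 0. f z = g z)"
proof
  assume "germ_of f = germ_of g"
  then have "f \<in> germ_of g" using mem_germ_of[of f f] by simp
  then show "\<forall>\<^sub>F z in nhds 0. f z = g z" by (simp add: mem_germ_of)
next
  assume "\<forall>\<^sub>F z in nhds 0. f z = g z"
  then have "(\<forall>\<^sub>F z in nhds 0. h z = f z) \<longleftrightarrow> (\<forall>\<^sub>F z in nhds 0. h z = g z)" for h
    by (auto elim: eventually_elim2)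
  then show "germ_of f = germ_of g" by (auto simp: mem_germ_of)
qed

lemma rep_in: "\<exists>f. F = germ_of f \<Longrightarrow> rep F \<in> F"
proof -
  assume "\<exists>f. F = germ_of f"
  then obtain f where "f \<in> F" using mem_germ_of eventually_True by (metis (mono_tags, lifting) eventuallyI)
  then show ?thesis unfolding rep_def by (rule someI[of "\<lambda>f. f \<in> F"])
qed

lemma eventually_rep_germ_of: "\<forall>\<^sub>F z in nhds 0. rep (germ_of f) z = f z"
  using rep_in[of "germ_of f"] mem_germ_of by blast

lemma has_derivative_rep_germ_of:
  assumes "(f has_derivative L) (at 0)"
  shows "(rep (germ_of f) has_derivative L) (at 0)"
  by (rule has_derivative_cong_near[OF _ assms])
    (use eventually_rep_germ_of[of f] in \<open>auto elim: eventually_mono\<close>)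

lemma d0_germ_of:
  fixes f :: "'m::finite cvec \<Rightarrow> 'm cvec"
  assumes "holo_on (ball 0 s) f" "0 < s"
  shows "d0 (germ_of f) = jac f 0"
proof -
  have "(f has_derivative (*v) (jac f 0)) (at 0)"
    using holo_on_has_derivative[OF assms(1), of 0] assms(2) by simp
  from jac_eqI[OF has_derivative_rep_germ_of[OF this]] show ?thesis
    by (simp add: d0_def dmat_eq_jac)
qed

text \<open>Elements of \<open>Xsp\<close> are normalised to vanish off their ball; truncation is
  therefore the form that restriction to a smaller ball takes in these spaces.\<close>

definition cut :: "real \<Rightarrow> ('m::finite cvec \<Rightarrow> 'm cvec) \<Rightarrow> 'm cvec \<Rightarrow> 'm cvec" where
  "cut s f z = (if z \<in> ball 0 s then f z else 0)"

lemma holo_on_cut: "holo_on (ball 0 s) f \<Longrightarrow> holo_on (ball 0 s) (cut s f)"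
  by (rule holo_on_cong[of _ f]) (auto simp: cut_def)

lemma germ_of_cut: "0 < s \<Longrightarrow> germ_of (cut s f) = germ_of f"
  by (auto simp: germ_of_eq_iff cut_def eventually_nhds_metric intro: exI[of _ s])

lemma uniform_limit_exD:
  assumes "uniform_limit S f g sequentially" "0 < e"
  shows "\<exists>N. \<forall>i\<ge>N. \<forall>z\<in>S. dist (f i z) (g z) < e"
  using assms unfolding uniform_limit_iff eventually_sequentially by blast

lemma Xsp_bound:
  assumes "f \<in> Xsp eps n"
  obtains B where "\<And>z. z \<in> ball 0 (eps n) \<Longrightarrow> norm (f z) \<le> B"
  using assms unfolding Xsp_def bounded_iff by blast

lemma norm_le_dX:
  assumes "f \<in> Xsp eps n" "g \<in> Xsp eps n" "z \<in> ball 0 (eps n)"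
  shows "norm (f z - g z) \<le> dX eps n f g"
proof -
  obtain a where a: "\<And>z. z \<in> ball 0 (eps n) \<Longrightarrow> norm (f z) \<le> a" using Xsp_bound[OF assms(1)] by blast
  obtain b where b: "\<And>z. z \<in> ball 0 (eps n) \<Longrightarrow> norm (g z) \<le> b" using Xsp_bound[OF assms(2)] by blast
  from a b have "norm (f z - g z) \<le> a + b" if "z \<in> ball 0 (eps n)" for z
    using that norm_triangle_ineq4[of "f z" "g z"] by (meson add_mono order_trans)
  then have "bdd_above ((\<lambda>z. norm (f z - g z)) ` ball 0 (eps n))" by (rule bdd_aboveI2)
  then show ?thesis unfolding dX_def by (rule cSUP_upper[OF assms(3)])
qed

locale radius_seq =
  fixes eps :: "nat \<Rightarrow> real"
  assumes eps_decr: "\<And>n. eps (Suc n) < eps n" and eps_lim: "eps \<longlonglongrightarrow> 0"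
begin

lemma eps_anti: "m \<le> n \<Longrightarrow> eps n \<le> eps m"
  using decseq_SucI[of eps] eps_decr less_imp_le by (metis decseqD)

lemma eps_pos: "0 < eps n"
proof -
  have "0 \<le> eps (Suc n)" using decseq_ge[OF _ eps_lim] decseq_SucI[of eps] eps_decr less_imp_le by metis
  then show ?thesis using eps_decr[of n] by simp
qed

lemma dX_le: "(\<And>z. z \<in> ball 0 (eps n) \<Longrightarrow> norm (f z - g z) \<le> a) \<Longrightarrow> dX eps n f g \<le> a"
  unfolding dX_def using eps_pos[of n] by (intro cSUP_least) auto

lemma Xsp_holo: "f \<in> Xsp eps n \<Longrightarrow> holo_on (ball 0 (eps n)) f"
  by (simp add: Xsp_def)

lemma germ_of_Xsp: "f \<in> Xsp eps n \<Longrightarrow> germ_of f \<in> Germs"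
  using eps_pos[of n] unfolding Germs_def Xsp_def by blast

lemma cut_Xsp:
  assumes "f \<in> Xsp eps n" "n \<le> k"
  shows "cut (eps k) f \<in> Xsp eps k"
proof -
  have sub: "ball 0 (eps k) \<subseteq> ball (0::'a cvec) (eps n)" using eps_anti[OF assms(2)] by auto
  have "cut (eps k) f ` ball 0 (eps k) \<subseteq> f ` ball 0 (eps n)" using sub by (auto simp: cut_def)
  then show ?thesis
    using assms holo_on_cut[OF holo_on_subset[OF _ sub]] eps_pos[of k] bounded_subset
    by (auto simp: Xsp_def cut_def)
qed

lemma Xsp_eqI:
  assumes "f \<in> Xsp eps n" "g \<in> Xsp eps n" "germ_of f = germ_of g"
  shows "f = g"
proof
  fix z show "f z = g z"
    using holo_on_identity[OF Xsp_holo[OF assms(1)] Xsp_holo[OF assms(2)]] assms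
    by (cases "z \<in> ball 0 (eps n)") (auto simp: germ_of_eq_iff Xsp_def)
qed

lemma istopology_germ_open: "istopology (germ_open eps :: ('m::finite cvec \<Rightarrow> 'm cvec) set set \<Rightarrow> bool)"
  unfolding istopology_def
proof (intro conjI allI impI)
  fix S T :: "('m cvec \<Rightarrow> 'm cvec) set set"
  assume S: "germ_open eps S" and T: "germ_open eps T"
  show "germ_open eps (S \<inter> T)"
    unfolding germ_open_def
  proof (intro conjI allI ballI impI)
    show "S \<inter> T \<subseteq> Germs" using S by (auto simp: germ_open_def)
    fix n f assume f: "f \<in> Xsp eps n" "germ_of f \<in> S \<inter> T"
    obtain a where a: "a > 0" "\<forall>g\<in>Xsp eps n. dX eps n f g < a \<longrightarrow> germ_of g \<in> S"
      using S f unfolding germ_open_def by blast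
    obtain b where b: "b > 0" "\<forall>g\<in>Xsp eps n. dX eps n f g < b \<longrightarrow> germ_of g \<in> T"
      using T f unfolding germ_open_def by blast
    show "\<exists>\<delta>>0. \<forall>g\<in>Xsp eps n. dX eps n f g < \<delta> \<longrightarrow> germ_of g \<in> S \<inter> T"
      using a b by (intro exI[of _ "min a b"]) auto
  qed
next
  fix \<K> :: "('m cvec \<Rightarrow> 'm cvec) set set set"
  assume K: "\<forall>K\<in>\<K>. germ_open eps K"
  show "germ_open eps (\<Union>\<K>)"
    unfolding germ_open_def
  proof (intro conjI allI ballI impI)
    show "\<Union>\<K> \<subseteq> Germs" using K by (auto simp: germ_open_def)
    fix n f assume f: "f \<in> Xsp eps n" "germ_of f \<in> \<Union>\<K>"
    then obtain U where U: "U \<in> \<K>" "germ_of f \<in> U" by blast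
    then obtain a where "a > 0" "\<forall>g\<in>Xsp eps n. dX eps n f g < a \<longrightarrow> germ_of g \<in> U"
      using K f unfolding germ_open_def by blast
    then show "\<exists>\<delta>>0. \<forall>g\<in>Xsp eps n. dX eps n f g < \<delta> \<longrightarrow> germ_of g \<in> \<Union>\<K>" using U by blast
  qed
qed

lemma openin_germ: "openin (germ_topology eps) U \<longleftrightarrow> germ_open eps (U :: ('m::finite cvec \<Rightarrow> 'm cvec) set set)"
  unfolding germ_topology_def using istopology_germ_open topology_inverse' by metis

lemma topspace_germ: "topspace (germ_topology eps) = (Germs :: ('m::finite cvec \<Rightarrow> 'm cvec) set set)"
proof -
  have "germ_open eps (Germs :: ('m cvec \<Rightarrow> 'm cvec) set set)"
    unfolding germ_open_def using germ_of_Xsp zero_less_one by blast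
  moreover have "germ_open eps U \<Longrightarrow> U \<subseteq> Germs" for U :: "('m cvec \<Rightarrow> 'm cvec) set set"
    by (simp add: germ_open_def)
  ultimately show ?thesis unfolding topspace_def openin_germ by blast
qed

text \<open>Openness is tested in each metric space X_n separately, so closedness can be tested on
  sequences inside one X_n: if the complement is not open at g, points of A lie within 1 / (i + 1)
  of g.\<close>

lemma closedin_germI:
  fixes A :: "('m::finite cvec \<Rightarrow> 'm cvec) set set"
  assumes A: "A \<subseteq> Germs"
    and lim: "\<And>n f g. (\<And>i. f i \<in> Xsp eps n) \<Longrightarrow> (\<And>i. germ_of (f i) \<in> A) \<Longrightarrow> g \<in> Xsp eps n
      \<Longrightarrow> uniform_limit (ball 0 (eps n)) f g sequentially \<Longrightarrow> germ_of g \<in> A"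
  shows "closedin (germ_topology eps) A"
proof -
  have "germ_open eps (Germs - A)"
    unfolding germ_open_def
  proof (intro conjI allI ballI impI, force)
    fix n g assume g: "g \<in> Xsp eps n" "germ_of g \<in> Germs - A"
    show "\<exists>\<delta>>0. \<forall>h\<in>Xsp eps n. dX eps n g h < \<delta> \<longrightarrow> germ_of h \<in> Germs - A"
    proof (rule ccontr)
      assume "\<not> ?thesis"
      then have "\<exists>h\<in>Xsp eps n. dX eps n g h < 1 / real (Suc i) \<and> germ_of h \<in> A" for i
        using germ_of_Xsp[of _ n] by (metis DiffI of_nat_0_less_iff zero_less_Suc zero_less_divide_1_iff)
      then obtain f where f: "\<And>i. f i \<in> Xsp eps n" "\<And>i. dX eps n g (f i) < 1 / real (Suc i)" "\<And>i. germ_of (f i) \<in> A"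
        by metis
      have "uniform_limit (ball 0 (eps n)) f g sequentially"
      proof (rule uniform_limitI)
        fix e :: real assume "e > 0"
        then obtain N where N: "1 / real (Suc N) < e" by (meson nat_approx_posE)
        have "dist (f i z) (g z) < e" if "i \<ge> N" "z \<in> ball 0 (eps n)" for i z
        proof -
          have "dist (f i z) (g z) \<le> dX eps n g (f i)"
            using norm_le_dX[OF g(1) f(1) that(2)] by (simp add: dist_norm norm_minus_commute)
          also have "\<dots> < 1 / real (Suc i)" by (rule f(2))
          also have "\<dots> \<le> 1 / real (Suc N)" using that(1) by (simp add: frac_le)
          finally show ?thesis using N by simp
        qed
        then show "\<forall>\<^sub>F i in sequentially. \<forall>z\<in>ball 0 (eps n). dist (f i z) (g z) < e"
          unfolding eventually_sequentially by blast
      qed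
      from lim[OF f(1) f(3) g(1) this] show False using g(2) by blast
    qed
  qed
  then show ?thesis using A by (simp add: closedin_def topspace_germ openin_germ)
qed

lemma closedin_germD:
  fixes A :: "('m::finite cvec \<Rightarrow> 'm cvec) set set"
  assumes A: "closedin (germ_topology eps) A"
    and f: "\<And>i. f i \<in> Xsp eps n" "\<And>i. germ_of (f i) \<in> A" "g \<in> Xsp eps n"
      "uniform_limit (ball 0 (eps n)) f g sequentially"
  shows "germ_of g \<in> A"
proof (rule ccontr)
  assume "germ_of g \<notin> A"
  moreover have "germ_open eps (Germs - A)"
    using A by (simp add: closedin_def topspace_germ openin_germ)
  ultimately obtain d where d: "d > 0" "\<forall>h\<in>Xsp eps n. dX eps n g h < d \<longrightarrow> germ_of h \<in> Germs - A"
    using f(3) germ_of_Xsp unfolding germ_open_def by (metis DiffI)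
  obtain N where N: "\<And>i z. i \<ge> N \<Longrightarrow> z \<in> ball 0 (eps n) \<Longrightarrow> dist (f i z) (g z) < d / 2"
    using uniform_limit_exD[OF f(4) half_gt_zero[OF d(1)]] by blast
  define i where "i = N"
  have i: "\<And>z. z \<in> ball 0 (eps n) \<Longrightarrow> dist (f i z) (g z) < d / 2"
    unfolding i_def by (rule N[OF order_refl])
  have "dX eps n g (f i) \<le> d / 2"
    using i by (intro dX_le) (metis dist_commute dist_norm less_imp_le)
  then show False using d f(1)[of i] f(2)[of i] by auto
qed

text \<open>Jacobians converge under uniform limits, so \<open>d0\<close> is continuous. This gives
  its measurability and makes open conditions on the differential open conditions on germs.\<close>

lemma openin_germ_d0_vimage:
  fixes B :: "'m::finite cmat set"
  assumes "open B"
  shows "openin (germ_topology eps) {F\<in>Germs. d0 F \<in> B}"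
proof -
  have "closedin (germ_topology eps) {F\<in>Germs. d0 F \<notin> B}"
  proof (rule closedin_germI)
    fix n and f :: "nat \<Rightarrow> 'm cvec \<Rightarrow> 'm cvec" and g
    assume f: "\<And>i. f i \<in> Xsp eps n" "\<And>i. germ_of (f i) \<in> {F\<in>Germs. d0 F \<notin> B}" and g: "g \<in> Xsp eps n"
      and ul: "uniform_limit (ball 0 (eps n)) f g sequentially"
    have d: "d0 (germ_of h) = jac h 0" if "h \<in> Xsp eps n" for h
      by (rule d0_germ_of[OF Xsp_holo[OF that] eps_pos])
    have "(\<lambda>i. jac (f i) 0) \<longlonglongrightarrow> jac g 0"
      using holo_on_uniform_limit(2)[OF Xsp_holo[OF f(1)] ul, of 0] eps_pos[of n] by simp
    moreover have "jac (f i) 0 \<in> - B" for i using f(2)[of i] d[OF f(1)] by simp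
    ultimately have "jac g 0 \<in> - B"
      using closed_sequentially[of "- B" "\<lambda>i. jac (f i) 0" "jac g 0"] assms by (simp add: closed_def)
    then show "germ_of g \<in> {F\<in>Germs. d0 F \<notin> B}" using d[OF g] germ_of_Xsp[OF g] by simp
  qed auto
  then have "openin (germ_topology eps) (Germs - {F\<in>Germs. d0 F \<notin> B})"
    unfolding closedin_def topspace_germ by (rule conjunct2)
  moreover have "Germs - {F\<in>Germs. d0 F \<notin> B} = {F\<in>Germs. d0 F \<in> B}" by auto
  ultimately show ?thesis by metis
qed

text \<open>One index serves both as radius index and as bound, so that the resulting sets of germs
  increase with n and exhaust \<open>Germs\<close>. By Montel each is precompact for uniform
  convergence on the next smaller ball.\<close>

definition bdd_fun :: "nat \<Rightarrow> ('m::finite cvec \<Rightarrow> 'm cvec) set" where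
  "bdd_fun n = {f \<in> Xsp eps n. \<forall>z\<in>ball 0 (eps n). norm (f z) \<le> real n}"

lemma cut_bdd_fun:
  assumes "f \<in> Xsp eps n" "\<And>z. z \<in> ball 0 (eps n) \<Longrightarrow> norm (f z) \<le> real k" "n \<le> k"
  shows "cut (eps k) f \<in> bdd_fun k" "germ_of (cut (eps k) f) = germ_of f"
  using cut_Xsp[OF assms(1,3)] assms(2) eps_anti[OF assms(3)] eps_pos[of k] germ_of_cut
  by (auto simp: bdd_fun_def cut_def)

lemma bdd_germs_mono:
  assumes "n \<le> k"
  shows "germ_of ` bdd_fun n \<subseteq> germ_of ` bdd_fun k"
proof
  fix F assume "F \<in> germ_of ` bdd_fun n"
  then obtain f where f: "f \<in> Xsp eps n" "\<And>z. z \<in> ball 0 (eps n) \<Longrightarrow> norm (f z) \<le> real n" "F = germ_of f"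
    by (auto simp: bdd_fun_def)
  have "norm (f z) \<le> real k" if "z \<in> ball 0 (eps n)" for z using f(2)[OF that] assms by simp
  from cut_bdd_fun[OF f(1) this assms] show "F \<in> germ_of ` bdd_fun k" using f(3) by (metis imageI)
qed

lemma Germs_bdd:
  assumes "F \<in> Germs"
  shows "\<exists>n. F \<in> germ_of ` bdd_fun n"
proof -
  obtain f r where f: "F = germ_of f" "0 < r" "holo_on (ball 0 r) f" "f 0 = 0"
    using assms by (auto simp: Germs_def)
  have "\<forall>\<^sub>F n in sequentially. eps n < r" using order_tendstoD(2)[OF eps_lim f(2)] .
  then obtain n where n: "eps n < r" unfolding eventually_sequentially by blast
  have sub: "cball 0 (eps n) \<subseteq> ball (0::'a cvec) r" using n by auto
  have "compact (f ` cball 0 (eps n))"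
    by (intro compact_continuous_image continuous_on_subset[OF holo_on_imp_continuous_on[OF f(3)] sub]) simp
  then obtain B where B: "\<And>z. z \<in> cball 0 (eps n) \<Longrightarrow> norm (f z) \<le> B"
    using compact_imp_bounded bounded_iff by (metis image_eqI)
  have sub': "ball 0 (eps n) \<subseteq> ball (0::'a cvec) r" using n by auto
  have c: "cut (eps n) f \<in> Xsp eps n"
    using holo_on_cut[OF holo_on_subset[OF f(3) sub']] eps_pos[of n] f(4) B
    by (auto simp: Xsp_def cut_def bounded_iff intro!: exI[of _ B])
  obtain k where k: "B \<le> real k" "n \<le> k"
    by (meson nat_le_linear of_nat_mono order_trans real_arch_simple)
  have "norm (cut (eps n) f z) \<le> real k" if "z \<in> ball 0 (eps n)" for z
    using B[of z] that k by (auto simp: cut_def)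
  from cut_bdd_fun[OF c this k(2)] germ_of_cut[OF eps_pos, of n f] f(1)
  show ?thesis by (metis imageI)
qed

text \<open>A sequence of germs leaving every bounded set has closed tails, so it cannot lie in a compact set.\<close>

lemma compact_germs_bdd:
  fixes S :: "('m::finite cvec \<Rightarrow> 'm cvec) set set"
  assumes S: "compactin (germ_topology eps) S"
  shows "\<exists>n. S \<subseteq> germ_of ` bdd_fun n"
proof (rule ccontr)
  assume "\<nexists>n. S \<subseteq> germ_of ` bdd_fun n"
  then have "\<forall>n. \<exists>F. F \<in> S \<and> F \<notin> germ_of ` bdd_fun n" by blast
  then obtain x where x: "\<And>n. x n \<in> S" "\<And>n. x n \<notin> germ_of ` bdd_fun n" by metis
  have SG: "S \<subseteq> Germs" using S compactin_subset_topspace topspace_germ by metis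
  define A where "A N = x ` {N..}" for N
  have closed: "closedin (germ_topology eps) (A N)" for N
  proof (rule closedin_germI)
    show "A N \<subseteq> Germs" using x(1) SG by (auto simp: A_def)
    fix n and f :: "nat \<Rightarrow> 'm cvec \<Rightarrow> 'm cvec" and g
    assume f: "\<And>i. f i \<in> Xsp eps n" "\<And>i. germ_of (f i) \<in> A N" and g: "g \<in> Xsp eps n"
      and ul: "uniform_limit (ball 0 (eps n)) f g sequentially"
    obtain B where B: "\<And>z. z \<in> ball 0 (eps n) \<Longrightarrow> norm (g z) \<le> B"
      using Xsp_bound[OF g] by blast
    obtain k where k: "B + 1 \<le> real k" "n \<le> k"
      by (meson nat_le_linear of_nat_mono order_trans real_arch_simple)
    obtain I where I: "\<And>i z. i \<ge> I \<Longrightarrow> z \<in> ball 0 (eps n) \<Longrightarrow> dist (f i z) (g z) < 1"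
      using uniform_limit_exD[OF ul zero_less_one] by blast
    \<comment> \<open>A uniformly convergent sequence is bounded, whereas x l lies outside the k-th
      bounded set for l \<ge> k. So the tail takes finitely many germ values; one recurs infinitely
      often and must be the limit.\<close>
    have fk: "germ_of (f i) \<in> x ` {..<k}" if "i \<ge> I" for i
    proof -
      have "norm (f i z) \<le> real k" if z: "z \<in> ball 0 (eps n)" for z
        using I[OF \<open>i \<ge> I\<close> z] B[OF z] k(1) norm_triangle_ineq2[of "f i z" "g z"] by (simp add: dist_norm)
      from cut_bdd_fun[OF f(1) this k(2)] have mem: "germ_of (f i) \<in> germ_of ` bdd_fun k" by (metis imageI)
      obtain l where l: "germ_of (f i) = x l" using f(2)[of i] by (auto simp: A_def)
      have "l < k"
      proof (rule ccontr)
        assume "\<not> l < k"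
        then have "x l \<in> germ_of ` bdd_fun l" using bdd_germs_mono[of k l] mem l by auto
        then show False using x(2) by blast
      qed
      then show ?thesis using l by auto
    qed
    have "\<exists>i0\<in>{I..}. infinite {i \<in> {I..}. germ_of (f i) = germ_of (f i0)}"
    proof (rule pigeonhole_infinite)
      show "infinite {I..}" by (rule infinite_Ici)
      show "finite ((\<lambda>i. germ_of (f i)) ` {I..})"
        by (rule finite_subset[of _ "x ` {..<k}"]) (use fk in auto)
    qed
    then obtain i0 where i0: "infinite {i \<in> {I..}. germ_of (f i) = germ_of (f i0)}" by blast
    have "f i0 z = g z" if z: "z \<in> ball 0 (eps n)" for z
    proof (rule ccontr)
      assume "f i0 z \<noteq> g z"
      then have "dist (f i0 z) (g z) > 0" by simp
      then have "\<forall>\<^sub>F i in sequentially. dist (f i z) (g z) < dist (f i0 z) (g z)"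
        using tendsto_uniform_limitI[OF ul z] tendstoD by blast
      then obtain J where J: "\<And>i. i \<ge> J \<Longrightarrow> dist (f i z) (g z) < dist (f i0 z) (g z)"
        unfolding eventually_sequentially by blast
      obtain i where i: "i \<ge> J" "germ_of (f i) = germ_of (f i0)"
        using i0 unfolding infinite_nat_iff_unbounded_le by blast
      show False using J[OF i(1)] Xsp_eqI[OF f(1) f(1) i(2)] by simp
    qed
    then have "f i0 z = g z" for z
      using f(1)[of i0] g by (cases "z \<in> ball 0 (eps n)") (auto simp: Xsp_def)
    then have "f i0 = g" by blast
    then show "germ_of g \<in> A N" using f(2)[of i0] by simp
  qed
  have "S \<inter> \<Inter> (range A) \<noteq> {}"
  proof (rule S[unfolded compactin_fip, THEN conjunct2, rule_format], intro conjI ballI allI impI)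
    show "closedin (germ_topology eps) C" if "C \<in> range A" for C using that closed by auto
    fix \<F> assume "finite \<F> \<and> \<F> \<subseteq> range A"
    then obtain J where J: "finite J" "\<F> = A ` J" using finite_subset_image by metis
    define M where "M = Max (insert 0 J)"
    have "x M \<in> C" if C: "C \<in> \<F>" for C
    proof -
      obtain N where N: "N \<in> J" "C = A N" using J(2) C by blast
      then have "N \<le> M" using J(1) by (simp add: M_def)
      then show ?thesis using N by (simp add: A_def)
    qed
    then show "S \<inter> \<Inter> \<F> \<noteq> {}" using x(1) by blast
  qed
  then obtain y where y: "y \<in> S" "\<And>N. y \<in> A N" by auto
  obtain n where n: "y \<in> germ_of ` bdd_fun n" using Germs_bdd y(1) SG by blast
  obtain l where "l \<ge> n" "y = x l" using y(2)[of n] by (auto simp: A_def)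
  then show False using n x(2)[of l] bdd_germs_mono by blast
qed

text \<open>Otherwise dependent choice builds an infinite sequence that is e-separated on the
  smaller ball, where Montel provides a uniformly convergent subsequence.\<close>

lemma bdd_fun_finite_net:
  assumes e: "0 < e"
  shows "\<exists>D. finite D \<and> D \<subseteq> bdd_fun n \<and>
    (\<forall>f\<in>bdd_fun n. \<exists>g\<in>D. \<forall>z\<in>ball 0 (eps (Suc n)). norm (f z - g z :: 'm::finite cvec) < e)"
proof (rule ccontr)
  assume no: "\<not> ?thesis"
  let ?P = "\<lambda>(s :: nat \<Rightarrow> 'm cvec \<Rightarrow> 'm cvec) i f. f \<in> bdd_fun n \<and>
     (\<forall>j<i. \<exists>z\<in>ball 0 (eps (Suc n)). e \<le> norm (f z - s j z))"
  have "\<exists>s. \<forall>i. ?P s i (s i)"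
  proof (rule dependent_wellorder_choice)
    fix i and s :: "nat \<Rightarrow> 'm cvec \<Rightarrow> 'm cvec"
    assume "\<And>j. j < i \<Longrightarrow> ?P s j (s j)"
    then have "finite (s ` {..<i}) \<and> s ` {..<i} \<subseteq> bdd_fun n" by auto
    with no have "\<not> (\<forall>f\<in>bdd_fun n. \<exists>g\<in>s ` {..<i}. \<forall>z\<in>ball 0 (eps (Suc n)). norm (f z - g z) < e)"
      by blast
    then show "\<exists>f. ?P s i f" by (auto simp: not_less)
  qed auto
  then obtain s where s: "\<And>i. ?P s i (s i)" by blast
  have "\<exists>k h. strict_mono (k::nat \<Rightarrow> nat) \<and> uniform_limit (cball 0 (eps (Suc n))) (\<lambda>i. s (k i)) h sequentially"
  proof (rule holo_on_montel[where s = "eps n" and R = "real n"])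
    show "holo_on (ball 0 (eps n)) (s i)" for i using s[of i] by (simp add: bdd_fun_def Xsp_def)
    show "norm (s i w) \<le> real n" if "w \<in> ball 0 (eps n)" for i w
      using s[of i] that unfolding bdd_fun_def by blast
  qed (rule eps_decr)
  then obtain k h where k: "strict_mono (k::nat \<Rightarrow> nat)" and
    ul: "uniform_limit (cball 0 (eps (Suc n))) (\<lambda>i. s (k i)) h sequentially" by blast
  obtain I where I: "\<And>i z. i \<ge> I \<Longrightarrow> z \<in> cball 0 (eps (Suc n)) \<Longrightarrow> dist (s (k i) z) (h z) < e / 2"
    using uniform_limit_exD[OF ul half_gt_zero[OF e]] by blast
  have "k I < k (Suc I)" using k by (simp add: strict_mono_Suc_iff)
  then obtain z where z: "z \<in> ball 0 (eps (Suc n))" "e \<le> norm (s (k (Suc I)) z - s (k I) z)"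
    using s[of "k (Suc I)"] by blast
  have "dist (s (k (Suc I)) z) (h z) < e / 2" "dist (s (k I) z) (h z) < e / 2"
    using I[of "Suc I" z] I[of I z] z(1) by auto
  then show False using z(2) dist_triangle2[of "s (k (Suc I)) z" "s (k I) z" "h z"] by (simp add: dist_norm)
qed

section \<open>Borel measures on germs and their supports\<close>

lemma borel_of_germs:
  fixes \<nu> :: "('m::finite cvec \<Rightarrow> 'm cvec) set measure"
  assumes borel: "sets \<nu> = sets (borel_of (germ_topology eps))"
  shows "space \<nu> = Germs" "openin (germ_topology eps) U \<Longrightarrow> U \<in> sets \<nu>"
proof -
  let ?T = "germ_topology eps :: ('m cvec \<Rightarrow> 'm cvec) set topology"
  have sub: "{U. openin ?T U} \<subseteq> Pow (topspace ?T)" using openin_subset by blast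
  show "space \<nu> = Germs"
    using sets_eq_imp_space_eq[OF borel] sub by (simp add: borel_of_def space_measure_of topspace_germ)
  show "openin (germ_topology eps) U \<Longrightarrow> U \<in> sets \<nu>"
    unfolding borel borel_of_def using sub by (simp add: sets_measure_of sigma_sets.Basic)
qed

text \<open>A Lindelof argument: the complement of the support is a union of open null sets, and
  countably many finite nets select a countable subfamily that still covers it.\<close>

lemma supp_of_germs_AE:
  fixes \<nu> :: "('m::finite cvec \<Rightarrow> 'm cvec) set measure"
  assumes borel: "sets \<nu> = sets (borel_of (germ_topology eps))"
  shows "AE F in \<nu>. F \<in> supp_of (germ_topology eps) \<nu>"
proof -
  let ?T = "germ_topology eps :: ('m cvec \<Rightarrow> 'm cvec) set topology"
  let ?S = "supp_of ?T \<nu>"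
  note space = borel_of_germs(1)[OF borel] and opens = borel_of_germs(2)[OF borel]
  define Nul where "Nul = {U. openin ?T U \<and> emeasure \<nu> U = 0}"
  define net where "net n k = (SOME D. finite D \<and> D \<subseteq> bdd_fun n \<and>
    (\<forall>f\<in>bdd_fun n. \<exists>g\<in>D. \<forall>z\<in>ball 0 (eps (Suc n)). norm (f z - g z :: 'm cvec) < 1 / real (Suc k)))" for n k
  have net: "finite (net n k)" "net n k \<subseteq> bdd_fun n"
    "\<And>f. f \<in> bdd_fun n \<Longrightarrow> \<exists>g\<in>net n k. \<forall>z\<in>ball 0 (eps (Suc n)). norm (f z - g z) < 1 / real (Suc k)" for n k
  proof -
    have "1 / real (Suc k) > 0" by simp
    from someI_ex[OF bdd_fun_finite_net[OF this, of n]]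
    show "finite (net n k)" "net n k \<subseteq> bdd_fun n"
      "\<And>f. f \<in> bdd_fun n \<Longrightarrow> \<exists>g\<in>net n k. \<forall>z\<in>ball 0 (eps (Suc n)). norm (f z - g z) < 1 / real (Suc k)"
      unfolding net_def by blast+
  qed
  \<comment> \<open>U is an open null set containing all germs from \<open>bdd_fun n\<close> whose
    distance to the net point g is below 1 / (k + 1). One such U is kept for every triple (n, k, g)
    that admits one.\<close>
  define good where "good n k g U \<longleftrightarrow> U \<in> Nul \<and>
    (\<forall>f\<in>bdd_fun n. (\<forall>z\<in>ball 0 (eps (Suc n)). norm (f z - g z) < 1 / real (Suc k)) \<longrightarrow> germ_of f \<in> U)"
    for n k g U
  define Cov where "Cov = (\<Union>n k. (\<lambda>g. SOME U. good n k g U) ` {g \<in> net n k. \<exists>U. good n k g U})"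
  have "countable ((\<lambda>g. SOME U. good n k g U) ` {g \<in> net n k. \<exists>U. good n k g U})" for n k
    by (intro countable_image countable_finite) (simp add: net(1))
  then have "countable Cov"
    unfolding Cov_def by (intro countable_UN) auto
  moreover have CovN: "Cov \<subseteq> Nul"
  proof
    fix V assume "V \<in> Cov"
    then obtain n k g where "V = (SOME U. good n k g U)" "\<exists>U. good n k g U" unfolding Cov_def by blast
    then have "good n k g V" using someI_ex by metis
    then show "V \<in> Nul" by (simp add: good_def)
  qed
  moreover have "U \<in> null_sets \<nu>" if "U \<in> Cov" for U
    using CovN that opens by (auto simp: Nul_def null_sets_def)
  ultimately have "(\<Union>U\<in>Cov. U) \<in> null_sets \<nu>"
    by (intro null_sets_UN')
  moreover have "{F \<in> space \<nu>. F \<notin> ?S} \<subseteq> (\<Union>U\<in>Cov. U)"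
  proof
    fix F assume "F \<in> {F \<in> space \<nu>. F \<notin> ?S}"
    then have F: "F \<in> Germs" "F \<notin> ?S" using space by auto
    then obtain U where U: "U \<in> Nul" "F \<in> U"
      by (auto simp: supp_of_def topspace_germ Nul_def)
    obtain n f where f: "f \<in> bdd_fun n" "F = germ_of f" using Germs_bdd[OF F(1)] by blast
    have fX: "f \<in> Xsp eps n" using f by (simp add: bdd_fun_def)
    let ?c = "cut (eps (Suc n))"
    have cX: "?c h \<in> Xsp eps (Suc n)" "germ_of (?c h) = germ_of h" if "h \<in> bdd_fun n" for h :: "'m cvec \<Rightarrow> 'm cvec"
      using cut_Xsp[of h n "Suc n"] that germ_of_cut[OF eps_pos] by (auto simp: bdd_fun_def)
    have "germ_open eps U" using U(1) by (simp add: Nul_def openin_germ)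
    then obtain d where d: "d > 0" "\<And>g. g \<in> Xsp eps (Suc n) \<Longrightarrow> dX eps (Suc n) (?c f) g < d \<Longrightarrow> germ_of g \<in> U"
      unfolding germ_open_def using cX[OF f(1)] U(2) f(2) by metis
    \<comment> \<open>Half of d, because two maps close to the same net point may be 2 / (k + 1)
      apart.\<close>
    obtain k where k: "1 / real (Suc k) < d / 2" using d(1) by (meson half_gt_zero nat_approx_posE)
    obtain g where g: "g \<in> net n k" "\<And>z. z \<in> ball 0 (eps (Suc n)) \<Longrightarrow> norm (f z - g z) < 1 / real (Suc k)"
      using net(3)[OF f(1)] by blast
    have "good n k g U"
      unfolding good_def
    proof (intro conjI U(1) ballI impI)
      fix h assume h: "h \<in> bdd_fun n" "\<forall>z\<in>ball 0 (eps (Suc n)). norm (h z - g z) < 1 / real (Suc k)"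
      have "dX eps (Suc n) (?c f) (?c h) \<le> 2 / real (Suc k)"
      proof (rule dX_le)
        fix z :: "'m cvec" assume z: "z \<in> ball 0 (eps (Suc n))"
        have "norm (f z - h z) \<le> norm (f z - g z) + norm (h z - g z)"
          using norm_triangle_ineq4[of "f z - g z" "h z - g z"] by simp
        then show "norm (?c f z - ?c h z) \<le> 2 / real (Suc k)"
          using g(2)[OF z] h(2) z by (fastforce simp: cut_def)
      qed
      then show "germ_of h \<in> U" using d(2)[OF cX(1)[OF h(1)]] cX(2)[OF h(1)] k by simp
    qed
    then have ex: "\<exists>U. good n k g U" by blast
    then have "good n k g (SOME U. good n k g U)" by (rule someI_ex)
    then have "F \<in> (SOME U. good n k g U)" using f g(2) by (simp add: good_def)
    moreover have "(SOME U. good n k g U) \<in> Cov" unfolding Cov_def using g(1) ex by blast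
    ultimately show "F \<in> (\<Union>U\<in>Cov. U)" by blast
  qed
  ultimately show ?thesis by (rule AE_I')
qed

lemma closedin_supp_of: "closedin T (supp_of T M)"
proof -
  have "topspace T - supp_of T M = \<Union>{U. openin T U \<and> \<not> emeasure M U > 0}"
    using openin_subset by (fastforce simp: supp_of_def)
  moreover have "openin T (\<Union>{U. openin T U \<and> \<not> emeasure M U > 0})" by (rule openin_Union) simp
  ultimately have "openin T (topspace T - supp_of T M)" by simp
  then show ?thesis by (auto simp: closedin_def supp_of_def)
qed

definition bdd_rep :: "nat \<Rightarrow> ('m::finite cvec \<Rightarrow> 'm cvec) set \<Rightarrow> 'm cvec \<Rightarrow> 'm cvec" where
  "bdd_rep n F = (SOME f. f \<in> bdd_fun n \<and> F = germ_of f)"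

lemma bdd_rep:
  assumes "F \<in> germ_of ` bdd_fun n"
  shows "bdd_rep n F \<in> bdd_fun n" "germ_of (bdd_rep n F) = F"
  using someI_ex[of "\<lambda>f. f \<in> bdd_fun n \<and> F = germ_of f"] assms unfolding bdd_rep_def by blast+

text \<open>Convergence in some X_p controls representatives only on a possibly smaller ball. On a
  closed bounded set of germs, Montel and the identity theorem upgrade it to uniform convergence on
  \<open>ball 0 s\<close>.\<close>

lemma closed_bdd_germs_nhd:
  fixes S :: "('m::finite cvec \<Rightarrow> 'm cvec) set set"
  assumes S: "closedin (germ_topology eps) S" "S \<subseteq> germ_of ` bdd_fun n"
    and s: "0 < s" "s < eps n" and d: "0 < d" and F: "F \<in> S"
  shows "\<exists>U. openin (germ_topology eps) U \<and> F \<in> U \<and>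
    (\<forall>G\<in>U \<inter> S. \<forall>z\<in>ball 0 s. norm (bdd_rep n G z - bdd_rep n F z) < d)"
proof -
  let ?f = "bdd_rep n"
  \<comment> \<open>Expresses that the supremum of the distance is at least d without its being
    attained; in this form the condition survives uniform limits.\<close>
  define A where "A = {G\<in>S. \<forall>c<d. \<exists>z\<in>ball 0 s. c \<le> norm (?f G z - ?f F z)}"
  have SG: "S \<subseteq> Germs" using closedin_subset[OF S(1)] topspace_germ by metis
  have rep: "?f G \<in> bdd_fun n" "germ_of (?f G) = G" if "G \<in> S" for G
    using bdd_rep[of G n] S(2) that by blast+
  have hol: "holo_on (ball 0 (eps n)) (?f G)" and bd: "z \<in> ball 0 (eps n) \<Longrightarrow> norm (?f G z) \<le> real n"
    if "G \<in> S" for G z using rep(1)[OF that] by (auto simp: bdd_fun_def Xsp_def)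
  have "closedin (germ_topology eps) A"
  proof (rule closedin_germI)
    show "A \<subseteq> Germs" using SG by (auto simp: A_def)
    fix p and f :: "nat \<Rightarrow> 'm cvec \<Rightarrow> 'm cvec" and g
    assume f: "\<And>i. f i \<in> Xsp eps p" "\<And>i. germ_of (f i) \<in> A" and g: "g \<in> Xsp eps p"
      and ul: "uniform_limit (ball 0 (eps p)) f g sequentially"
    have fS: "germ_of (f i) \<in> S" for i using f(2)[of i] by (simp add: A_def)
    have gS: "germ_of g \<in> S" by (rule closedin_germD[OF S(1) f(1) fS g ul])
    let ?h = "\<lambda>i. ?f (germ_of (f i))"
    \<comment> \<open>The approximants f i and their bounded representatives live on different
      balls; q is a radius at which both are available.\<close>
    define q where "q = min (eps p) s"
    have q: "0 < q" "q \<le> eps p" "q \<le> s" using eps_pos s by (auto simp: q_def)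
    have eq: "?h i z = f i z" if "z \<in> ball 0 q" for i z
    proof (rule holo_on_identity[where s = q and f = "?h i" and g = "f i"])
      show "holo_on (ball 0 q) (?h i)" using q s by (intro holo_on_subset[OF hol[OF fS]]) auto
      show "holo_on (ball 0 q) (f i)" using q by (intro holo_on_subset[OF Xsp_holo[OF f(1)]]) auto
      show "\<forall>\<^sub>F z in nhds 0. ?h i z = f i z" using rep(2)[OF fS] by (simp flip: germ_of_eq_iff)
    qed (rule that)
    obtain k h where k: "strict_mono (k::nat \<Rightarrow> nat)" and
      uh: "uniform_limit (cball 0 s) (\<lambda>i. ?h (k i)) h sequentially"
      using holo_on_montel[of "eps n" ?h "real n" s] hol[OF fS] bd[OF fS] s(2) by blast
    have uh': "uniform_limit (ball 0 s) (\<lambda>i. ?h (k i)) h sequentially"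
      by (rule uniform_limit_on_subset[OF uh]) auto
    have hh: "holo_on (ball 0 s) h"
      using s by (intro holo_on_uniform_limit(1)[OF _ uh'] holo_on_subset[OF hol[OF fS]]) auto
    have "h z = g z" if z: "z \<in> ball 0 q" for z
    proof -
      have "z \<in> ball 0 s" "z \<in> ball 0 (eps p)" using z q by auto
      then have "(\<lambda>i. ?h (k i) z) \<longlonglongrightarrow> h z" "(\<lambda>i. f (k i) z) \<longlonglongrightarrow> g z"
        using tendsto_uniform_limitI[OF uh'] LIMSEQ_subseq_LIMSEQ[OF tendsto_uniform_limitI[OF ul] k]
        by (auto simp: o_def)
      then show ?thesis using eq[OF z] LIMSEQ_unique by simp
    qed
    then have "\<forall>\<^sub>F z in nhds 0. h z = g z"
      using q(1) by (auto simp: eventually_nhds_metric intro!: exI[of _ q])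
    moreover have "\<forall>\<^sub>F z in nhds 0. ?f (germ_of g) z = g z"
      using rep(2)[OF gS] by (simp flip: germ_of_eq_iff)
    ultimately have ev: "\<forall>\<^sub>F z in nhds 0. h z = ?f (germ_of g) z" by eventually_elim simp
    have hg: "holo_on (ball 0 s) (?f (germ_of g))" using s by (intro holo_on_subset[OF hol[OF gS]]) auto
    have heq: "h z = ?f (germ_of g) z" if "z \<in> ball 0 s" for z by (rule holo_on_identity[OF hh hg ev that])
    show "germ_of g \<in> A"
      unfolding A_def
    proof (intro CollectI conjI gS allI impI)
      fix c assume c: "c < d"
      have "0 < (d - c) / 2" using c by simp
      then obtain i where i: "\<And>z. z \<in> ball 0 s \<Longrightarrow> dist (?h (k i) z) (h z) < (d - c) / 2"
        using uniform_limit_exD[OF uh'] by blast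
      have "(c + d) / 2 < d" using c by simp
      then obtain z where z: "z \<in> ball 0 s" "(c + d) / 2 \<le> norm (?h (k i) z - ?f F z)"
        using f(2)[of "k i"] unfolding A_def by blast
      have "norm (?h (k i) z - ?f F z) \<le> norm (?h (k i) z - h z) + norm (h z - ?f F z)"
        using norm_triangle_ineq[of "?h (k i) z - h z" "h z - ?f F z"] by simp
      then have "c \<le> norm (h z - ?f F z)" using i[OF z(1)] z(2) by (simp add: dist_norm field_simps)
      then show "\<exists>z\<in>ball 0 s. c \<le> norm (?f (germ_of g) z - ?f F z)" using z(1) heq by auto
    qed
  qed
  then have "openin (germ_topology eps) (Germs - A)"
    unfolding closedin_def topspace_germ by (rule conjunct2)
  moreover have "F \<in> Germs - A"
  proof -
    have "\<not> (\<exists>z\<in>ball 0 s. d / 2 \<le> norm (?f F z - ?f F z))" using d by simp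
    moreover have "d / 2 < d" using d by simp
    ultimately have "F \<notin> A" unfolding A_def by blast
    then show ?thesis using F SG by blast
  qed
  moreover have "norm (?f G z - ?f F z) < d" if "G \<in> (Germs - A) \<inter> S" "z \<in> ball 0 s" for G z
  proof -
    have "G \<in> S" "G \<notin> A" using that(1) by auto
    then obtain c where "c < d" "\<not> (\<exists>z\<in>ball 0 s. c \<le> norm (?f G z - ?f F z))" unfolding A_def by blast
    then show ?thesis using that(2) by (meson not_le less_trans)
  qed
  ultimately show ?thesis by blast
qed

end

section \<open>Independent sequences\<close>

abbreviation shift :: "nat \<Rightarrow> (nat \<Rightarrow> 'a) \<Rightarrow> nat \<Rightarrow> 'a" where
  "shift k \<omega> \<equiv> (\<lambda>i. \<omega> (i + k))"

context sequence_space
begin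

lemma shift_measurable [measurable]: "shift k \<in> S \<rightarrow>\<^sub>M S"
proof -
  have "(\<lambda>\<omega>. \<lambda>i\<in>UNIV. \<omega> (i + k)) \<in> S \<rightarrow>\<^sub>M S"
    by (rule measurable_restrict) measurable
  then show ?thesis by (simp add: restrict_def)
qed

lemma distr_shift: "distr S S (shift k) = S"
proof -
  have "distr (PiM UNIV (\<lambda>_. M)) (PiM UNIV (\<lambda>_. M)) (\<lambda>\<omega>. \<lambda>n\<in>UNIV. \<omega> (n + k)) = PiM UNIV (\<lambda>_::nat. M)"
    by (rule distr_PiM_reindex) (auto intro: M.prob_space_axioms simp: inj_on_def)
  then show ?thesis by (simp add: restrict_def)
qed

lemma AE_shift: "AE \<omega> in S. P \<omega> \<Longrightarrow> AE \<omega> in S. P (shift k \<omega>)"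
  by (rule AE_distrD[OF shift_measurable[of k]]) (subst distr_shift)

lemma nn_integral_comb_seq:
  assumes [measurable]: "f \<in> borel_measurable S"
  shows "(\<integral>\<^sup>+\<omega>. f \<omega> \<partial>S) = (\<integral>\<^sup>+\<omega>. \<integral>\<^sup>+\<omega>'. f (comb_seq k \<omega> \<omega>') \<partial>S \<partial>S)"
proof -
  let ?g = "\<lambda>X. f ((\<lambda>(\<omega>, \<omega>'). comb_seq k \<omega> \<omega>') X)"
  have "(\<integral>\<^sup>+\<omega>. f \<omega> \<partial>S) = (\<integral>\<^sup>+X. ?g X \<partial>(S \<Otimes>\<^sub>M S))"
    using nn_integral_distr[OF measurable_comb_seq[of k M], of f] assms unfolding PiM_comb_seq by simp
  also have "\<dots> = (\<integral>\<^sup>+\<omega>. \<integral>\<^sup>+\<omega>'. ?g (\<omega>, \<omega>') \<partial>S \<partial>S)"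
    by (rule P.nn_integral_fst[symmetric]) (rule measurable_compose[OF measurable_comb_seq assms])
  finally show ?thesis by simp
qed

lemma nn_integral_case_nat:
  assumes [measurable]: "f \<in> borel_measurable S"
  shows "(\<integral>\<^sup>+\<omega>. f \<omega> \<partial>S) = (\<integral>\<^sup>+x. \<integral>\<^sup>+\<omega>'. f (case_nat x \<omega>') \<partial>S \<partial>M)"
proof -
  let ?g = "\<lambda>X. f ((\<lambda>(x, \<omega>'). case_nat x \<omega>') X)"
  have m: "(\<lambda>(x, \<omega>'). case_nat x \<omega>') \<in> M \<Otimes>\<^sub>M S \<rightarrow>\<^sub>M S" by measurable
  have "(\<integral>\<^sup>+\<omega>. f \<omega> \<partial>S) = (\<integral>\<^sup>+X. ?g X \<partial>(M \<Otimes>\<^sub>M S))"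
    using nn_integral_distr[OF m, of f] assms unfolding PiM_iter by simp
  also have "\<dots> = (\<integral>\<^sup>+x. \<integral>\<^sup>+\<omega>'. ?g (x, \<omega>') \<partial>S \<partial>M)"
    by (rule P.nn_integral_fst[symmetric]) (rule measurable_compose[OF m assms])
  finally show ?thesis by simp
qed

text \<open>Products over disjoint blocks of coordinates have geometrically decaying expectation,
  so they are almost surely summable.\<close>

lemma AE_block_prod_tendsto_0:
  fixes Y :: "(nat \<Rightarrow> 'a) \<Rightarrow> ennreal"
  assumes [measurable]: "Y \<in> borel_measurable S"
    and dep: "\<And>\<omega> \<omega>'. Y (comb_seq N \<omega> \<omega>') = Y \<omega>"
    and q: "(\<integral>\<^sup>+\<omega>. Y \<omega> \<partial>S) < 1"
  shows "AE \<omega> in S. (\<lambda>K. \<Prod>k<K. Y (shift (k * N) \<omega>)) \<longlonglongrightarrow> 0"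
proof -
  define q where "q = (\<integral>\<^sup>+\<omega>. Y \<omega> \<partial>S)"
  let ?H = "\<lambda>K \<omega>. \<Prod>k<K. Y (shift (k * N) \<omega>)"
  have [measurable]: "?H K \<in> borel_measurable S" for K by measurable
  have H: "(\<integral>\<^sup>+\<omega>. ?H K \<omega> \<partial>S) = q ^ K" for K
  proof (induction K)
    case 0 then show ?case by (simp add: P.emeasure_space_1)
  next
    case (Suc K)
    have sh: "shift (Suc k * N) (comb_seq N \<omega> \<omega>') = shift (k * N) \<omega>'" for k \<omega> \<omega>'
      by (rule ext) (simp add: comb_seq_def add.commute)
    have eq: "?H (Suc K) (comb_seq N \<omega> \<omega>') = Y \<omega> * ?H K \<omega>'" for \<omega> \<omega>'
      unfolding prod.lessThan_Suc_shift sh by (simp add: dep)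
    have "(\<integral>\<^sup>+\<omega>. ?H (Suc K) \<omega> \<partial>S) = (\<integral>\<^sup>+\<omega>. \<integral>\<^sup>+\<omega>'. Y \<omega> * ?H K \<omega>' \<partial>S \<partial>S)"
      by (subst nn_integral_comb_seq[where k = N]) (measurable, simp only: eq)
    also have "\<dots> = q * q ^ K"
      by (subst nn_integral_cmult, measurable) (simp add: Suc nn_integral_multc q_def)
    finally show ?case by simp
  qed
  have q1: "q < 1" using q by (simp add: q_def)
  then obtain r where r: "q = ennreal r" "0 \<le> r" by (cases q) auto
  have r1: "r < 1" using q1 r by (simp add: ennreal_less_one_iff)
  have "(\<integral>\<^sup>+\<omega>. (\<Sum>K. ?H K \<omega>) \<partial>S) = (\<Sum>K. q ^ K)"
    by (subst nn_integral_suminf) (simp_all add: H)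
  also have "\<dots> = (\<Sum>K. ennreal (r ^ K))" by (simp add: r ennreal_power)
  also have "\<dots> = ennreal (\<Sum>K. r ^ K)"
    using r r1 by (intro suminf_ennreal_eq) (auto intro!: summable_sums summable_geometric)
  finally have "(\<integral>\<^sup>+\<omega>. (\<Sum>K. ?H K \<omega>) \<partial>S) \<noteq> \<infinity>" by simp
  then have "AE \<omega> in S. (\<Sum>K. ?H K \<omega>) \<noteq> \<infinity>" by (intro nn_integral_PInf_AE) auto
  then show ?thesis
  proof eventually_elim
    case (elim \<omega>)
    then have fin: "(\<Sum>K. ?H K \<omega>) < top" by (simp add: less_top)
    have Hfin: "?H K \<omega> < top" for K
    proof -
      have "?H K \<omega> = (\<Sum>k\<in>{K}. ?H k \<omega>)" by simp
      also have "\<dots> \<le> (\<Sum>K. ?H K \<omega>)" by (rule sum_le_suminf) auto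
      finally show ?thesis using fin by (rule le_less_trans)
    qed
    define h where "h K = enn2real (?H K \<omega>)" for K
    have h: "?H K \<omega> = ennreal (h K)" "0 \<le> h K" for K using Hfin[of K] by (auto simp: h_def)
    have "summable h"
      by (rule summable_suminf_not_top) (use h fin in \<open>auto simp flip: h(1)\<close>)
    then have "h \<longlonglongrightarrow> 0" by (rule summable_LIMSEQ_zero)
    then have "(\<lambda>K. ennreal (h K)) \<longlonglongrightarrow> ennreal 0" by (rule tendsto_ennrealI)
    then show ?case by (simp add: h(1))
  qed
qed

text \<open>Y is the indicator that a block of length p misses the pattern. Its mean is below 1, so
  products over consecutive blocks tend to 0 almost surely, whereas they would all be 1 if no block
  matched.\<close>

lemma AE_visits:
  assumes Q: "\<And>i. i < p \<Longrightarrow> Q i \<in> sets M" "\<And>i. i < p \<Longrightarrow> 0 < emeasure M (Q i)"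
  shows "AE \<omega> in S. \<exists>n. \<forall>i<p. \<omega> (i + n) \<in> Q i"
proof -
  define E where "E = {\<omega>\<in>space S. \<forall>i\<in>{..<p}. \<omega> i \<in> Q i}"
  have E[measurable]: "E \<in> sets S"
    unfolding E_def using Q(1) by (intro sets.sets_Collect_finite_All sets_Collect_single) auto
  have "emeasure S E = (\<Prod>i<p. emeasure M (Q i))"
    unfolding E_def by (rule emeasure_PiM_Collect) (use Q in auto)
  then have "emeasure S E > 0" using Q(2) by (simp add: zero_less_iff_neq_zero)
  then have pos: "P.prob E > 0" by (simp add: P.emeasure_eq_measure)
  define Y :: "(nat \<Rightarrow> 'a) \<Rightarrow> ennreal" where "Y \<omega> = (if \<forall>i<p. \<omega> i \<in> Q i then 0 else 1)" for \<omega>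
  have Yind: "Y \<omega> = indicator (space S - E) \<omega>" if "\<omega> \<in> space S" for \<omega>
    using that by (auto simp: Y_def E_def indicator_def)
  have [measurable]: "Y \<in> borel_measurable S"
    by (subst measurable_cong[OF Yind]) auto
  have "AE \<omega> in S. (\<lambda>K. \<Prod>k<K. Y (shift (k * p) \<omega>)) \<longlonglongrightarrow> 0"
  proof (rule AE_block_prod_tendsto_0)
    show "Y (comb_seq p \<omega> \<omega>') = Y \<omega>" for \<omega> \<omega>' by (simp add: Y_def comb_seq_less)
    have "(\<integral>\<^sup>+\<omega>. Y \<omega> \<partial>S) = emeasure S (space S - E)"
      by (subst nn_integral_cong[OF Yind]) auto
    also have "\<dots> = ennreal (1 - P.prob E)" by (simp add: P.emeasure_eq_measure P.prob_compl)
    also have "\<dots> < 1" using pos by (simp add: ennreal_less_one_iff)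
    finally show "(\<integral>\<^sup>+\<omega>. Y \<omega> \<partial>S) < 1" .
  qed simp
  then show ?thesis
  proof eventually_elim
    case (elim \<omega>)
    show ?case
    proof (rule ccontr)
      assume "\<nexists>n. \<forall>i<p. \<omega> (i + n) \<in> Q i"
      then have "Y (shift n \<omega>) = 1" for n unfolding Y_def by auto
      then have "(\<lambda>K::nat. 1::ennreal) \<longlonglongrightarrow> 0" using elim by simp
      then show False using LIMSEQ_unique tendsto_const zero_neq_one by metis
    qed
  qed
qed

lemma AE_all_coordinates: "AE x in M. P x \<Longrightarrow> AE \<omega> in S. \<forall>i. P (\<omega> i)"
  unfolding AE_all_countable by (intro allI AE_PiM_component) (auto intro: M.prob_space_axioms)

end

section \<open>Moments of logarithms and multiplicative random walks\<close>

lemma exp_le_quadratic: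
  fixes x :: real
  assumes "\<bar>x\<bar> \<le> 1"
  shows "exp x \<le> 1 + x + x\<^sup>2"
proof (cases "0 \<le> x")
  case True
  then show ?thesis using exp_bound[of x] assms by simp
next
  case False
  define y where "y = - x"
  have y: "0 \<le> y" using False by (simp add: y_def)
  have e: "1 + y + y\<^sup>2 / 2 \<le> exp y" using y by (rule exp_lower_Taylor_quadratic)
  have "(1 - y + y\<^sup>2) * (1 + y + y\<^sup>2 / 2) = 1 + y\<^sup>2 / 2 + y ^ 3 / 2 + y ^ 4 / 2"
    by (simp add: power2_eq_square power3_eq_cube power4_eq_xxxx field_simps)
  also have "\<dots> \<ge> 1" using y by simp
  finally have 1: "1 \<le> (1 - y + y\<^sup>2) * (1 + y + y\<^sup>2 / 2)" .
  have "0 \<le> (1 - y / 2)\<^sup>2 + 3/4 * y\<^sup>2" by simp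
  then have "0 \<le> 1 - y + y\<^sup>2" by (simp add: power2_eq_square algebra_simps)
  then have "1 \<le> (1 - y + y\<^sup>2) * exp y" using 1 mult_left_mono[OF e] by (meson order_trans)
  then have "exp (- y) \<le> 1 - y + y\<^sup>2" by (simp add: exp_minus field_simps)
  then show ?thesis by (simp add: y_def)
qed

text \<open>The function s |-> E Y^s equals 1 at s = 0 and has derivative E ln Y < 0 there; the
  quadratic bound on exp replaces differentiation under the integral.\<close>

lemma (in prob_space) powr_expectation_less_1:
  fixes Y :: "'a \<Rightarrow> real"
  assumes [measurable]: "Y \<in> borel_measurable M"
    and bd: "\<And>x. \<delta> \<le> Y x" "\<And>x. Y x \<le> C" and \<delta>: "0 < \<delta>"
    and neg: "expectation (\<lambda>x. ln (Y x)) < 0"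
  shows "\<exists>s>0. (\<integral>\<^sup>+x. ennreal (Y x powr s) \<partial>M) < 1"
proof -
  define B where "B = \<bar>ln \<delta>\<bar> + \<bar>ln C\<bar> + 1"
  have Y0: "0 < Y x" for x using bd(1)[of x] \<delta> by simp
  have B: "\<bar>ln (Y x)\<bar> \<le> B" for x
  proof -
    have "ln \<delta> \<le> ln (Y x)" using bd(1)[of x] \<delta> by simp
    moreover have "ln (Y x) \<le> ln C" using bd(2)[of x] Y0[of x] by (simp add: ln_mono)
    ultimately show ?thesis by (simp add: B_def)
  qed
  have B0: "1 \<le> B" by (simp add: B_def)
  define c where "c = - expectation (\<lambda>x. ln (Y x))"
  have c: "c > 0" using neg by (simp add: c_def)
  \<comment> \<open>The value 1 / B keeps the exponent s ln Y in [-1, 1]; the other one lets the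
    quadratic error s^2 B^2 consume at most half of the gain s c.\<close>
  define s where "s = min (1 / B) (c / (2 * B\<^sup>2))"
  have s: "0 < s" "s * B \<le> 1" "s * B\<^sup>2 \<le> c / 2"
    using B0 c by (auto simp: s_def min_def field_simps)
  have int: "integrable M (\<lambda>x. ln (Y x))"
    by (rule integrable_const_bound[where B = B]) (use B in auto)
  have pw: "Y x powr s \<le> 1 + s * ln (Y x) + s\<^sup>2 * B\<^sup>2" for x
  proof -
    have "\<bar>s * ln (Y x)\<bar> \<le> s * B" using B[of x] s(1) by (simp add: abs_mult)
    then have "exp (s * ln (Y x)) \<le> 1 + s * ln (Y x) + (s * ln (Y x))\<^sup>2"
      using s(2) by (intro exp_le_quadratic) simp
    moreover have "(s * ln (Y x))\<^sup>2 \<le> s\<^sup>2 * B\<^sup>2"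
      using power_mono[OF B[of x], of 2] by (simp add: power_mult_distrib mult_left_mono)
    ultimately show ?thesis using Y0[of x] by (simp add: powr_def)
  qed
  have "(\<integral>\<^sup>+x. ennreal (Y x powr s) \<partial>M) \<le> (\<integral>\<^sup>+x. ennreal (1 + s * ln (Y x) + s\<^sup>2 * B\<^sup>2) \<partial>M)"
    by (intro nn_integral_mono ennreal_leI pw)
  also have "\<dots> = ennreal (expectation (\<lambda>x. 1 + s * ln (Y x) + s\<^sup>2 * B\<^sup>2))"
  proof (rule nn_integral_eq_integral)
    show "integrable M (\<lambda>x. 1 + s * ln (Y x) + s\<^sup>2 * B\<^sup>2)"
      by (intro Bochner_Integration.integrable_add integrable_mult_right int) auto
    show "AE x in M. 0 \<le> 1 + s * ln (Y x) + s\<^sup>2 * B\<^sup>2"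
      by (rule AE_I2) (rule order_trans[OF powr_ge_zero pw])
  qed
  finally have le: "(\<integral>\<^sup>+x. ennreal (Y x powr s) \<partial>M) \<le> ennreal (expectation (\<lambda>x. 1 + s * ln (Y x) + s\<^sup>2 * B\<^sup>2))" .
  have "expectation (\<lambda>x. 1 + s * ln (Y x) + s\<^sup>2 * B\<^sup>2) = 1 - s * c + s * (s * B\<^sup>2)"
    using int by (simp add: prob_space c_def power2_eq_square)
  also have "\<dots> \<le> 1 - s * c + s * (c / 2)" using s by (intro add_left_mono mult_left_mono) auto
  also have "\<dots> < 1" using s(1) c by (simp add: field_simps)
  finally have "ennreal (expectation (\<lambda>x. 1 + s * ln (Y x) + s\<^sup>2 * B\<^sup>2)) < 1"
    by (simp add: ennreal_less_one_iff)
  with le s(1) show ?thesis by (meson le_less_trans)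
qed

text \<open>Dominated convergence: the limit may vary with x but is negative almost surely, so the
  means tend to a negative number, and n times them eventually beats any constant. In the
  application X n is a truncated logarithmic growth rate and c = ln 2.\<close>

lemma (in prob_space) expectation_times_n_to_minus_infinity:
  fixes X :: "nat \<Rightarrow> 'a \<Rightarrow> real"
  assumes [measurable]: "\<And>n. X n \<in> borel_measurable M"
    and bd: "\<And>n x. \<bar>X n x\<bar> \<le> B"
    and lim: "AE x in M. \<exists>l<0. (\<lambda>n. X n x) \<longlonglongrightarrow> l"
  shows "\<exists>n>0. real n * expectation (X n) + c < 0"
proof -
  define X' where "X' x = lim (\<lambda>n. X n x)" for x
  have [measurable]: "X' \<in> borel_measurable M" unfolding X'_def by measurable
  have X': "AE x in M. (\<lambda>n. X n x) \<longlonglongrightarrow> X' x" "AE x in M. X' x < 0"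
    using lim by (eventually_elim, force simp: X'_def limI)+
  have conv: "(\<lambda>n. expectation (X n)) \<longlonglongrightarrow> expectation X'" and int: "integrable M X'"
    using X'(1) bd by (auto intro!: integral_dominated_convergence[where w = "\<lambda>_. B"]
        integrable_dominated_convergence[where w = "\<lambda>_. B" and s = X])
  have "expectation X' < 0"
  proof (rule ccontr)
    assume "\<not> expectation X' < 0"
    moreover have "expectation (\<lambda>x. - X' x) \<ge> 0"
      using X'(2) by (intro integral_nonneg_AE) (auto elim: eventually_mono)
    ultimately have "expectation (\<lambda>x. - X' x) = 0" by simp
    then have "AE x in M. - X' x = 0"
      using X'(2) int by (subst (asm) integral_nonneg_eq_0_iff_AE) (auto elim: eventually_mono)
    with X'(2) have "AE x in M. False" by eventually_elim simp
    then show False by simp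
  qed
  then have e: "- (expectation X') / 2 > 0" by simp
  have "\<forall>\<^sub>F n in sequentially. expectation (X n) < expectation X' / 2"
    using order_tendstoD(2)[OF conv, of "expectation X' / 2"] e by simp
  moreover have "\<forall>\<^sub>F n in sequentially. c < real n * (- (expectation X') / 2)"
  proof -
    obtain N where "c < real N * (- (expectation X') / 2)"
      using reals_Archimedean3[OF e] by blast
    moreover have "real N * (- (expectation X') / 2) \<le> real n * (- (expectation X') / 2)" if "N \<le> n" for n
      using that e by (intro mult_right_mono) auto
    ultimately have "c < real n * (- (expectation X') / 2)" if "N \<le> n" for n
      using that by (meson less_le_trans)
    then show ?thesis unfolding eventually_sequentially by blast
  qed
  ultimately have "\<forall>\<^sub>F n in sequentially. 0 < n \<and> real n * expectation (X n) + c < 0"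
    using eventually_gt_at_top[of 0]
  proof eventually_elim
    case (elim n)
    have "real n * expectation (X n) \<le> real n * (expectation X' / 2)"
      using elim(1) by (intro mult_left_mono) auto
    moreover have "real n * (expectation X' / 2) = - (real n * (- (expectation X') / 2))" by simp
    ultimately show ?case using elim(2,3) by linarith
  qed
  then show ?thesis unfolding eventually_sequentially by blast
qed

context sequence_space
begin

text \<open>A multiplicative random walk which is bounded above and has growth rate one is constant:
  with \<open>W = inf\<^sub>n 1 / p\<^sub>n\<close>, stationarity forces the cocycle identity \<open>W \<circ> shift = a W\<close>,
  and independence turns it into \<open>E a\<^sup>-\<^sup>1 = E a\<^sup>-\<^sup>2 = 1\<close>.\<close>

lemma AE_eq_1_of_bounded_products:
  fixes a :: "'a \<Rightarrow> real"
  assumes a[measurable]: "a \<in> borel_measurable M" and a0: "\<And>x. 0 < a x"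
    and bd: "AE \<omega> in S. \<exists>C. \<forall>n. (\<Prod>i<n. a (\<omega> i)) \<le> C"
    and rt: "AE \<omega> in S. (\<lambda>n. root n (\<Prod>i<n. a (\<omega> i))) \<longlonglongrightarrow> 1"
  shows "AE x in M. a x = 1"
proof -
  define p where "p n \<omega> = (\<Prod>i<n. a (\<omega> i))" for n and \<omega> :: "nat \<Rightarrow> 'a"
  have p0: "0 < p n \<omega>" for n \<omega> by (simp add: p_def prod_pos a0)
  have [measurable]: "p n \<in> borel_measurable S" for n unfolding p_def by measurable
  define W where "W \<omega> = (INF n. 1 / p n \<omega>)" for \<omega>
  have [measurable]: "W \<in> borel_measurable S" unfolding W_def by measurable
  have bdd: "bdd_below (range (\<lambda>n. 1 / p n \<omega>))" for \<omega>
    using p0 by (intro bdd_belowI2[of _ 0]) (simp add: less_imp_le)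
  have W_le: "W \<omega> \<le> 1 / p n \<omega>" for n \<omega> unfolding W_def by (rule cINF_lower[OF bdd]) simp
  have W0: "0 \<le> W \<omega>" for \<omega> unfolding W_def by (rule cINF_greatest) (simp_all add: less_imp_le[OF p0])
  have W1: "W \<omega> \<le> 1" for \<omega> using W_le[of \<omega> 0] by (simp add: p_def)
  have psh: "p (Suc n) \<omega> = a (\<omega> 0) * p n (shift 1 \<omega>)" for n \<omega>
    unfolding p_def prod.lessThan_Suc_shift by simp
  have Wsh: "W \<omega> \<le> W (shift 1 \<omega>) / a (\<omega> 0)" for \<omega>
  proof -
    have "a (\<omega> 0) * W \<omega> \<le> W (shift 1 \<omega>)"
      unfolding W_def[of "shift 1 \<omega>"]
    proof (rule cINF_greatest)
      fix n
      show "a (\<omega> 0) * W \<omega> \<le> 1 / p n (shift 1 \<omega>)"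
        using W_le[of \<omega> "Suc n"] a0[of "\<omega> 0"] p0[of n "shift 1 \<omega>"] unfolding psh by (simp add: field_simps)
    qed simp
    then show ?thesis using a0[of "\<omega> 0"] by (simp add: field_simps)
  qed
  have Wpos: "AE \<omega> in S. 0 < W \<omega>"
    using bd
  proof eventually_elim
    case (elim \<omega>)
    then obtain C where C: "\<And>n. p n \<omega> \<le> C" by (auto simp: p_def)
    have "1 / C \<le> W \<omega>" unfolding W_def
      by (rule cINF_greatest) (use C p0 in \<open>auto intro!: divide_left_mono mult_pos_pos intro: less_le_trans\<close>)
    moreover have "0 < C" using C[of 0] by (simp add: p_def less_le_trans[OF zero_less_one])
    ultimately show ?case by (meson less_le_trans zero_less_divide_1_iff)
  qed
  \<comment> \<open>The defect of the cocycle identity, nonnegative by \<open>Wsh\<close> where W is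
    positive. Its sums along an orbit telescope to logarithms of W and p n.\<close>
  define D where "D \<omega> = ln (W (shift 1 \<omega>)) - ln (a (\<omega> 0)) - ln (W \<omega>)" for \<omega>
  have [measurable]: "D \<in> borel_measurable S" unfolding D_def by measurable
  have Wall: "AE \<omega> in S. \<forall>k. 0 < W (shift k \<omega>)"
    unfolding AE_all_countable using AE_shift[OF Wpos] by blast
  have Dall: "AE \<omega> in S. \<forall>k. 0 \<le> D (shift k \<omega>)"
    using Wall
  proof eventually_elim
    case (elim \<omega>)
    show ?case
    proof
      fix k
      have w: "0 < W (shift k \<omega>)" "0 < W (shift 1 (shift k \<omega>))" using elim[rule_format, of k] elim[rule_format, of "Suc k"] by simp_all
      have "ln (W (shift k \<omega>)) \<le> ln (W (shift 1 (shift k \<omega>)) / a (shift k \<omega> 0))"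
        using w Wsh[of "shift k \<omega>"] by (intro ln_mono) auto
      then show "0 \<le> D (shift k \<omega>)" using w a0[of "\<omega> k"] by (simp add: D_def ln_div)
    qed
  qed
  have tel: "(\<Sum>k<n. D (shift k \<omega>)) = ln (W (shift n \<omega>)) - ln (W \<omega>) - ln (p n \<omega>)" for n \<omega>
  proof (induction n)
    case (Suc n)
    have "p (Suc n) \<omega> = p n \<omega> * a (\<omega> n)" by (simp add: p_def)
    then have "ln (p (Suc n) \<omega>) = ln (p n \<omega>) + ln (a (\<omega> n))"
      using p0[of n \<omega>] a0[of "\<omega> n"] by (simp add: ln_mult)
    then show ?case using Suc by (simp add: D_def)
  qed (simp add: p_def)
  define d where "d \<omega> = min 1 \<bar>D \<omega>\<bar>" for \<omega>
  define u where "u n \<omega> = min 1 \<bar>ln (W \<omega>) / real n\<bar>" for n \<omega>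
  define v where "v n \<omega> = min 1 \<bar>ln (p n \<omega>) / real n\<bar>" for n \<omega>
  have [measurable]: "d \<in> borel_measurable S" "u n \<in> borel_measurable S" "v n \<in> borel_measurable S" for n
    unfolding d_def u_def v_def by measurable
  have int: "integrable S d" "integrable S (u n)" "integrable S (v n)" for n
    by (rule P.integrable_const_bound[where B = 1]; simp add: d_def u_def v_def)+
  have integral_shift: "integrable S (\<lambda>\<omega>. f (shift k \<omega>)) \<and> P.expectation (\<lambda>\<omega>. f (shift k \<omega>)) = P.expectation f"
    if f: "integrable S f" for k and f :: "(nat \<Rightarrow> 'a) \<Rightarrow> real"
  proof -
    have m: "f \<in> borel_measurable S" using f by simp
    show ?thesis
      using integrable_distr_eq[OF shift_measurable[of k] m] integral_distr[OF shift_measurable[of k] m] f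
      unfolding distr_shift by simp
  qed
  have key: "P.expectation d \<le> 2 * P.expectation (u n) + P.expectation (v n)" if n: "0 < n" for n
  proof -
    have "real n * P.expectation d = P.expectation (\<lambda>\<omega>. \<Sum>k<n. d (shift k \<omega>))"
      using integral_shift[OF int(1)] by (subst Bochner_Integration.integral_sum) auto
    also have "\<dots> \<le> P.expectation (\<lambda>\<omega>. real n * (u n (shift n \<omega>) + u n \<omega> + v n \<omega>))"
    proof (rule integral_mono_AE)
      show "integrable S (\<lambda>\<omega>. \<Sum>k<n. d (shift k \<omega>))"
        using integral_shift[OF int(1)] by (intro Bochner_Integration.integrable_sum) blast
      show "integrable S (\<lambda>\<omega>. real n * (u n (shift n \<omega>) + u n \<omega> + v n \<omega>))"
        using integral_shift[OF int(2)] int(2,3) by (intro integrable_mult_right Bochner_Integration.integrable_add) blast+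
      show "AE \<omega> in S. (\<Sum>k<n. d (shift k \<omega>)) \<le> real n * (u n (shift n \<omega>) + u n \<omega> + v n \<omega>)"
        using Dall
      proof eventually_elim
        case (elim \<omega>)
        have 1: "(\<Sum>k<n. d (shift k \<omega>)) \<le> real n * 1"
          using sum_bounded_above[of "{..<n}" "\<lambda>k. d (shift k \<omega>)" 1] by (simp add: d_def)
        have "(\<Sum>k<n. d (shift k \<omega>)) \<le> (\<Sum>k<n. D (shift k \<omega>))"
          using elim by (intro sum_mono) (simp add: d_def)
        also have "\<dots> \<le> \<bar>ln (W (shift n \<omega>))\<bar> + \<bar>ln (W \<omega>)\<bar> + \<bar>ln (p n \<omega>)\<bar>" unfolding tel by simp
        also have "\<dots> = real n * (\<bar>ln (W (shift n \<omega>)) / real n\<bar> + \<bar>ln (W \<omega>) / real n\<bar> + \<bar>ln (p n \<omega>) / real n\<bar>)"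
          using n by (simp add: field_simps)
        finally have 2: "(\<Sum>k<n. d (shift k \<omega>)) \<le> \<dots>" .
        have min3: "min 1 (\<bar>x\<bar> + \<bar>y\<bar> + \<bar>z\<bar>) \<le> min 1 \<bar>x\<bar> + min 1 \<bar>y\<bar> + min 1 \<bar>z\<bar>" for x y z :: real
          by (auto simp: min_def)
        let ?T = "\<bar>ln (W (shift n \<omega>)) / real n\<bar> + \<bar>ln (W \<omega>) / real n\<bar> + \<bar>ln (p n \<omega>) / real n\<bar>"
        have "(\<Sum>k<n. d (shift k \<omega>)) \<le> real n * min 1 ?T"
          using 1 2 by (cases "1 \<le> ?T") (simp_all only: min_absorb1 min_absorb2 not_le less_imp_le)
        also have "\<dots> \<le> real n * (u n (shift n \<omega>) + u n \<omega> + v n \<omega>)"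
          unfolding u_def v_def by (rule mult_left_mono[OF min3]) simp
        finally show ?case .
      qed
    qed
    also have "\<dots> = real n * (2 * P.expectation (u n) + P.expectation (v n))"
      using integral_shift[OF int(2)[of n], of n] int(2,3)[of n] by simp
    finally show ?thesis using n by simp
  qed
  have ulim: "(\<lambda>n. P.expectation (u n)) \<longlonglongrightarrow> P.expectation (\<lambda>_. 0)"
  proof (rule integral_dominated_convergence[where w = "\<lambda>_. 1"])
    show "AE \<omega> in S. (\<lambda>n. u n \<omega>) \<longlonglongrightarrow> 0"
    proof (rule AE_I2)
      fix \<omega>
      have "(\<lambda>n. ln (W \<omega>) / real n) \<longlonglongrightarrow> 0" by (rule lim_const_over_n)
      then have "(\<lambda>n. min 1 \<bar>ln (W \<omega>) / real n\<bar>) \<longlonglongrightarrow> min 1 \<bar>0\<bar>" by (intro tendsto_intros)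
      then show "(\<lambda>n. u n \<omega>) \<longlonglongrightarrow> 0" by (simp add: u_def)
    qed
  qed (auto simp: u_def)
  have vlim: "(\<lambda>n. P.expectation (v n)) \<longlonglongrightarrow> P.expectation (\<lambda>_. 0)"
  proof (rule integral_dominated_convergence[where w = "\<lambda>_. 1"])
    show "AE \<omega> in S. (\<lambda>n. v n \<omega>) \<longlonglongrightarrow> 0"
      using rt
    proof eventually_elim
      case (elim \<omega>)
      then have "(\<lambda>n. ln (root n (p n \<omega>))) \<longlonglongrightarrow> ln 1" by (intro tendsto_ln) (simp_all add: p_def)
      then have "(\<lambda>n. ln (root n (p n \<omega>))) \<longlonglongrightarrow> 0" by simp
      then have "(\<lambda>n. ln (p n \<omega>) / real n) \<longlonglongrightarrow> 0"
        by (rule Lim_transform_eventually) (rule eventually_sequentiallyI[of 1], simp add: ln_root p0)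
      then have "(\<lambda>n. min 1 \<bar>ln (p n \<omega>) / real n\<bar>) \<longlonglongrightarrow> min 1 \<bar>0\<bar>" by (intro tendsto_intros)
      then show ?case by (simp add: v_def)
    qed
  qed (auto simp: v_def)
  have "P.expectation d \<le> 0"
  proof (rule LIMSEQ_le_const)
    show "(\<lambda>n. 2 * P.expectation (u n) + P.expectation (v n)) \<longlonglongrightarrow> 0"
      using tendsto_add[OF tendsto_mult[OF tendsto_const[of 2] ulim] vlim] by simp
    show "\<exists>N. \<forall>n\<ge>N. P.expectation d \<le> 2 * P.expectation (u n) + P.expectation (v n)"
      using key by (intro exI[of _ 1]) auto
  qed
  then have "P.expectation d = 0" by (intro antisym) (simp_all add: d_def)
  then have "AE \<omega> in S. d \<omega> = 0"
    using int(1) by (subst (asm) integral_nonneg_eq_0_iff_AE) (auto simp: d_def)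
  then have coc: "AE \<omega> in S. W \<omega> = W (shift 1 \<omega>) * (1 / a (\<omega> 0))"
    using Wall
  proof eventually_elim
    case (elim \<omega>)
    have w: "0 < W \<omega>" "0 < W (shift 1 \<omega>)" using elim(2)[rule_format, of 0] elim(2)[rule_format, of 1] by simp_all
    have "D \<omega> = 0" using elim(1) by (simp add: d_def min_def split: if_splits)
    then have "ln (W \<omega>) = ln (W (shift 1 \<omega>) / a (\<omega> 0))" using w a0[of "\<omega> 0"] by (simp add: D_def ln_div)
    then show ?case using w a0[of "\<omega> 0"] by simp
  qed
  \<comment> \<open>W after the shift is independent of a (\<omega> 0), so the cocycle identity
    gives E W^t = E W^t E a^(-t). The common factor is finite and nonzero and cancels.\<close>
  have mom: "(\<integral>\<^sup>+x. ennreal ((1 / a x) ^ t) \<partial>M) = 1" for t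
  proof -
    define w where "w = (\<integral>\<^sup>+\<omega>. ennreal (W \<omega> ^ t) \<partial>S)"
    have "w \<le> (\<integral>\<^sup>+\<omega>. 1 \<partial>S)"
      unfolding w_def using W0 W1 by (intro nn_integral_mono) (simp add: power_le_one)
    then have w_fin: "w \<noteq> \<infinity>" by (simp add: P.emeasure_space_1) (metis ennreal_one_neq_top neq_top_trans)
    have w_pos: "w \<noteq> 0"
    proof
      assume "w = 0"
      then have "AE \<omega> in S. ennreal (W \<omega> ^ t) = 0" unfolding w_def by (subst (asm) nn_integral_0_iff_AE) auto
      with Wpos have "AE \<omega> in S. False" by eventually_elim (metis ennreal_eq_0_iff not_le zero_less_power)
      then show False by simp
    qed
    have "w = (\<integral>\<^sup>+\<omega>. ennreal (W (shift 1 \<omega>) ^ t) * ennreal ((1 / a (\<omega> 0)) ^ t) \<partial>S)"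
      unfolding w_def using coc
    proof (intro nn_integral_cong_AE, eventually_elim)
      case (elim \<omega>)
      have "W \<omega> ^ t = W (shift 1 \<omega>) ^ t * (1 / a (\<omega> 0)) ^ t"
        by (subst elim) (rule power_mult_distrib)
      then have "ennreal (W \<omega> ^ t) = ennreal (W (shift 1 \<omega>) ^ t * (1 / a (\<omega> 0)) ^ t)" by (simp only:)
      also have "\<dots> = ennreal (W (shift 1 \<omega>) ^ t) * ennreal ((1 / a (\<omega> 0)) ^ t)"
        by (rule ennreal_mult') (simp add: W0)
      finally show ?case .
    qed
    also have "\<dots> = (\<integral>\<^sup>+x. \<integral>\<^sup>+\<omega>'. ennreal (W \<omega>' ^ t) * ennreal ((1 / a x) ^ t) \<partial>S \<partial>M)"
    proof -
      have m0: "(\<lambda>\<omega>. \<omega> 0) \<in> S \<rightarrow>\<^sub>M M" by (rule measurable_component_singleton) simp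
      have "(\<lambda>\<omega>. ennreal (W (shift 1 \<omega>) ^ t) * ennreal ((1 / a (\<omega> 0)) ^ t)) \<in> borel_measurable S"
        using measurable_compose[OF m0 a] measurable_compose[OF shift_measurable[of 1], of W borel] by measurable
      from nn_integral_case_nat[OF this] show ?thesis by simp
    qed
    also have "\<dots> = (\<integral>\<^sup>+x. w * ennreal ((1 / a x) ^ t) \<partial>M)"
      unfolding w_def by (intro nn_integral_cong nn_integral_multc) measurable
    also have "\<dots> = w * (\<integral>\<^sup>+x. ennreal ((1 / a x) ^ t) \<partial>M)"
      by (rule nn_integral_cmult) measurable
    finally have "w * (\<integral>\<^sup>+x. ennreal ((1 / a x) ^ t) \<partial>M) = w * 1" by simp
    then show ?thesis using w_fin w_pos by (subst (asm) ennreal_mult_cancel_left) auto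
  qed
  define b where "b x = 1 / a x" for x
  have b0: "0 \<le> b x" for x by (simp add: b_def less_imp_le a0)
  have [measurable]: "b \<in> borel_measurable M" unfolding b_def by measurable
  have ib: "has_bochner_integral M (\<lambda>x. b x ^ t) 1" for t
    by (rule has_bochner_integral_nn_integral) (use mom[of t] b0 in \<open>auto simp: b_def\<close>)
  \<comment> \<open>With total mass, first and second moment of b all equal to 1, the mean of (b -
    1)^2 vanishes.\<close>
  have "has_bochner_integral M (\<lambda>x. b x ^ 2 - 2 * b x ^ 1 + 1) (1 - 2 * 1 + 1)"
    using M.prob_space by (intro has_bochner_integral_add has_bochner_integral_diff has_bochner_integral_mult_right ib)
      (auto simp: has_bochner_integral_iff)
  then have "has_bochner_integral M (\<lambda>x. (b x - 1)\<^sup>2) 0"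
    by (simp add: power2_eq_square algebra_simps)
  then have "integrable M (\<lambda>x. (b x - 1)\<^sup>2)" "(\<integral>x. (b x - 1)\<^sup>2 \<partial>M) = 0"
    by (simp_all add: has_bochner_integral_iff)
  then have "AE x in M. (b x - 1)\<^sup>2 = 0"
    using integral_nonneg_eq_0_iff_AE[of M "\<lambda>x. (b x - 1)\<^sup>2"] by simp
  then show ?thesis
  proof eventually_elim
    case (elim x)
    then show ?case using a0[of x] by (simp add: b_def)
  qed
qed

end

section \<open>Compositions of bounded families of germs\<close>

lemma compo_add: "compo g (n + k) = compo (shift k g) n \<circ> compo g k"
  by (induction n) (auto simp: o_assoc)

lemma compo_0_fixed: "(\<And>k. g k 0 = 0) \<Longrightarrow> compo g n 0 = 0"
  by (induction n) auto

lemma compo_has_derivative_0: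
  assumes "\<And>k. (g k has_derivative (*v) (A k)) (at (0::'m::finite cvec))" "\<And>k. g k 0 = 0"
  shows "(compo g n has_derivative (*v) (mprod A n)) (at 0)"
proof (induction n)
  case 0
  have "(*v) (mat 1 :: 'm cmat) = (\<lambda>x. x)" by auto
  then show ?case by (simp add: id_def)
next
  case (Suc n)
  have "(g n has_derivative (*v) (A n)) (at (compo g n 0))"
    by (simp add: compo_0_fixed[of g, OF assms(2)] assms(1))
  from jac_compose[OF Suc this] show ?case by (simp add: o_def)
qed

lemma compo_holo_on:
  assumes "\<And>k. holo_on (U k) (g k)" "\<And>n z. z \<in> V \<Longrightarrow> compo g n z \<in> U n"
  shows "holo_on V (compo g n)"
proof (induction n)
  case (Suc n)
  have "holo_on V (\<lambda>z. g n (compo g n z))" by (rule holo_on_compose[OF Suc assms(1)]) (rule assms(2))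
  then show ?case by (simp add: o_def)
qed (simp add: holo_on_id[unfolded id_def] id_def)

lemma fatou_at_0I:
  fixes g :: "nat \<Rightarrow> 'm::finite cvec \<Rightarrow> 'm cvec"
  assumes U: "\<And>k. open (U k)" "\<And>k. 0 \<in> U k" "\<And>k. holo_on (U k) (g k)" "\<And>k. g k \<in> \<omega> k"
    and v: "0 < v" "\<And>n z. z \<in> ball 0 v \<Longrightarrow> compo g n z \<in> U n"
    and B: "\<And>n z. z \<in> ball 0 v \<Longrightarrow> norm (compo g n z) \<le> B"
  shows "fatou_at_0 \<omega>"
proof -
  let ?V = "ball 0 (v / 2) :: 'm cvec set"
  have sub: "?V \<subseteq> ball 0 v" using v(1) by auto
  have hol: "holo_on (ball 0 v) (compo g n)" for n by (rule compo_holo_on[of U]) (use U(3) v(2) in auto)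
  have "normal_family ?V {compo g n |n. n \<ge> 1}"
    unfolding normal_family_def
  proof (intro allI impI)
    fix s :: "nat \<Rightarrow> 'm cvec \<Rightarrow> 'm cvec" assume s: "\<forall>k. s k \<in> {compo g n |n. n \<ge> 1}"
    have "holo_on (ball 0 v) (s k) \<and> (\<forall>z\<in>ball 0 v. norm (s k z) \<le> B)" for k
    proof -
      obtain n where "s k = compo g n" using s by blast
      then show ?thesis using hol B by simp
    qed
    then obtain k h where "strict_mono (k::nat \<Rightarrow> nat)" "uniform_limit (cball 0 (v/2)) (\<lambda>n. s (k n)) h sequentially"
      using holo_on_montel[of v s B "v/2"] v(1) by auto
    moreover have "K \<subseteq> cball 0 (v / 2)" if "K \<subseteq> ?V" for K using that ball_subset_cball by blast
    ultimately show "\<exists>r h. strict_mono r \<and> (\<forall>K. compact K \<and> K \<subseteq> ?V \<longrightarrow> uniform_limit K (\<lambda>k. s (r k)) h sequentially)"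
      using uniform_limit_on_subset by meson
  qed
  moreover have "defined_on ?V \<omega> U g" unfolding defined_on_def using U v(2) sub by blast
  moreover have "\<forall>n\<ge>1. holo_on ?V (compo g n)" using holo_on_subset[OF hol sub] by blast
  moreover have "open ?V" "0 \<in> ?V" using v(1) by auto
  ultimately show ?thesis unfolding fatou_at_0_def by blast
qed

text \<open>Limits in a normal family are finite maps here, so divergence to infinity is excluded:
  members exceeding every bound on K have no subsequence converging uniformly on K.\<close>

lemma normal_family_bounded:
  assumes nf: "normal_family V {compo g n |n. n \<ge> 1}" and K: "compact K" "K \<subseteq> V"
    and cont: "\<And>n. n \<ge> 1 \<Longrightarrow> continuous_on K (compo g n :: 'm::finite cvec \<Rightarrow> _)"
  shows "\<exists>B. \<forall>n\<ge>1. \<forall>z\<in>K. norm (compo g n z) \<le> B"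
proof (rule ccontr)
  assume no: "\<not> ?thesis"
  have "\<exists>n z. n \<ge> 1 \<and> z \<in> K \<and> \<not> norm (compo g n z) \<le> real k" for k :: nat
    using no by (metis (no_types, lifting))
  then obtain n where n: "\<And>k. n k \<ge> 1" "\<And>k. \<exists>z\<in>K. real k < norm (compo g (n k) z)"
    by (metis not_le)
  have "\<forall>k. compo g (n k) \<in> {compo g n |n. n \<ge> 1}" using n(1) by blast
  then obtain r h where r: "strict_mono r" and ul: "uniform_limit K (\<lambda>k. compo g (n (r k))) h sequentially"
    using nf K unfolding normal_family_def by meson
  obtain N where N: "\<And>k z. k \<ge> N \<Longrightarrow> z \<in> K \<Longrightarrow> dist (compo g (n (r k)) z) (h z) < 1"
    using uniform_limit_exD[OF ul zero_less_one] by blast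
  have "bounded (compo g (n (r N)) ` K)"
    by (intro compact_imp_bounded compact_continuous_image cont n K)
  then obtain B where B: "\<And>z. z \<in> K \<Longrightarrow> norm (compo g (n (r N)) z) \<le> B" by (auto simp: bounded_iff)
  obtain k :: nat where k: "k \<ge> N" "real k > B + 2"
    by (meson less_le_trans nat_le_linear of_nat_mono reals_Archimedean2)
  obtain z where z: "z \<in> K" "real (r k) < norm (compo g (n (r k)) z)" using n(2) by blast
  have "real k \<le> real (r k)" using seq_suble[OF r] by simp
  moreover have "dist (compo g (n (r k)) z) (compo g (n (r N)) z) < 2"
    using N[OF k(1) z(1)] N[OF order_refl z(1)] dist_triangle2[of "compo g (n (r k)) z" "compo g (n (r N)) z" "h z"] by linarith
  then have "norm (compo g (n (r k)) z) < B + 2"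
    using B[OF z(1)] norm_triangle_ineq2[of "compo g (n (r k)) z" "compo g (n (r N)) z"] by (simp add: dist_norm)
  ultimately show False using z(2) k(2) by linarith
qed

section \<open>Families of maps with a common radius and a common bound\<close>

locale bdd_family =
  fixes I :: "'i set" and f :: "'i \<Rightarrow> 'm::finite cvec \<Rightarrow> 'm cvec" and r R :: real
  assumes r_pos: "0 < r" and R_pos: "0 < R"
    and hol: "\<And>i. i \<in> I \<Longrightarrow> holo_on (ball 0 r) (f i)"
    and zero: "\<And>i. i \<in> I \<Longrightarrow> f i 0 = 0"
    and bd: "\<And>i z. i \<in> I \<Longrightarrow> z \<in> ball 0 r \<Longrightarrow> norm (f i z) \<le> R"
begin

abbreviation comp :: "(nat \<Rightarrow> 'i) \<Rightarrow> nat \<Rightarrow> 'm cvec \<Rightarrow> 'm cvec" where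
  "comp \<omega> \<equiv> compo (\<lambda>k. f (\<omega> k))"

abbreviation dcomp :: "(nat \<Rightarrow> 'i) \<Rightarrow> nat \<Rightarrow> 'm cmat" where
  "dcomp \<omega> \<equiv> mprod (\<lambda>k. jac (f (\<omega> k)) 0)"

text \<open>Half the radius leaves a margin: orbits remain inside the domain, and slightly perturbed
  orbits still fit into the ball of radius 3/4 r.\<close>

definition stays :: "real \<Rightarrow> (nat \<Rightarrow> 'i) \<Rightarrow> bool" where
  "stays v \<omega> \<longleftrightarrow> (\<forall>n. \<forall>z\<in>ball 0 v. norm (comp \<omega> n z) \<le> r / 2)"

lemma stays_mono: "stays v \<omega> \<Longrightarrow> v' \<le> v \<Longrightarrow> stays v' \<omega>"
  unfolding stays_def using subset_ball[of v' v 0] by blast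

lemma comp_0: "range \<omega> \<subseteq> I \<Longrightarrow> comp \<omega> n 0 = 0"
  by (rule compo_0_fixed) (rule zero, blast)

lemma jac_comp_0:
  assumes "range \<omega> \<subseteq> I"
  shows "(comp \<omega> n has_derivative (*v) (dcomp \<omega> n)) (at 0)" "jac (comp \<omega> n) 0 = dcomp \<omega> n"
proof -
  show *: "(comp \<omega> n has_derivative (*v) (dcomp \<omega> n)) (at 0)"
    using assms r_pos zero by (intro compo_has_derivative_0 holo_on_has_derivative[OF hol]) auto
  show "jac (comp \<omega> n) 0 = dcomp \<omega> n" by (rule jac_eqI[OF *])
qed

lemma comp_holo:
  assumes \<omega>: "range \<omega> \<subseteq> I" and "\<And>k z. k < n \<Longrightarrow> z \<in> ball 0 v \<Longrightarrow> comp \<omega> k z \<in> ball 0 r"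
  shows "holo_on (ball 0 v) (comp \<omega> n)"
  using assms(2)
proof (induction n)
  case (Suc n)
  have "holo_on (ball 0 v) (comp \<omega> n)" using Suc by simp
  from holo_on_compose[OF this hol[of "\<omega> n"]] have "holo_on (ball 0 v) (\<lambda>z. f (\<omega> n) (comp \<omega> n z))"
    using \<omega> Suc.prems by blast
  then show ?case by (simp add: o_def)
qed (simp add: holo_on_id[unfolded id_def] id_def)

lemma stays_holo:
  assumes "range \<omega> \<subseteq> I" "stays v \<omega>"
  shows "holo_on (ball 0 v) (comp \<omega> n)"
proof (rule comp_holo[OF assms(1)])
  fix k z assume "z \<in> ball (0::'m cvec) v"
  then have "norm (comp \<omega> k z) \<le> r / 2" using assms(2) by (simp add: stays_def)
  then show "comp \<omega> k z \<in> ball 0 r" using r_pos by auto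
qed

lemma stays_dcomp_bound:
  assumes "range \<omega> \<subseteq> I" "stays v \<omega>" "0 < v"
  shows "opnorm (dcomp \<omega> n) \<le> 2 * real CARD('m) * (r / 2) / v"
  using holo_on_cauchy_bound[OF stays_holo[OF assms(1,2), of n] assms(3), of "r / 2"] assms(2)
  by (simp add: jac_comp_0(2)[OF assms(1)] stays_def)

text \<open>A common expansion constant at the origin on the half ball, from the Cauchy estimate;
  the maximum with 1 makes its powers increasing.\<close>

definition \<Lambda> :: real where "\<Lambda> = max 1 (2 * real CARD('m) * R / (r / 2))"

lemma \<Lambda>_ge_1: "1 \<le> \<Lambda>" by (simp add: \<Lambda>_def)

lemma f_le_\<Lambda>:
  assumes "i \<in> I" "norm z \<le> r / 2"
  shows "norm (f i z) \<le> \<Lambda> * norm z"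
proof -
  have "norm (f i z - f i 0) \<le> 2 * real CARD('m) * R / (r - r / 2) * norm (z - 0)"
    by (rule holo_on_lipschitz[OF hol[OF assms(1)] _ bd[OF assms(1)]]) (use assms r_pos in auto)
  also have "\<dots> \<le> \<Lambda> * norm z" proof -
    have "r - r / 2 = r / 2" by simp
    then show ?thesis unfolding \<Lambda>_def by (simp only: diff_zero) (intro mult_right_mono; simp)
  qed
  finally show ?thesis by (simp add: zero[OF assms(1)])
qed

lemma comp_le_\<Lambda>:
  assumes \<omega>: "range \<omega> \<subseteq> I" and "\<Lambda> ^ n * norm z \<le> r / 2"
  shows "norm (comp \<omega> n z) \<le> \<Lambda> ^ n * norm z"
  using assms(2)
proof (induction n)
  case (Suc n)
  have le: "\<Lambda> ^ n * norm z \<le> \<Lambda> ^ Suc n * norm z"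
    using \<Lambda>_ge_1 by (intro mult_right_mono power_increasing) auto
  then have IH: "norm (comp \<omega> n z) \<le> \<Lambda> ^ n * norm z" using Suc by simp
  then have "norm (f (\<omega> n) (comp \<omega> n z)) \<le> \<Lambda> * norm (comp \<omega> n z)"
    using \<omega> le Suc.prems by (intro f_le_\<Lambda>) auto
  also have "\<dots> \<le> \<Lambda> * (\<Lambda> ^ n * norm z)" using IH \<Lambda>_ge_1 by (intro mult_left_mono) auto
  finally show ?case by simp
qed simp

text \<open>The radius depends on N and \<delta> but not on \<omega>: N steps have a Taylor error
  with uniform constant C, and C r1 \<le> \<delta>.\<close>

lemma comp_block_contraction:
  assumes "0 < \<delta>"
  shows "\<exists>r1>0. \<forall>\<omega> z. range \<omega> \<subseteq> I \<longrightarrow> norm z \<le> r1 \<longrightarrow>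
    norm (comp \<omega> N z) \<le> (opnorm (dcomp \<omega> N) + \<delta>) * norm z"
proof -
  define s where "s = r / 2 / \<Lambda> ^ N"
  have \<Lambda>N: "1 \<le> \<Lambda> ^ N" using \<Lambda>_ge_1 by simp
  have s: "0 < s" using r_pos \<Lambda>N by (simp add: s_def)
  define C where "C = 8 * real CARD('m) * (r / 2) / s\<^sup>2"
  have C: "0 < C" using r_pos s by (simp add: C_def)
  define r1 where "r1 = min (s / 4) (\<delta> / C)"
  have r1: "0 < r1" "r1 \<le> s / 4" "C * r1 \<le> \<delta>" using s C assms by (auto simp: r1_def min_def field_simps)
  have "norm (comp \<omega> N z) \<le> (opnorm (dcomp \<omega> N) + \<delta>) * norm z" if \<omega>: "range \<omega> \<subseteq> I" and z: "norm z \<le> r1" for \<omega> z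
  proof -
    have small: "norm (comp \<omega> k w) \<le> r / 2" if "k \<le> N" "w \<in> ball 0 s" for k w
    proof -
      have "\<Lambda> ^ k * norm w \<le> \<Lambda> ^ N * norm w" using that(1) \<Lambda>_ge_1 by (intro mult_right_mono power_increasing) auto
      also have "\<dots> \<le> \<Lambda> ^ N * s" using that(2) \<Lambda>N by (intro mult_left_mono) auto
      also have "\<dots> = r / 2" using \<Lambda>_ge_1 by (simp add: s_def)
      finally show ?thesis using comp_le_\<Lambda>[OF \<omega>, of k w] by simp
    qed
    have "comp \<omega> k w \<in> ball 0 r" if "k < N" "w \<in> ball 0 s" for k w
      using small[of k w] that r_pos by auto
    then have "holo_on (ball 0 s) (comp \<omega> N)" by (intro comp_holo[OF \<omega>])
    then have "norm (comp \<omega> N z - jac (comp \<omega> N) 0 *v z) \<le> C * (norm z)\<^sup>2"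
      unfolding C_def by (rule holo_on_taylor_bound) (use s small comp_0[OF \<omega>] z r1 in auto)
    also have "\<dots> \<le> C * r1 * norm z"
      using z C by (simp add: power2_eq_square mult_left_mono mult_right_mono flip: mult.assoc)
    also have "\<dots> \<le> \<delta> * norm z" using r1 by (intro mult_right_mono) auto
    finally have "norm (comp \<omega> N z - dcomp \<omega> N *v z) \<le> \<delta> * norm z" by (simp add: jac_comp_0(2)[OF \<omega>])
    then show ?thesis
      using norm_triangle_ineq2[of "comp \<omega> N z" "dcomp \<omega> N *v z"] norm_mult_le_opnorm[of "dcomp \<omega> N" z]
      by (simp add: algebra_simps)
  qed
  then show ?thesis using r1(1) by blast
qed

lemma range_shift: "range \<omega> \<subseteq> I \<Longrightarrow> range (shift k \<omega>) \<subseteq> I"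
  by auto

text \<open>The block products H are bounded by some m, so an orbit starting within r2 / m is still
  within r2 at every block time, where block contraction applies. Inside a block it grows by at most
  \<open>\<Lambda> ^ N\<close>.\<close>

lemma comp_tendsto_0:
  assumes \<omega>: "range \<omega> \<subseteq> I" and \<delta>: "0 < \<delta>" and N: "0 < N"
    and H: "(\<lambda>K. \<Prod>k<K. opnorm (dcomp (shift (k * N) \<omega>) N) + \<delta>) \<longlonglongrightarrow> 0"
  shows "\<exists>v>0. stays v \<omega> \<and> (\<forall>z\<in>ball 0 v. (\<lambda>n. comp \<omega> n z) \<longlonglongrightarrow> 0)"
proof -
  define H where "H K = (\<Prod>k<K. opnorm (dcomp (shift (k * N) \<omega>) N) + \<delta>)" for K
  have lim: "H \<longlonglongrightarrow> 0" using assms(4) by (simp add: H_def[abs_def])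
  have H0: "0 \<le> H K" for K unfolding H_def using \<delta> by (intro prod_nonneg ballI add_nonneg_nonneg opnorm_nonneg) simp
  have "Bseq H" using lim by (metis convergent_def convergent_imp_Bseq)
  then obtain m where m: "0 < m" "\<And>K. H K \<le> m" using H0 by (auto simp: Bseq_def)
  obtain r1 where r1: "0 < r1" "\<And>\<omega> z. range \<omega> \<subseteq> I \<Longrightarrow> norm z \<le> r1 \<Longrightarrow>
    norm (comp \<omega> N z) \<le> (opnorm (dcomp \<omega> N) + \<delta>) * norm z"
    using comp_block_contraction[OF \<delta>, of N] by blast
  define r2 where "r2 = min r1 (r / 2 / \<Lambda> ^ N)"
  have \<Lambda>N: "1 \<le> \<Lambda> ^ N" using \<Lambda>_ge_1 by simp
  have r2: "0 < r2" "r2 \<le> r1" "\<Lambda> ^ N * r2 \<le> r / 2"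
    using r1(1) r_pos \<Lambda>N by (auto simp: r2_def min_def field_simps)
  define v where "v = r2 / m"
  have v: "0 < v" using r2 m by (simp add: v_def)
  have blk: "norm (comp \<omega> (K * N) z) \<le> H K * norm z" and le: "H K * norm z \<le> r2" if z: "z \<in> ball 0 v" for K z
  proof -
    have le: "H K * norm z \<le> r2" for K
    proof -
      have "H K * norm z \<le> m * v" using m z H0 by (intro mult_mono) auto
      then show ?thesis using m by (simp add: v_def)
    qed
    then show "H K * norm z \<le> r2" .
    show "norm (comp \<omega> (K * N) z) \<le> H K * norm z"
    proof (induction K)
      case 0 then show ?case by (simp add: H_def)
    next
      case (Suc K)
      let ?w = "comp \<omega> (K * N) z"
      have "comp \<omega> (Suc K * N) z = comp (shift (K * N) \<omega>) N ?w"
        using compo_add[of "\<lambda>k. f (\<omega> k)" N "K * N"] by (simp add: o_def)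
      also have "norm \<dots> \<le> (opnorm (dcomp (shift (K * N) \<omega>) N) + \<delta>) * norm ?w"
        using Suc le[of K] r2 by (intro r1 range_shift[OF \<omega>]) auto
      also have "\<dots> \<le> (opnorm (dcomp (shift (K * N) \<omega>) N) + \<delta>) * (H K * norm z)"
        using Suc \<delta> by (intro mult_left_mono add_nonneg_nonneg opnorm_nonneg) auto
      also have "\<dots> = H (Suc K) * norm z" by (simp add: H_def)
      finally show ?case .
    qed
  qed
  have all: "norm (comp \<omega> n z) \<le> \<Lambda> ^ N * (H (n div N) * norm z)" if z: "z \<in> ball 0 v" for n z
  proof -
    let ?K = "n div N" and ?i = "n mod N"
    let ?w = "comp \<omega> (?K * N) z"
    have w: "norm ?w \<le> H ?K * norm z" "norm ?w \<le> r2" using blk[OF z, of ?K] le[OF z, of ?K] by auto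
    have p: "\<Lambda> ^ ?i \<le> \<Lambda> ^ N" using \<Lambda>_ge_1 N by (intro power_increasing) auto
    have "\<Lambda> ^ ?i * norm ?w \<le> \<Lambda> ^ N * r2" using p w \<Lambda>_ge_1 by (intro mult_mono) auto
    then have "norm (comp (shift (?K * N) \<omega>) ?i ?w) \<le> \<Lambda> ^ ?i * norm ?w"
      using r2 by (intro comp_le_\<Lambda> range_shift[OF \<omega>]) auto
    also have "\<dots> \<le> \<Lambda> ^ N * (H ?K * norm z)" using p w \<Lambda>_ge_1 by (intro mult_mono) auto
    also have "comp (shift (?K * N) \<omega>) ?i ?w = comp \<omega> n z"
      using compo_add[of "\<lambda>k. f (\<omega> k)" ?i "?K * N"] by (simp add: o_def)
    finally show ?thesis .
  qed
  have "stays v \<omega>"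
    unfolding stays_def
  proof (intro allI ballI)
    fix n z assume z: "z \<in> ball (0::'m cvec) v"
    have "\<Lambda> ^ N * (H (n div N) * norm z) \<le> \<Lambda> ^ N * r2" using le[OF z] \<Lambda>N by (intro mult_left_mono) auto
    then show "norm (comp \<omega> n z) \<le> r / 2" using all[OF z, of n] r2(3) by linarith
  qed
  moreover have "(\<lambda>n. comp \<omega> n z) \<longlonglongrightarrow> 0" if z: "z \<in> ball 0 v" for z
  proof (rule Lim_null_comparison[OF always_eventually])
    show "\<forall>n. norm (comp \<omega> n z) \<le> \<Lambda> ^ N * (H (n div N) * norm z)" using all[OF z] by blast
    have "filterlim (\<lambda>n. n div N) sequentially sequentially"
      unfolding filterlim_at_top eventually_sequentially
      by (metis N div_le_mono div_mult_self_is_m mult.commute)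
    from filterlim_compose[OF lim this]
    have "(\<lambda>n. \<Lambda> ^ N * (H (n div N) * norm z)) \<longlonglongrightarrow> \<Lambda> ^ N * (0 * norm z)" by (intro tendsto_intros)
    then show "(\<lambda>n. \<Lambda> ^ N * (H (n div N) * norm z)) \<longlonglongrightarrow> 0" by simp
  qed
  ultimately show ?thesis using v by blast
qed

text \<open>Continuity of a finite orbit in its maps. Only the last point may leave the half ball,
  and the earlier perturbed points are off by less than r / 4, so maps are compared within radius
  3/4 r only.\<close>

lemma stays_perturb:
  assumes \<omega>: "range \<omega> \<subseteq> I" and z: "\<And>j. j < p \<Longrightarrow> norm (comp \<omega> j z) \<le> r / 2" and e: "0 < e"
  shows "\<exists>d>0. \<forall>\<eta>. (\<forall>i<p. \<forall>w\<in>ball 0 (3/4 * r). norm (f (\<eta> i) w - f (\<omega> i) w) < d) \<longrightarrow>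
    norm (comp \<eta> p z - comp \<omega> p z) < e"
  using z e
proof (induction p arbitrary: e)
  case 0
  then show ?case by (intro exI[of _ 1]) simp
next
  case (Suc p)
  let ?w = "comp \<omega> p z"
  have w: "norm ?w \<le> r / 2" using Suc.prems(1) by simp
  then have "isCont (f (\<omega> p)) ?w"
    using \<omega> r_pos by (intro has_derivative_continuous[OF holo_on_has_derivative[OF hol]]) auto
  then obtain \<delta> where \<delta>: "0 < \<delta>" "\<And>y. dist y ?w < \<delta> \<Longrightarrow> dist (f (\<omega> p) y) (f (\<omega> p) ?w) < e / 2"
    unfolding continuous_at_eps_delta using Suc.prems(2) by (metis half_gt_zero)
  have "0 < min \<delta> (r / 4)" using \<delta> r_pos by simp
  then obtain d where d: "0 < d" "\<And>\<eta>. (\<forall>i<p. \<forall>w\<in>ball 0 (3/4 * r). norm (f (\<eta> i) w - f (\<omega> i) w) < d) \<Longrightarrow>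
      norm (comp \<eta> p z - comp \<omega> p z) < min \<delta> (r / 4)"
    using Suc.IH[of "min \<delta> (r / 4)"] Suc.prems(1) by (metis less_SucI)
  have "norm (comp \<eta> (Suc p) z - comp \<omega> (Suc p) z) < e"
    if \<eta>: "\<forall>i<Suc p. \<forall>w\<in>ball 0 (3/4 * r). norm (f (\<eta> i) w - f (\<omega> i) w) < min d (e / 2)" for \<eta>
  proof -
    let ?y = "comp \<eta> p z"
    have y: "norm (?y - ?w) < min \<delta> (r / 4)" using \<eta> by (intro d(2)) auto
    have "norm ?y \<le> norm (?y - ?w) + norm ?w" using norm_triangle_ineq[of "?y - ?w" ?w] by simp
    then have "?y \<in> ball 0 (3/4 * r)" using y w by simp
    then have "norm (f (\<eta> p) ?y - f (\<omega> p) ?y) < e / 2" using \<eta> by auto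
    moreover have "norm (f (\<omega> p) ?y - f (\<omega> p) ?w) < e / 2" using \<delta>(2)[of ?y] y by (simp add: dist_norm)
    ultimately show ?thesis
      using norm_triangle_ineq[of "f (\<eta> p) ?y - f (\<omega> p) ?y" "f (\<omega> p) ?y - f (\<omega> p) ?w"] by simp
  qed
  then show ?case using d(1) Suc.prems(2) by (intro exI[of _ "min d (e / 2)"]) simp
qed

text \<open>Leaving the half ball is a strict inequality at a first time p, so instability depends
  on finitely many maps and persists when they change a little.\<close>

lemma not_stays_perturb:
  assumes \<omega>: "range \<omega> \<subseteq> I" and "\<not> stays v \<omega>"
  shows "\<exists>d>0. \<exists>p. \<forall>\<eta>. (\<forall>i<p. \<forall>w\<in>ball 0 (3/4 * r). norm (f (\<eta> i) w - f (\<omega> i) w) < d) \<longrightarrow> \<not> stays v \<eta>"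
proof -
  obtain n z where z: "z \<in> ball 0 v" "\<not> norm (comp \<omega> n z) \<le> r / 2" using assms(2) by (auto simp: stays_def)
  define p where "p = (LEAST n. \<not> norm (comp \<omega> n z) \<le> r / 2)"
  have p: "\<not> norm (comp \<omega> p z) \<le> r / 2" unfolding p_def by (rule LeastI[of _ n]) (rule z(2))
  have less: "norm (comp \<omega> j z) \<le> r / 2" if "j < p" for j using not_less_Least[of j] that by (auto simp: p_def)
  have "0 < norm (comp \<omega> p z) - r / 2" using p by simp
  from stays_perturb[OF \<omega> less this] obtain d where d: "0 < d"
    "\<And>\<eta>. \<forall>i<p. \<forall>w\<in>ball 0 (3/4 * r). norm (f (\<eta> i) w - f (\<omega> i) w) < d \<Longrightarrow>
      norm (comp \<eta> p z - comp \<omega> p z) < norm (comp \<omega> p z) - r / 2" by blast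
  have "\<not> stays v \<eta>" if "\<forall>i<p. \<forall>w\<in>ball 0 (3/4 * r). norm (f (\<eta> i) w - f (\<omega> i) w) < d" for \<eta>
  proof
    assume "stays v \<eta>"
    then have "norm (comp \<eta> p z) \<le> r / 2" using z(1) by (simp add: stays_def)
    moreover have "norm (comp \<omega> p z) - norm (comp \<eta> p z) \<le> norm (comp \<eta> p z - comp \<omega> p z)"
      by (metis norm_minus_commute norm_triangle_ineq2)
    ultimately show False using d(2)[OF that] by linarith
  qed
  then show ?thesis using d(1) by blast
qed

text \<open>The Fatou condition permits any representatives g on any domains. Normality bounds their
  iterates, a Lipschitz bound at 0 makes the orbits small near 0, and the identity theorem
  identifies them step by step with those of the fixed family.\<close>

lemma fatou_imp_stays:
  assumes \<omega>: "range \<omega> \<subseteq> I" and F: "\<And>k. F k = germ_of (f (\<omega> k))" and fat: "fatou_at_0 F"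
  shows "\<exists>v>0. stays v \<omega>"
proof -
  obtain V U g where V: "open V" "0 \<in> V" and def: "defined_on V F U g"
    and holc: "\<And>n. n \<ge> 1 \<Longrightarrow> holo_on V (compo g n)" and nf: "normal_family V {compo g n |n. n \<ge> 1}"
    using fat unfolding fatou_at_0_def by blast
  have g: "open (U k)" "0 \<in> U k" "holo_on (U k) (g k)" "\<forall>\<^sub>F z in nhds 0. g k z = f (\<omega> k) z" for k
    using def unfolding defined_on_def F mem_germ_of by blast+
  have inU: "compo g n z \<in> U n" if "z \<in> V" for n z using def that unfolding defined_on_def by blast
  have g0: "g k 0 = 0" for k using eventually_nhds_x_imp_x[OF g(4)[of k]] \<omega> zero by auto
  have holc': "holo_on V (compo g n)" for n
    using holc[of n] by (cases "n = 0") (auto simp: holo_on_id[unfolded id_def] id_def)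
  obtain v where v: "0 < v" "cball 0 v \<subseteq> V" using V open_contains_cball by blast
  have "\<exists>B. \<forall>n\<ge>1. \<forall>z\<in>cball 0 v. norm (compo g n z) \<le> B"
    by (rule normal_family_bounded[OF nf _ v(2)])
      (auto intro: holo_on_imp_continuous_on[OF holo_on_subset[OF holc' v(2)]])
  then obtain B0 where B0: "\<And>n z. n \<ge> 1 \<Longrightarrow> z \<in> cball 0 v \<Longrightarrow> norm (compo g n z) \<le> B0" by blast
  \<comment> \<open>The identity, n = 0, does not belong to the normal family, hence the maximum
    with v.\<close>
  define B where "B = max B0 v"
  have B: "norm (compo g n z) \<le> B" if "z \<in> ball 0 v" for n z
    using B0[of n z] that by (cases "n = 0") (auto simp: B_def)
  have holb: "holo_on (ball 0 v) (compo g n)" for n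
    using v(2) ball_subset_cball by (intro holo_on_subset[OF holc']) blast
  define L where "L = 2 * real CARD('m) * B / (v - v / 2)"
  have Bpos: "0 < B" using v(1) by (simp add: B_def)
  have L: "0 < L" using v(1) Bpos by (simp add: L_def)
  define w where "w = min (v / 2) (r / 2 / L)"
  have w: "0 < w" "w \<le> v / 2" "L * w \<le> r / 2" using v(1) L r_pos by (auto simp: w_def min_def field_simps)
  have small: "norm (compo g n z) \<le> r / 2" if "z \<in> ball 0 w" for n z
  proof -
    have "norm (compo g n z - compo g n 0) \<le> L * norm (z - 0)"
      unfolding L_def using that w v(1) by (intro holo_on_lipschitz[OF holb _ B]) auto
    also have "\<dots> \<le> L * w" using that L by (intro mult_left_mono) auto
    finally show ?thesis using w(3) by (simp add: compo_0_fixed[of g, OF g0])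
  qed
  have holw: "holo_on (ball 0 w) (compo g n)" for n
    using w v(1) by (intro holo_on_subset[OF holb]) auto
  have eq: "comp \<omega> n z = compo g n z" if "z \<in> ball 0 w" for n z
    using that
  proof (induction n arbitrary: z)
    case (Suc n)
    have inr: "compo g n y \<in> ball 0 r" if "y \<in> ball 0 w" for y using small[OF that, of n] r_pos by auto
    have "(\<lambda>z. f (\<omega> n) (compo g n z)) z = (\<lambda>z. g n (compo g n z)) z"
    proof (rule holo_on_identity[where s = w and z = z])
      show "holo_on (ball 0 w) (\<lambda>z. f (\<omega> n) (compo g n z))"
        using \<omega> inr by (intro holo_on_compose[OF holw hol]) auto
      show "holo_on (ball 0 w) (\<lambda>z. g n (compo g n z))"
      proof (rule holo_on_compose[OF holw g(3)])
        fix y :: "'m cvec" assume "y \<in> ball 0 w"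
        then have "y \<in> V" using w v by (auto simp: subset_iff)
        then show "compo g n y \<in> U n" by (rule inU)
      qed
      have "isCont (compo g n) 0"
        using w by (intro has_derivative_continuous[OF holo_on_has_derivative[OF holw]]) auto
      then have "filterlim (compo g n) (nhds 0) (nhds 0)"
        using compo_0_fixed[of g n, OF g0] tendsto_at_iff_tendsto_nhds[of "compo g n" 0]
        by (simp add: isCont_def)
      from eventually_compose_filterlim[OF g(4)[of n] this]
      show "\<forall>\<^sub>F z in nhds 0. f (\<omega> n) (compo g n z) = g n (compo g n z)"
        by (auto elim: eventually_mono)
    qed (rule Suc.prems)
    then show ?case using Suc.IH[OF Suc.prems] by simp
  qed simp
  have "stays w \<omega>" unfolding stays_def using eq small by simp
  then show ?thesis using w(1) by blast
qed

end

lemma norm_le_opnorm: "norm A \<le> (real CARD('m))\<^sup>2 * opnorm (A::'m::finite cmat)"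
proof -
  have entry: "cmod (A $ i $ j) \<le> opnorm A" for i j
  proof -
    have "A $ i $ j = (A *v axis j 1) $ i"
      by (simp add: matrix_vector_mult_def axis_def if_distrib cong: if_cong)
    then have "cmod (A $ i $ j) \<le> norm (A *v axis j 1)" using norm_nth_le_norm by metis
    also have "\<dots> \<le> opnorm A" using norm_mult_le_opnorm[of A "axis j 1"] by (simp add: norm_axis_1)
    finally show ?thesis .
  qed
  have "norm A \<le> (\<Sum>i\<in>UNIV. norm (A $ i))" unfolding norm_vec_def[of A] by (rule L2_set_le_sum) simp
  also have "\<dots> \<le> (\<Sum>i\<in>(UNIV::'m set). real CARD('m) * opnorm A)"
    by (intro sum_mono norm_le_CARD entry)
  finally show ?thesis by (simp add: power2_eq_square)
qed

text \<open>These matrices form a compact set of invertible ones, on which the least stretching of a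
  unit vector is attained and positive. This turns |det| = 1 into a uniform bound on
  inverses.\<close>

lemma unimodular_lower_bound:
  "\<exists>c>0. \<forall>A::'m::finite cmat. opnorm A \<le> C \<and> cmod (det A) = 1 \<longrightarrow> (\<forall>x. c * norm x \<le> norm (A *v x))"
proof -
  let ?S = "{A::'m cmat. opnorm A \<le> C \<and> cmod (det A) = 1}"
  have "closed ?S"
    by (intro closed_Collect_conj closed_Collect_le closed_Collect_eq continuous_intros)
  moreover have "bounded ?S"
  proof -
    have "norm A \<le> (real CARD('m))\<^sup>2 * C" if "A \<in> ?S" for A
    proof -
      have "(real CARD('m))\<^sup>2 * opnorm A \<le> (real CARD('m))\<^sup>2 * C"
        using that by (intro mult_left_mono) auto
      then show ?thesis using norm_le_opnorm[of A] by linarith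
    qed
    then show ?thesis unfolding bounded_iff by blast
  qed
  ultimately have comp: "compact ?S" by (simp add: compact_eq_bounded_closed)
  show ?thesis
  proof (cases "?S = {}")
    case True
    then show ?thesis by (intro exI[of _ 1]) auto
  next
    case False
    let ?T = "?S \<times> sphere (0::'m cvec) 1"
    have "norm (axis undefined 1 :: 'm cvec) = 1" by simp
    moreover obtain A0 where "A0 \<in> ?S" using False by blast
    ultimately have "(A0, axis undefined 1) \<in> ?T" by simp
    then have ne: "?T \<noteq> {}" by blast
    have ct: "compact ?T" by (intro compact_Times comp compact_sphere)
    have "continuous_on ?T (\<lambda>p. norm (fst p *v snd p))" by (intro continuous_intros)
    from continuous_attains_inf[OF ct ne this] obtain p where p: "p \<in> ?T"
      "\<And>q. q \<in> ?T \<Longrightarrow> norm (fst p *v snd p) \<le> norm (fst q *v snd q)" by blast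
    define c where "c = norm (fst p *v snd p)"
    have "det (fst p) \<noteq> 0" "snd p \<noteq> 0" using p(1) by auto
    moreover obtain B where "B ** fst p = mat 1"
      using invertible_det_nz[of "fst p"] \<open>det (fst p) \<noteq> 0\<close> by (auto simp: invertible_def)
    then have "B *v (fst p *v snd p) = snd p" by (simp add: matrix_vector_mul_assoc)
    ultimately have "fst p *v snd p \<noteq> 0" by (metis matrix_vector_mult_0_right)
    then have c: "0 < c" by (simp add: c_def)
    have "c * norm x \<le> norm (A *v x)" if "A \<in> ?S" for A x
    proof (cases "x = 0")
      case False
      have "(A, (1 / norm x) *\<^sub>R x) \<in> ?T" using that False by simp
      from p(2)[OF this] have "c \<le> norm (A *v ((1 / norm x) *\<^sub>R x))" by (simp add: c_def)
      also have "\<dots> = norm (A *v x) / norm x" by (simp add: matrix_vector_scaleR)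
      finally show ?thesis using False by (simp add: field_simps)
    qed simp
    then show ?thesis using c by blast
  qed
qed

section \<open>Fixed points of bounded linear actions\<close>

text \<open>The circumcentre argument uses convexity only through the parallelogram identity, so
  closure under midpoints suffices, and properties of the members follow by induction.\<close>

inductive_set midpoint_hull :: "('x \<Rightarrow> 'x \<Rightarrow> 'x) \<Rightarrow> 'x set \<Rightarrow> 'x set" for mid S where
  base: "x \<in> S \<Longrightarrow> x \<in> midpoint_hull mid S"
| mid: "x \<in> midpoint_hull mid S \<Longrightarrow> y \<in> midpoint_hull mid S \<Longrightarrow> mid x y \<in> midpoint_hull mid S"

text \<open>The circumcentre argument: if each \<open>N g\<close> satisfies the parallelogram identity, two points almost minimising
  \<open>sup\<^sub>g N g\<close> must be close for at least one \<open>g\<close>.\<close>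

lemma midpoint_minimizing:
  fixes N :: "'g \<Rightarrow> 'x \<Rightarrow> real" and D :: "'g \<Rightarrow> 'x \<Rightarrow> 'x \<Rightarrow> real"
  assumes x0: "x0 \<in> CV" "\<And>g. g \<in> G \<Longrightarrow> N g x0 \<le> b0" and G: "g0 \<in> G"
    and mid: "\<And>x y. x \<in> CV \<Longrightarrow> y \<in> CV \<Longrightarrow> mid x y \<in> CV"
    and nonneg: "\<And>g x. g \<in> G \<Longrightarrow> x \<in> CV \<Longrightarrow> 0 \<le> N g x"
    and par: "\<And>g x y. g \<in> G \<Longrightarrow> x \<in> CV \<Longrightarrow> y \<in> CV \<Longrightarrow> N g (mid x y) = (N g x + N g y) / 2 - D g x y / 4"
  shows "\<exists>m. (\<forall>e>0. \<exists>x\<in>CV. \<forall>g\<in>G. N g x \<le> m + e) \<and>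
    (\<forall>e>0. \<forall>x\<in>CV. \<forall>y\<in>CV. (\<forall>g\<in>G. N g x \<le> m + e) \<and> (\<forall>g\<in>G. N g y \<le> m + e) \<longrightarrow> (\<exists>g\<in>G. D g x y \<le> 8 * e))"
proof -
  define B where "B = {b. \<exists>x\<in>CV. \<forall>g\<in>G. N g x \<le> b}"
  define m where "m = Inf B"
  have ne: "B \<noteq> {}" using x0 by (auto simp: B_def)
  have bdd: "bdd_below B"
    by (rule bdd_belowI[of _ 0]) (use nonneg G in \<open>force simp: B_def\<close>)
  have 1: "\<exists>x\<in>CV. \<forall>g\<in>G. N g x \<le> m + e" if e: "0 < e" for e
  proof -
    have "Inf B < m + e" using e by (simp add: m_def)
    then obtain b where "b \<in> B" "b < m + e" using cInf_lessD[OF ne] by blast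
    then obtain x where x: "x \<in> CV" "\<forall>g\<in>G. N g x \<le> b" by (auto simp: B_def)
    then have "\<forall>g\<in>G. N g x \<le> m + e" using \<open>b < m + e\<close> by force
    then show ?thesis using x(1) by blast
  qed
  have 2: "\<exists>g\<in>G. D g x y \<le> 8 * e" if e: "0 < e" and xy: "x \<in> CV" "y \<in> CV"
    and le: "\<And>g. g \<in> G \<Longrightarrow> N g x \<le> m + e" "\<And>g. g \<in> G \<Longrightarrow> N g y \<le> m + e" for e x y
  proof (rule ccontr)
    assume no: "\<not> (\<exists>g\<in>G. D g x y \<le> 8 * e)"
    have "N g (mid x y) \<le> m - e" if g: "g \<in> G" for g
    proof -
      have "8 * e < D g x y" using no g by force
      moreover have "4 * N g (mid x y) = 2 * N g x + 2 * N g y - D g x y"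
        unfolding par[OF g xy] by (simp add: field_simps)
      ultimately show ?thesis using le[OF g] by linarith
    qed
    then have "m - e \<in> B" using mid[OF xy] by (auto simp: B_def)
    then have "m \<le> m - e" unfolding m_def by (rule cInf_lower[OF _ bdd])
    then show False using e by simp
  qed
  show ?thesis by (intro exI[of _ m] conjI allI impI ballI 1 2) auto
qed

lemma parallelogram_midpoint:
  "(norm ((1/2) *\<^sub>R (a + b)))\<^sup>2 = ((norm a)\<^sup>2 + (norm b)\<^sup>2) / 2 - (norm (a - b :: 'a::real_inner))\<^sup>2 / 4"
  by (simp add: power2_norm_eq_inner inner_add inner_diff inner_commute field_simps)

section \<open>Invariant Hermitian forms\<close>

lemma opnorm_adjointC_le: "opnorm (adjointC B) \<le> opnorm (B::'m::finite cmat)"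
proof (rule onorm_bound[OF opnorm_nonneg])
  fix x
  have "(norm (adjointC B *v x))\<^sup>2 = inner x (B *v (adjointC B *v x))"
    by (simp add: power2_norm_eq_inner inner_adjointC)
  also have "\<dots> \<le> norm x * (opnorm B * norm (adjointC B *v x))"
    using norm_cauchy_schwarz[of x "B *v (adjointC B *v x)"] norm_mult_le_opnorm[of B "adjointC B *v x"]
    by (meson mult_left_mono norm_ge_zero order_trans)
  finally have "norm (adjointC B *v x) * norm (adjointC B *v x) \<le> (opnorm B * norm x) * norm (adjointC B *v x)"
    by (simp add: power2_eq_square mult_ac)
  then show "norm (adjointC B *v x) \<le> opnorm B * norm x"
    by (cases "adjointC B *v x = 0") (simp_all add: opnorm_nonneg mult_le_cancel_right)
qed

definition congr :: "'m::finite cmat \<Rightarrow> 'm cmat \<Rightarrow> 'm cmat" where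
  "congr A Q = adjointC A ** Q ** A"

lemma congr_congr: "congr A (congr B Q) = congr (B ** A) Q"
  by (simp add: congr_def adjointC_mult matrix_mul_assoc)

lemma linear_congr: "linear (congr A)"
proof -
  have "linear ((\<lambda>Y. Y ** A) \<circ> (\<lambda>Y. adjointC A ** Y))"
    using bounded_bilinear.bounded_linear_right[OF bounded_bilinear_matrix_mult, of "adjointC A"]
      bounded_bilinear.bounded_linear_left[OF bounded_bilinear_matrix_mult, of A]
    by (intro linear_compose bounded_linear.linear)
  then show ?thesis by (simp add: congr_def[abs_def] o_def)
qed

lemma norm_congr_le:
  "\<exists>K>0. \<forall>b A Q. opnorm A \<le> b \<longrightarrow> norm (congr A Q) \<le> K * b\<^sup>2 * norm (Q::'m::finite cmat)"
proof -
  obtain K where K: "0 < K" "\<And>A::'m cmat. opnorm A \<le> K * norm A" using opnorm_le_norm by blast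
  have "norm (congr A Q) \<le> ((real CARD('m))\<^sup>2 * K) * b\<^sup>2 * norm Q" if "opnorm A \<le> b" for b and A Q :: "'m cmat"
  proof -
    have b: "0 \<le> b" using opnorm_nonneg[of A] that by linarith
    have "opnorm (congr A Q) \<le> opnorm (adjointC A ** Q) * opnorm A"
      unfolding congr_def by (rule opnorm_mult_le)
    also have "\<dots> \<le> (opnorm (adjointC A) * opnorm Q) * opnorm A"
      by (intro mult_right_mono opnorm_mult_le opnorm_nonneg)
    also have "\<dots> \<le> (b * (K * norm Q)) * b"
      using K that b opnorm_adjointC_le[of A] by (intro mult_mono) (auto simp: opnorm_nonneg intro!: mult_nonneg_nonneg)
    finally have "opnorm (congr A Q) \<le> (b * (K * norm Q)) * b" .
    then have "(real CARD('m))\<^sup>2 * opnorm (congr A Q) \<le> (real CARD('m))\<^sup>2 * ((b * (K * norm Q)) * b)"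
      by (rule mult_left_mono) simp
    also have "\<dots> = ((real CARD('m))\<^sup>2 * K) * b\<^sup>2 * norm Q" by (simp add: power2_eq_square mult_ac)
    finally show ?thesis using norm_le_opnorm[of "congr A Q"] by linarith
  qed
  then show ?thesis using K(1) by (intro exI[of _ "(real CARD('m))\<^sup>2 * K"]) auto
qed

text \<open>With P the positive square root of Q and P' its inverse, invariance of Q says exactly
  that P A P' preserves the standard form. The lower bound on Q makes P invertible.\<close>

lemma invariant_form_imp_unitary:
  fixes Q :: "'m::finite cmat"
  assumes herm: "adjointC Q = Q" and c: "0 < c" "\<And>x. c * (norm x)\<^sup>2 \<le> inner x (Q *v x)"
    and inv: "\<And>A. A \<in> \<A> \<Longrightarrow> congr A Q = Q"
  shows "\<exists>P P' :: 'm cmat. P ** P' = mat 1 \<and> P' ** P = mat 1 \<and> (\<forall>A\<in>\<A>. P ** A ** P' \<in> unitary_grp)"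
proof -
  have psd: "hermitian_psd Q"
    unfolding hermitian_psd_inner using herm c by (metis less_imp_le mult_nonneg_nonneg order_trans zero_le_power2)
  obtain P where P: "hermitian_psd P" "mpow P 2 = Q" using mroot[OF psd, of 2] by auto
  have PP: "P ** P = Q" using P(2) by (simp add: numeral_2_eq_2 mpow_Suc mpow_0)
  have aP: "adjointC P = P" using P(1) by (simp add: hermitian_psd_def)
  have "sqrt c * norm x \<le> norm (P *v x)" for x
  proof (rule power2_le_imp_le)
    have "(norm (P *v x))\<^sup>2 = inner x (Q *v x)"
      unfolding PP[symmetric] power2_norm_eq_inner by (simp add: inner_adjointC aP flip: matrix_vector_mul_assoc)
    then show "(sqrt c * norm x)\<^sup>2 \<le> (norm (P *v x))\<^sup>2" using c by (simp add: power_mult_distrib)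
  qed simp
  then obtain P' where P': "P' ** P = mat 1" "P ** P' = mat 1"
    using matrix_left_inverse_bound[of "sqrt c" P] c(1) by (metis real_sqrt_gt_0_iff)
  have aP': "adjointC P' ** P = mat 1"
    using arg_cong[OF P'(2), of adjointC] by (simp add: adjointC_mult aP)
  have "P ** A ** P' \<in> unitary_grp" if A: "A \<in> \<A>" for A
  proof -
    let ?U = "P ** A ** P'"
    have "adjointC ?U ** ?U = adjointC P' ** (congr A (P ** P)) ** P'"
      by (simp add: adjointC_mult aP congr_def matrix_mul_assoc)
    also have "\<dots> = (adjointC P' ** P) ** (P ** P')" using inv[OF A] by (simp add: PP[symmetric] matrix_mul_assoc)
    also have "\<dots> = mat 1" by (simp add: aP' P')
    finally have "adjointC ?U ** ?U = mat 1" .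
    moreover from this have "?U ** adjointC ?U = mat 1" using matrix_left_right_inverse by blast
    ultimately show ?thesis by (simp add: unitary_grp_def)
  qed
  then have u: "\<forall>A\<in>\<A>. P ** A ** P' \<in> unitary_grp" by simp
  show ?thesis by (rule exI[of _ P], rule exI[of _ P'], intro conjI P' u)
qed

text \<open>A semigroup of matrices that is bounded together with its inverses preserves a Hermitian form, found as
  the circumcentre of the orbit of the standard one.\<close>

lemma bounded_semigroup_unitary:
  fixes \<A> :: "'m::finite cmat set"
  assumes sg: "\<And>A B. A \<in> \<A> \<Longrightarrow> B \<in> \<A> \<Longrightarrow> A ** B \<in> \<A>" and ne: "A0 \<in> \<A>"
    and up: "\<And>A. A \<in> \<A> \<Longrightarrow> opnorm A \<le> C"
    and lo: "0 < c" "\<And>A x. A \<in> \<A> \<Longrightarrow> c * norm x \<le> norm (A *v x)"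
  shows "\<exists>P P' :: 'm cmat. P ** P' = mat 1 \<and> P' ** P = mat 1 \<and> (\<forall>A\<in>\<A>. P ** A ** P' \<in> unitary_grp)"
proof -
  define mid :: "'m cmat \<Rightarrow> 'm cmat \<Rightarrow> 'm cmat" where "mid X Y = (1/2) *\<^sub>R (X + Y)" for X Y
  define CV where "CV = midpoint_hull mid ((\<lambda>A. adjointC A ** A) ` \<A>)"
  have congr_mid: "congr A (mid X Y) = mid (congr A X) (congr A Y)" for A X Y
    by (simp add: mid_def linear_add[OF linear_congr] linear_scale[OF linear_congr])
  obtain Kc where Kc: "0 < Kc" "\<And>b A Q. opnorm A \<le> b \<Longrightarrow> norm (congr A Q) \<le> Kc * b\<^sup>2 * norm (Q::'m cmat)"
    using norm_congr_le by metis
  define KQ where "KQ = (real CARD('m))\<^sup>2 * C\<^sup>2"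
  \<comment> \<open>Averages inherit both uniform bounds. The upper one gives compactness, and the
    lower one survives in the limit and keeps the form definite.\<close>
  have CV: "adjointC Q = Q \<and> norm Q \<le> KQ \<and> (\<forall>x. c\<^sup>2 * (norm x)\<^sup>2 \<le> inner x (Q *v x))" if "Q \<in> CV" for Q
    using that unfolding CV_def
  proof induction
    case (base Q)
    then obtain A where A: "A \<in> \<A>" "Q = adjointC A ** A" by blast
    have "(opnorm A)\<^sup>2 \<le> C\<^sup>2" using up[OF A(1)] by (intro power_mono opnorm_nonneg)
    then have "norm Q \<le> KQ"
      using norm_le_opnorm[of Q] unfolding A(2) opnorm_adjoint_mult KQ_def
      by (meson mult_left_mono order_trans zero_le_power2)
    moreover have "c\<^sup>2 * (norm x)\<^sup>2 \<le> inner x (Q *v x)" for x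
    proof -
      have "(c * norm x)\<^sup>2 \<le> (norm (A *v x))\<^sup>2" using lo A(1) by (intro power_mono) auto
      then show ?thesis
        by (simp add: A(2) power_mult_distrib power2_norm_eq_inner[of "A *v x"] inner_adjointC matrix_vector_mul_assoc)
    qed
    ultimately show ?case by (simp add: A(2) adjointC_mult)
  next
    case (mid X Y)
    have "adjointC (mid X Y) = mid X Y"
      using mid.IH by (simp add: mid_def adjointC_def vec_eq_iff)
    moreover have "norm (mid X Y) \<le> KQ"
      using mid.IH norm_triangle_ineq[of X Y] by (simp add: mid_def)
    moreover have "c\<^sup>2 * (norm x)\<^sup>2 \<le> inner x (mid X Y *v x)" for x
    proof -
      have "c\<^sup>2 * (norm x)\<^sup>2 \<le> inner x (X *v x)" "c\<^sup>2 * (norm x)\<^sup>2 \<le> inner x (Y *v x)" using mid.IH by auto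
      then show ?thesis
        by (simp add: mid_def scaleR_matrix_vector matrix_vector_mult_add_rdistrib inner_add_right)
    qed
    ultimately show ?case by blast
  qed
  have CVcongr: "congr A Q \<in> CV" if "A \<in> \<A>" "Q \<in> CV" for A Q
    using that(2) unfolding CV_def
  proof induction
    case (base Q)
    then obtain B where B: "B \<in> \<A>" "Q = adjointC B ** B" by blast
    have "congr A Q = adjointC (B ** A) ** (B ** A)" by (simp add: congr_def B(2) adjointC_mult matrix_mul_assoc)
    then show ?case using sg[OF B(1) that(1)] by (intro midpoint_hull.base) blast
  next
    case (mid X Y)
    then show ?case by (simp add: congr_mid midpoint_hull.mid)
  qed
  define N where "N A Q = (norm (congr A Q))\<^sup>2" for A Q :: "'m cmat"
  define D where "D A X Y = (norm (congr A (X - Y)))\<^sup>2" for A X Y :: "'m cmat"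
  let ?Q0 = "adjointC A0 ** A0"
  have Q0: "?Q0 \<in> CV" unfolding CV_def using ne by (intro midpoint_hull.base) blast
  have "\<exists>m. (\<forall>e>0. \<exists>x\<in>CV. \<forall>g\<in>\<A>. N g x \<le> m + e) \<and>
    (\<forall>e>0. \<forall>x\<in>CV. \<forall>y\<in>CV. (\<forall>g\<in>\<A>. N g x \<le> m + e) \<and> (\<forall>g\<in>\<A>. N g y \<le> m + e) \<longrightarrow> (\<exists>g\<in>\<A>. D g x y \<le> 8 * e))"
  proof (rule midpoint_minimizing[where mid = mid and ?b0.0 = "KQ\<^sup>2", OF Q0 _ ne])
    show "N A ?Q0 \<le> KQ\<^sup>2" if "A \<in> \<A>" for A
      unfolding N_def using CV[OF CVcongr[OF that Q0]] by (intro power_mono) auto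
    show "mid X Y \<in> CV" if "X \<in> CV" "Y \<in> CV" for X Y using that unfolding CV_def by (rule midpoint_hull.mid)
    show "N A (mid X Y) = (N A X + N A Y) / 2 - D A X Y / 4" for A X Y
      unfolding N_def D_def congr_mid linear_diff[OF linear_congr]
      unfolding mid_def by (rule parallelogram_midpoint)
  qed (simp add: N_def)
  then obtain m where m1: "\<forall>e>0. \<exists>x\<in>CV. \<forall>g\<in>\<A>. N g x \<le> m + e"
    and m2: "\<forall>e>0. \<forall>x\<in>CV. \<forall>y\<in>CV. (\<forall>g\<in>\<A>. N g x \<le> m + e) \<and> (\<forall>g\<in>\<A>. N g y \<le> m + e) \<longrightarrow> (\<exists>g\<in>\<A>. D g x y \<le> 8 * e)"
    by (elim exE conjE)
  have pos: "0 < 1 / real (Suc k)" for k by simp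
  have "\<exists>x. x \<in> CV \<and> (\<forall>g\<in>\<A>. N g x \<le> m + 1 / real (Suc k))" for k
    using m1[rule_format, OF pos[of k]] by blast
  then obtain x where x: "\<And>k. x k \<in> CV" "\<And>k. \<forall>g\<in>\<A>. N g (x k) \<le> m + 1 / real (Suc k)" by metis
  have "\<forall>k. x k \<in> cball 0 KQ" using CV[OF x(1)] by simp
  then obtain Q s where s: "strict_mono (s :: nat \<Rightarrow> nat)" "(x \<circ> s) \<longlonglongrightarrow> Q"
    using compact_cball[of "0::'m cmat" KQ] unfolding compact_def by blast
  have Q: "adjointC Q = Q \<and> (\<forall>z. c\<^sup>2 * (norm z)\<^sup>2 \<le> inner z (Q *v z))"
  proof -
    have "closed {Q. adjointC Q = Q \<and> (\<forall>z. c\<^sup>2 * (norm z)\<^sup>2 \<le> inner z (Q *v (z::'m cvec)))}"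
      by (intro closed_Collect_conj closed_Collect_all closed_Collect_eq closed_Collect_le continuous_intros)
    from closed_sequentially[OF this _ s(2)] CV[OF x(1)] show ?thesis by simp
  qed
  have inv: "congr A Q = Q" if A: "A \<in> \<A>" for A
  proof -
    define K where "K = Kc * (1 / c)\<^sup>2"
    \<comment> \<open>As \<open>N g (congr A X) = N (A ** g) X\<close>, the image of a near
      minimiser is one too. The two are therefore close after applying some g, and the inverse of g,
      of norm at most 1 / c, removes it.\<close>
    have small: "(norm (x k - congr A (x k)))\<^sup>2 \<le> K\<^sup>2 * (8 * (1 / real (Suc k)))" for k
    proof -
      have "N g (congr A (x k)) = N (A ** g) (x k)" for g
        by (simp add: N_def congr_congr)
      then have "\<forall>g\<in>\<A>. N g (congr A (x k)) \<le> m + 1 / real (Suc k)"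
        using x(2)[of k] sg[OF A] by simp
      then obtain g where g: "g \<in> \<A>" "D g (x k) (congr A (x k)) \<le> 8 * (1 / real (Suc k))"
        using m2[rule_format, OF pos[of k] x(1)[of k] CVcongr[OF A x(1)[of k]]] x(2)[of k] by blast
      obtain B where B: "g ** B = mat 1" "opnorm B \<le> 1 / c"
        using matrix_left_inverse_bound[OF lo(1) lo(2)[OF g(1)]] by blast
      let ?d = "x k - congr A (x k)"
      have "?d = congr B (congr g ?d)" unfolding congr_congr B(1) by (simp add: congr_def)
      then have "norm ?d \<le> K * norm (congr g ?d)" using Kc(2)[OF B(2), of "congr g ?d"] by (simp add: K_def)
      then have "(norm ?d)\<^sup>2 \<le> K\<^sup>2 * D g (x k) (congr A (x k))"
        unfolding D_def power_mult_distrib[symmetric] by (intro power_mono) auto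
      also have "\<dots> \<le> K\<^sup>2 * (8 * (1 / real (Suc k)))" using g(2) by (intro mult_left_mono) auto
      finally show ?thesis .
    qed
    have "(\<lambda>k. (norm (x (s k) - congr A (x (s k))))\<^sup>2) \<longlonglongrightarrow> (norm (Q - congr A Q))\<^sup>2"
      using s(2) unfolding congr_def o_def by (intro tendsto_intros)
    moreover have "(\<lambda>k. (norm (x (s k) - congr A (x (s k))))\<^sup>2) \<longlonglongrightarrow> 0"
    proof (rule tendsto_sandwich[OF _ _ tendsto_const])
      have "(\<lambda>k. K\<^sup>2 * (8 * (1 / real (Suc k)))) \<longlonglongrightarrow> K\<^sup>2 * (8 * 0)"
        by (intro tendsto_intros LIMSEQ_inverse_real_of_nat[unfolded inverse_eq_divide])
      from LIMSEQ_subseq_LIMSEQ[OF this s(1)]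
      show "(\<lambda>k. K\<^sup>2 * (8 * (1 / real (Suc (s k))))) \<longlonglongrightarrow> 0" by (simp add: o_def)
    qed (use small in \<open>auto intro!: always_eventually\<close>)
    ultimately have "(norm (Q - congr A Q))\<^sup>2 = 0" using LIMSEQ_unique by blast
    then show ?thesis by simp
  qed
  show ?thesis
    by (rule invariant_form_imp_unitary[of Q "c\<^sup>2"]) (use Q lo(1) inv in auto)
qed

section \<open>Linearization of a uniformly stable family\<close>

lemma fold_matrix_mult_append:
  "fold (\<lambda>i X. J i ** X) ws Y = fold (\<lambda>i X. J i ** X) ws (mat 1) ** (Y :: 'm::finite cmat)"
proof (induction ws arbitrary: Y)
  case (Cons i ws)
  show ?case
    using Cons[of "J i ** Y"] Cons[of "J i"] by (simp add: matrix_mul_assoc)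
qed simp

locale stable_family = bdd_family I f r R
  for I :: "'i set" and f :: "'i \<Rightarrow> 'm::finite cvec \<Rightarrow> 'm cvec" and r R +
  fixes \<rho> :: real
  assumes \<rho>_pos: "0 < \<rho>"
    and stable: "\<And>\<omega>. range \<omega> \<subseteq> I \<Longrightarrow> stays \<rho> \<omega>"
    and unimod: "\<And>i. i \<in> I \<Longrightarrow> cmod (det (jac (f i) 0)) = 1"
    and I_ne: "I \<noteq> {}"
begin

text \<open>A word is applied from its first letter on, so the matrices of concatenated words
  multiply in reverse order.\<close>

abbreviation gw :: "'i list \<Rightarrow> 'm cvec \<Rightarrow> 'm cvec" where
  "gw \<equiv> fold f"

definition Aw :: "'i list \<Rightarrow> 'm cmat" where
  "Aw ws = fold (\<lambda>i X. jac (f i) 0 ** X) ws (mat 1)"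

lemma comp_eq_gw: "comp \<omega> n = gw (map \<omega> [0..<n])"
  by (induction n) (auto simp: o_def)

lemma dcomp_eq_Aw: "dcomp \<omega> n = Aw (map \<omega> [0..<n])"
  by (induction n) (auto simp: Aw_def)

lemma Aw_append: "Aw (u @ v) = Aw v ** Aw u"
  unfolding Aw_def by (simp add: fold_matrix_mult_append[of _ v "fold _ u _"])

text \<open>Stability is assumed for infinite sequences; a finite word is continued by an arbitrary
  element of I.\<close>

lemma word_as_sequence:
  assumes "ws \<in> lists I"
  obtains \<omega> where "range \<omega> \<subseteq> I" "gw ws = comp \<omega> (length ws)" "Aw ws = dcomp \<omega> (length ws)"
proof -
  obtain i0 where i0: "i0 \<in> I" using I_ne by blast
  define \<omega> where "\<omega> k = (if k < length ws then ws ! k else i0)" for k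
  have "range \<omega> \<subseteq> I" using assms i0 by (auto simp: \<omega>_def in_lists_conv_set)
  moreover have "map \<omega> [0..<length ws] = ws" by (rule nth_equalityI) (auto simp: \<omega>_def)
  ultimately show ?thesis using that[of \<omega>] by (simp add: comp_eq_gw dcomp_eq_Aw)
qed

lemma gw_bound: "ws \<in> lists I \<Longrightarrow> z \<in> ball 0 \<rho> \<Longrightarrow> norm (gw ws z) \<le> r / 2"
  using word_as_sequence[of ws] stable unfolding stays_def by metis

lemma gw_holo: "ws \<in> lists I \<Longrightarrow> holo_on (ball 0 \<rho>) (gw ws)"
  using word_as_sequence[of ws] stays_holo stable by metis

lemma gw_0: "ws \<in> lists I \<Longrightarrow> gw ws 0 = 0"
  using word_as_sequence[of ws] comp_0 by metis

lemma gw_derivative: "ws \<in> lists I \<Longrightarrow> (gw ws has_derivative (*v) (Aw ws)) (at 0)"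
  using word_as_sequence[of ws] jac_comp_0(1) by metis

definition C0 :: real where "C0 = 2 * real CARD('m) * (r / 2) / \<rho>"

lemma C0_pos: "0 < C0"
  using r_pos \<rho>_pos by (simp add: C0_def)

lemma Aw_le: "ws \<in> lists I \<Longrightarrow> opnorm (Aw ws) \<le> C0"
  using word_as_sequence[of ws] stays_dcomp_bound[OF _ stable \<rho>_pos] unfolding C0_def by metis

lemma det_Aw: "ws \<in> lists I \<Longrightarrow> cmod (det (Aw ws)) = 1"
proof (induction ws)
  case (Cons i ws)
  have "Aw (i # ws) = Aw ws ** jac (f i) 0" using Aw_append[of "[i]" ws] by (simp add: Aw_def)
  then show ?case using Cons by (simp add: det_mul norm_mult unimod)
qed (simp add: Aw_def)

definition c0 :: real where
  "c0 = (SOME c. 0 < c \<and> (\<forall>A::'m cmat. opnorm A \<le> C0 \<and> cmod (det A) = 1 \<longrightarrow> (\<forall>x. c * norm x \<le> norm (A *v x))))"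

lemma c0: "0 < c0" "\<And>ws x. ws \<in> lists I \<Longrightarrow> c0 * norm x \<le> norm (Aw ws *v x)"
proof -
  have "0 < c0 \<and> (\<forall>A::'m cmat. opnorm A \<le> C0 \<and> cmod (det A) = 1 \<longrightarrow> (\<forall>x. c0 * norm x \<le> norm (A *v x)))"
    unfolding c0_def by (rule someI_ex) (rule unimodular_lower_bound)
  then show "0 < c0" "\<And>ws x. ws \<in> lists I \<Longrightarrow> c0 * norm x \<le> norm (Aw ws *v x)"
    using Aw_le det_Aw by blast+
qed

definition Bw :: "'i list \<Rightarrow> 'm cmat" where
  "Bw ws = (SOME B. B ** Aw ws = mat 1 \<and> Aw ws ** B = mat 1 \<and> opnorm B \<le> 1 / c0)"

lemma Bw:
  assumes "ws \<in> lists I"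
  shows "Bw ws ** Aw ws = mat 1" "Aw ws ** Bw ws = mat 1" "opnorm (Bw ws) \<le> 1 / c0"
proof -
  have "\<exists>B. B ** Aw ws = mat 1 \<and> Aw ws ** B = mat 1 \<and> opnorm B \<le> 1 / c0"
    using matrix_left_inverse_bound[OF c0(1) c0(2)[OF assms]] by blast
  from someI_ex[OF this] show "Bw ws ** Aw ws = mat 1" "Aw ws ** Bw ws = mat 1" "opnorm (Bw ws) \<le> 1 / c0"
    unfolding Bw_def by blast+
qed

lemma Bw_append:
  assumes "u \<in> lists I" "v \<in> lists I"
  shows "Bw (u @ v) = Bw u ** Bw v"
proof -
  have uv: "u @ v \<in> lists I" using assms by simp
  have "(Bw u ** Bw v) ** Aw (u @ v) = Bw u ** (Bw v ** Aw v) ** Aw u"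
    by (simp add: Aw_append matrix_mul_assoc)
  also have "\<dots> = mat 1" by (simp add: Bw assms)
  finally have "(Bw u ** Bw v) ** Aw (u @ v) ** Bw (u @ v) = Bw (u @ v)" by simp
  then show ?thesis using Bw(2)[OF uv] by (simp flip: matrix_mul_assoc)
qed

lemma semigroup_unitary:
  "\<exists>P P' :: 'm cmat. P ** P' = mat 1 \<and> P' ** P = mat 1 \<and> (\<forall>ws\<in>lists I. P ** Aw ws ** P' \<in> unitary_grp)"
proof -
  have "\<exists>P P' :: 'm cmat. P ** P' = mat 1 \<and> P' ** P = mat 1 \<and> (\<forall>A\<in>Aw ` lists I. P ** A ** P' \<in> unitary_grp)"
  proof (rule bounded_semigroup_unitary[where C = C0 and c = c0 and ?A0.0 = "Aw []"])
    show "A ** B \<in> Aw ` lists I" if "A \<in> Aw ` lists I" "B \<in> Aw ` lists I" for A B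
    proof -
      from that obtain u v where uv: "u \<in> lists I" "v \<in> lists I" "A = Aw u" "B = Aw v" by (elim imageE)
      then have "v @ u \<in> lists I" by simp
      then show ?thesis unfolding uv Aw_append[symmetric] by (rule imageI)
    qed
  qed (use Aw_le c0 in auto)
  then obtain P P' :: "'m cmat" where P: "P ** P' = mat 1" "P' ** P = mat 1"
    "\<forall>A\<in>Aw ` lists I. P ** A ** P' \<in> unitary_grp" by (elim exE conjE)
  have u: "\<forall>ws\<in>lists I. P ** Aw ws ** P' \<in> unitary_grp" by (rule ballI, rule P(3)[rule_format], rule imageI)
  show ?thesis by (rule exI[of _ P], rule exI[of _ P'], intro conjI P(1,2) u)
qed

definition act :: "'i list \<Rightarrow> ('m cvec \<Rightarrow> 'm cvec) \<Rightarrow> 'm cvec \<Rightarrow> 'm cvec" where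
  "act u \<phi> z = Bw u *v \<phi> (gw u z)"

definition mid_fun :: "('m cvec \<Rightarrow> 'm cvec) \<Rightarrow> ('m cvec \<Rightarrow> 'm cvec) \<Rightarrow> 'm cvec \<Rightarrow> 'm cvec" where
  "mid_fun \<phi> \<psi> z = (1/2) *\<^sub>R (\<phi> z + \<psi> z)"

definition avgs :: "('m cvec \<Rightarrow> 'm cvec) set" where
  "avgs = midpoint_hull mid_fun ((\<lambda>w. act w id) ` lists I)"

lemma act_act:
  assumes "u \<in> lists I" "v \<in> lists I"
  shows "act u (act v \<phi>) = act (u @ v) \<phi>"
  by (rule ext) (simp add: act_def Bw_append[OF assms] matrix_vector_mul_assoc)

lemma act_mid_fun: "act u (mid_fun \<phi> \<psi>) = mid_fun (act u \<phi>) (act u \<psi>)"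
  by (rule ext) (simp add: act_def mid_fun_def matrix_vector_scaleR matrix_vector_right_distrib)

lemma act_avgs:
  assumes "u \<in> lists I" "\<phi> \<in> avgs"
  shows "act u \<phi> \<in> avgs"
  using assms(2) unfolding avgs_def
proof (induction rule: midpoint_hull.induct)
  case (base \<phi>)
  then obtain w where w: "w \<in> lists I" "\<phi> = act w id" by blast
  have uw: "u @ w \<in> lists I" using w assms(1) by simp
  show ?case unfolding w(2) act_act[OF assms(1) w(1)] by (intro midpoint_hull.base imageI uw)
next
  case (mid \<phi> \<psi>)
  show ?case unfolding act_mid_fun by (rule midpoint_hull.mid[OF mid.IH])
qed

definition C1 :: real where "C1 = r / 2 / c0"

lemma C1_pos: "0 < C1"
  using r_pos c0(1) by (simp add: C1_def)

text \<open>All averages are tangent to the identity and obey one bound. Both pass to the limit,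
  where the first guarantees local invertibility of the linearizing map.\<close>

lemma avgs_props:
  assumes "\<phi> \<in> avgs"
  shows "holo_on (ball 0 \<rho>) \<phi> \<and> \<phi> 0 = 0 \<and> jac \<phi> 0 = mat 1 \<and> (\<forall>z\<in>ball 0 \<rho>. norm (\<phi> z) \<le> C1)"
  using assms unfolding avgs_def
proof (induction rule: midpoint_hull.induct)
  case (base \<phi>)
  then obtain w where w: "w \<in> lists I" and \<phi>: "\<phi> = (\<lambda>z. Bw w *v gw w z)"
    unfolding act_def[abs_def] id_apply by blast
  have "holo_on (ball 0 \<rho>) \<phi>"
    unfolding \<phi> by (rule holo_on_compose[OF gw_holo[OF w] holo_on_matrix_vector[of UNIV]]) simp
  moreover have "\<phi> 0 = 0" by (simp add: \<phi> gw_0[OF w])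
  moreover have "jac \<phi> 0 = mat 1"
  proof -
    have "((*v) (Bw w) has_derivative (*v) (Bw w)) (at (gw w 0))"
      by (simp add: bounded_linear_imp_has_derivative)
    from jac_eqI[OF jac_compose[OF gw_derivative[OF w] this]] show ?thesis by (simp add: \<phi> Bw[OF w])
  qed
  moreover have "norm (\<phi> z) \<le> C1" if z: "z \<in> ball 0 \<rho>" for z
  proof -
    have "norm (\<phi> z) \<le> opnorm (Bw w) * norm (gw w z)" unfolding \<phi> by (rule norm_mult_le_opnorm)
    also have "\<dots> \<le> (1 / c0) * (r / 2)"
      using Bw(3)[OF w] gw_bound[OF w z] c0(1) by (intro mult_mono) auto
    finally show ?thesis by (simp add: C1_def)
  qed
  ultimately show ?case by blast
next
  case (mid \<phi> \<psi>)
  have d: "(mid_fun \<phi> \<psi> has_derivative (*v) ((1/2) *\<^sub>R (jac \<phi> z + jac \<psi> z))) (at z)" if "z \<in> ball 0 \<rho>" for z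
  proof -
    have "(\<phi> has_derivative (*v) (jac \<phi> z)) (at z)" "(\<psi> has_derivative (*v) (jac \<psi> z)) (at z)"
      using mid.IH that by (auto intro: holo_on_has_derivative)
    from has_derivative_scaleR_right[OF has_derivative_add[OF this], of "1/2"]
    show ?thesis
      by (simp add: mid_fun_def[abs_def] scaleR_matrix_vector[abs_def] matrix_vector_mult_add_rdistrib[abs_def])
  qed
  have "holo_on (ball 0 \<rho>) (mid_fun \<phi> \<psi>)" by (rule holo_onI) (rule d)
  moreover have "mid_fun \<phi> \<psi> 0 = 0" using mid.IH by (simp add: mid_fun_def)
  moreover have "jac (mid_fun \<phi> \<psi>) 0 = (1/2) *\<^sub>R (mat 1 + mat 1)"
    using jac_eqI[OF d[of 0]] mid.IH \<rho>_pos by simp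
  then have "jac (mid_fun \<phi> \<psi>) 0 = mat 1" by (simp flip: scaleR_2)
  moreover have "norm (mid_fun \<phi> \<psi> z) \<le> C1" if "z \<in> ball 0 \<rho>" for z
  proof -
    have "norm (\<phi> z) \<le> C1" "norm (\<psi> z) \<le> C1" using mid.IH that by auto
    then show ?thesis using norm_triangle_ineq[of "\<phi> z" "\<psi> z"] by (simp add: mid_fun_def)
  qed
  ultimately show ?case by blast
qed

definition \<zeta> :: "nat \<Rightarrow> 'm cvec" where
  "\<zeta> = (SOME z. range z \<subseteq> ball 0 (\<rho> / 2) \<and> ball 0 (\<rho> / 2) \<subseteq> closure (range z))"

lemma \<zeta>: "\<zeta> j \<in> ball 0 (\<rho> / 2)" "ball 0 (\<rho> / 2) \<subseteq> closure (range \<zeta>)"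
proof -
  obtain T where T: "countable T" "T \<subseteq> ball (0::'m cvec) (\<rho> / 2)" "ball 0 (\<rho> / 2) \<subseteq> closure T"
    using separable by metis
  have "T \<noteq> {}" using T(3) \<rho>_pos by (auto simp: subset_empty)
  then have "range (from_nat_into T) = T" using T(1) by (rule range_from_nat_into)
  then have "\<exists>z::nat \<Rightarrow> 'm cvec. range z \<subseteq> ball 0 (\<rho> / 2) \<and> ball 0 (\<rho> / 2) \<subseteq> closure (range z)"
    using T(2,3) by metis
  from someI_ex[OF this] show "\<zeta> j \<in> ball 0 (\<rho> / 2)" "ball 0 (\<rho> / 2) \<subseteq> closure (range \<zeta>)"
    unfolding \<zeta>_def by blast+
qed

lemma \<zeta>_in: "\<zeta> j \<in> ball 0 \<rho>"
  using \<zeta>(1)[of j] \<rho>_pos by auto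

text \<open>A weighted sum over a countable dense set plays the role of an \<open>L\<^sup>2\<close> norm.\<close>

definition Nsq :: "'i list \<Rightarrow> ('m cvec \<Rightarrow> 'm cvec) \<Rightarrow> real" where
  "Nsq u \<phi> = (\<Sum>j. (1/2)^j * (norm (act u \<phi> (\<zeta> j)))\<^sup>2)"

definition Dsq :: "'i list \<Rightarrow> ('m cvec \<Rightarrow> 'm cvec) \<Rightarrow> ('m cvec \<Rightarrow> 'm cvec) \<Rightarrow> real" where
  "Dsq u \<phi> \<psi> = (\<Sum>j. (1/2)^j * (norm (act u \<phi> (\<zeta> j) - act u \<psi> (\<zeta> j)))\<^sup>2)"

lemma weighted_summable:
  assumes "\<And>j. norm (a j :: 'm cvec) \<le> b"
  shows "summable (\<lambda>j. (1/2)^j * (norm (a j))\<^sup>2)" "(\<Sum>j. (1/2)^j * (norm (a j))\<^sup>2) \<le> 2 * b\<^sup>2"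
proof -
  have s: "(\<lambda>j. (1/2)^j * b\<^sup>2) sums (2 * b\<^sup>2)"
    using sums_mult2[OF geometric_sums[of "1/2::real"], of "b\<^sup>2"] by simp
  have le: "(1/2)^j * (norm (a j))\<^sup>2 \<le> (1/2)^j * b\<^sup>2" for j
    using assms[of j] by (intro mult_left_mono power_mono) auto
  show sm: "summable (\<lambda>j. (1/2)^j * (norm (a j))\<^sup>2)"
    by (rule summable_comparison_test'[OF sums_summable[OF s], of 0]) (simp add: le)
  show "(\<Sum>j. (1/2)^j * (norm (a j))\<^sup>2) \<le> 2 * b\<^sup>2"
    using suminf_le[OF le sm sums_summable[OF s]] sums_unique[OF s] by simp
qed

lemma act_bound: "u \<in> lists I \<Longrightarrow> \<phi> \<in> avgs \<Longrightarrow> z \<in> ball 0 \<rho> \<Longrightarrow> norm (act u \<phi> z) \<le> C1"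
  using avgs_props[OF act_avgs] by blast

lemma Nsq_sums: "u \<in> lists I \<Longrightarrow> \<phi> \<in> avgs \<Longrightarrow> (\<lambda>j. (1/2)^j * (norm (act u \<phi> (\<zeta> j)))\<^sup>2) sums Nsq u \<phi>"
  unfolding Nsq_def by (rule summable_sums[OF weighted_summable(1)[OF act_bound[OF _ _ \<zeta>_in]]])

lemma Dsq_sums:
  assumes "u \<in> lists I" "\<phi> \<in> avgs" "\<psi> \<in> avgs"
  shows "(\<lambda>j. (1/2)^j * (norm (act u \<phi> (\<zeta> j) - act u \<psi> (\<zeta> j)))\<^sup>2) sums Dsq u \<phi> \<psi>"
  unfolding Dsq_def
proof (rule summable_sums[OF weighted_summable(1)])
  show "norm (act u \<phi> (\<zeta> j) - act u \<psi> (\<zeta> j)) \<le> C1 + C1" for j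
    using norm_triangle_ineq4 act_bound[OF assms(1,2) \<zeta>_in[of j]] act_bound[OF assms(1,3) \<zeta>_in[of j]]
    by (meson add_mono order_trans)
qed

lemma Nsq_mid_fun:
  assumes "u \<in> lists I" "\<phi> \<in> avgs" "\<psi> \<in> avgs"
  shows "Nsq u (mid_fun \<phi> \<psi>) = (Nsq u \<phi> + Nsq u \<psi>) / 2 - Dsq u \<phi> \<psi> / 4"
proof -
  have "(\<lambda>j. ((1/2)^j * (norm (act u \<phi> (\<zeta> j)))\<^sup>2 + (1/2)^j * (norm (act u \<psi> (\<zeta> j)))\<^sup>2) / 2
     - (1/2)^j * (norm (act u \<phi> (\<zeta> j) - act u \<psi> (\<zeta> j)))\<^sup>2 / 4) sums ((Nsq u \<phi> + Nsq u \<psi>) / 2 - Dsq u \<phi> \<psi> / 4)"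
    by (intro sums_diff sums_divide sums_add Nsq_sums Dsq_sums assms)
  moreover have "((1/2)^j * (norm (act u \<phi> (\<zeta> j)))\<^sup>2 + (1/2)^j * (norm (act u \<psi> (\<zeta> j)))\<^sup>2) / 2
     - (1/2)^j * (norm (act u \<phi> (\<zeta> j) - act u \<psi> (\<zeta> j)))\<^sup>2 / 4
     = (1/2)^j * (norm (act u (mid_fun \<phi> \<psi>) (\<zeta> j)))\<^sup>2" for j
    unfolding act_mid_fun mid_fun_def parallelogram_midpoint by (simp add: algebra_simps)
  ultimately show ?thesis unfolding Nsq_def[of u "mid_fun \<phi> \<psi>"] by (simp add: sums_iff)
qed

text \<open>A ball covered by the images of the half ball under all words, from the open mapping
  property. Near minimisers are compared only after composition with an uncontrolled word, and the
  covering undoes that composition.\<close>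

definition \<rho>' :: real where
  "\<rho>' = (SOME p. 0 < p \<and> p \<le> \<rho> \<and> (\<forall>u\<in>lists I. ball 0 p \<subseteq> gw u ` ball 0 (\<rho> / 2)))"

lemma \<rho>': "0 < \<rho>'" "\<rho>' \<le> \<rho>" "\<And>u. u \<in> lists I \<Longrightarrow> ball 0 \<rho>' \<subseteq> gw u ` ball 0 (\<rho> / 2)"
proof -
  have p: "0 < r / 2" "0 < \<rho> / 2" using r_pos \<rho>_pos by auto
  obtain p where p: "0 < p" "\<And>g :: 'm cvec \<Rightarrow> 'm cvec. holo_on (ball 0 \<rho>) g \<and> g 0 = 0 \<and>
    (\<forall>w\<in>ball 0 \<rho>. norm (g w) \<le> r / 2) \<and> (\<forall>x. c0 * norm x \<le> norm (jac g 0 *v x)) \<Longrightarrow> ball 0 p \<subseteq> g ` ball 0 (\<rho> / 2)"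
    using holo_on_open_mapping[OF \<rho>_pos p(1) c0(1) p(2)] by metis
  have "ball 0 (min p \<rho>) \<subseteq> gw u ` ball 0 (\<rho> / 2)" if u: "u \<in> lists I" for u
  proof -
    have "ball 0 p \<subseteq> gw u ` ball 0 (\<rho> / 2)"
      using gw_holo[OF u] gw_0[OF u] gw_bound[OF u] c0(2)[OF u] jac_eqI[OF gw_derivative[OF u]]
      by (intro p(2)) auto
    then show ?thesis by auto
  qed
  then have "\<exists>p. 0 < p \<and> p \<le> \<rho> \<and> (\<forall>u\<in>lists I. ball 0 p \<subseteq> gw u ` ball 0 (\<rho> / 2))"
    using p(1) \<rho>_pos by (intro exI[of _ "min p \<rho>"]) auto
  from someI_ex[OF this] show "0 < \<rho>'" "\<rho>' \<le> \<rho>" "\<And>u. u \<in> lists I \<Longrightarrow> ball 0 \<rho>' \<subseteq> gw u ` ball 0 (\<rho> / 2)"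
    unfolding \<rho>'_def by blast+
qed

text \<open>Finitely many points of \<zeta> and a common Lipschitz constant turn a small weighted
  sum into a small difference on the half ball after the action of u. Each z of the smaller ball is
  \<open>gw u y\<close> with y in the half ball, and \<open>Aw u\<close> cancels the factor
  \<open>Bw u\<close>.\<close>

lemma Dsq_small:
  assumes e: "0 < e"
  shows "\<exists>d>0. \<forall>u\<in>lists I. \<forall>\<phi>\<in>avgs. \<forall>\<psi>\<in>avgs. Dsq u \<phi> \<psi> \<le> d \<longrightarrow> (\<forall>z\<in>ball 0 \<rho>'. norm (\<phi> z - \<psi> z) \<le> e)"
proof -
  define L where "L = 2 * real CARD('m) * C1 / (\<rho> - \<rho> / 2)"
  have L: "0 < L" using C1_pos \<rho>_pos by (simp add: L_def)
  \<comment> \<open>Two Lipschitz errors L t and the value e / (2 C0) at a net point add up to e /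
    C0; \<open>Aw u\<close>, of norm at most C0, enlarges this to e.\<close>
  define t where "t = e / (4 * L * C0)"
  have t: "0 < t" using e L C0_pos by (simp add: t_def)
  have "cball 0 (\<rho> / 2) \<subseteq> closure (range \<zeta>)"
    using closure_mono[OF \<zeta>(2)] \<rho>_pos by (simp add: closure_ball)
  then have "cball 0 (\<rho> / 2) \<subseteq> (\<Union>j. ball (\<zeta> j) t)"
    using t by (force simp: closure_approachable)
  then obtain J where J: "finite J" "cball 0 (\<rho> / 2) \<subseteq> (\<Union>j\<in>J. ball (\<zeta> j) t)"
    using compactE_image[OF compact_cball, of UNIV "\<lambda>j. ball (\<zeta> j) t" 0 "\<rho> / 2"] by auto
  \<comment> \<open>The net involves finitely many indices, so their weights are at least
    (1/2)^n.\<close>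
  define n where "n = Max (insert 0 J)"
  define d where "d = (1/2)^n * (e / (2 * C0))\<^sup>2"
  have d: "0 < d" using e C0_pos by (simp add: d_def)
  have "norm (\<phi> z - \<psi> z) \<le> e"
    if u: "u \<in> lists I" and \<phi>: "\<phi> \<in> avgs" and \<psi>: "\<psi> \<in> avgs" and D: "Dsq u \<phi> \<psi> \<le> d" and z: "z \<in> ball 0 \<rho>'" for u \<phi> \<psi> z
  proof -
    obtain y where y: "y \<in> ball 0 (\<rho> / 2)" "z = gw u y" using \<rho>'(3)[OF u] z by blast
    have "y \<in> cball 0 (\<rho> / 2)" using y(1) by simp
    then obtain j where j: "j \<in> J" "dist (\<zeta> j) y < t" using J(2) by (force simp: subset_iff)
    have jn: "j \<le> n" using J(1) j(1) by (simp add: n_def)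
    let ?h = "\<lambda>z. act u \<phi> z - act u \<psi> z"
    have "(1/2)^j * (norm (?h (\<zeta> j)))\<^sup>2 = (\<Sum>k\<in>{j}. (1/2)^k * (norm (?h (\<zeta> k)))\<^sup>2)" by simp
    also have "\<dots> \<le> Dsq u \<phi> \<psi>"
      unfolding Dsq_def by (intro sum_le_suminf sums_summable[OF Dsq_sums[OF u \<phi> \<psi>]]) auto
    also have "\<dots> \<le> (1/2)^n * (e / (2 * C0))\<^sup>2" using D by (simp add: d_def)
    also have "\<dots> \<le> (1/2)^j * (e / (2 * C0))\<^sup>2"
      using jn by (intro mult_right_mono power_decreasing) auto
    finally have "(norm (?h (\<zeta> j)))\<^sup>2 \<le> (e / (2 * C0))\<^sup>2" by (rule mult_left_le_imp_le) simp
    then have 1: "norm (?h (\<zeta> j)) \<le> e / (2 * C0)" by (rule power2_le_imp_le) (use e C0_pos in simp)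
    have lip: "norm (act u \<theta> y - act u \<theta> (\<zeta> j)) \<le> L * t" if "\<theta> \<in> avgs" for \<theta>
    proof -
      have "norm (act u \<theta> y - act u \<theta> (\<zeta> j)) \<le> L * norm (y - \<zeta> j)"
        unfolding L_def
        by (rule holo_on_lipschitz[where s = \<rho>])
          (use avgs_props[OF act_avgs[OF u that]] \<rho>_pos y(1) \<zeta>(1)[of j] in simp_all)
      also have "\<dots> \<le> L * t" using j(2) L by (intro mult_left_mono) (auto simp: dist_norm norm_minus_commute)
      finally show ?thesis .
    qed
    have "norm (?h y) \<le> norm (act u \<phi> y - act u \<phi> (\<zeta> j)) + norm (?h (\<zeta> j)) + norm (act u \<psi> y - act u \<psi> (\<zeta> j))"
    proof -
      have tri: "norm (a + b - c) \<le> norm a + norm b + norm c" for a b c :: "'m cvec"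
        using norm_triangle_ineq4[of "a + b" c] norm_triangle_ineq[of a b] by linarith
      have "?h y = (act u \<phi> y - act u \<phi> (\<zeta> j)) + ?h (\<zeta> j) - (act u \<psi> y - act u \<psi> (\<zeta> j))" by simp
      then show ?thesis using tri by metis
    qed
    also have "\<dots> \<le> L * t + e / (2 * C0) + L * t" using lip[OF \<phi>] lip[OF \<psi>] 1 by (intro add_mono)
    also have "\<dots> = e / C0" using L C0_pos by (simp add: t_def field_simps)
    finally have h: "norm (?h y) \<le> e / C0" .
    have "\<phi> z - \<psi> z = Aw u *v ?h y"
      using Bw(2)[OF u] by (simp add: act_def y(2) matrix_vector_mult_diff_distrib matrix_vector_mul_assoc)
    then have "norm (\<phi> z - \<psi> z) \<le> opnorm (Aw u) * norm (?h y)" using norm_mult_le_opnorm by metis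
    also have "\<dots> \<le> C0 * (e / C0)" using Aw_le[OF u] h C0_pos by (intro mult_mono) auto
    finally show ?thesis using C0_pos by simp
  qed
  then show ?thesis using d by blast
qed

text \<open>A minimising sequence is uniformly Cauchy on the covered ball. Its image under the
  action of a letter minimises as well, hence has the same limit there, and equality of the limits
  is the linearizing equation.\<close>

lemma linearizing_map:
  "\<exists>\<phi>. holo_on (ball 0 \<rho>') \<phi> \<and> \<phi> 0 = 0 \<and> jac \<phi> 0 = mat 1 \<and> (\<forall>z\<in>ball 0 \<rho>'. norm (\<phi> z) \<le> C1) \<and>
    (\<forall>i\<in>I. \<forall>\<^sub>F z in nhds 0. \<phi> (f i z) = jac (f i) 0 *v \<phi> z)"
proof -
  have nil: "[] \<in> lists I" by simp
  have idh: "act [] id \<in> avgs" unfolding avgs_def by (intro midpoint_hull.base imageI nil)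
  have "\<exists>m. (\<forall>e>0. \<exists>x\<in>avgs. \<forall>g\<in>lists I. Nsq g x \<le> m + e) \<and>
    (\<forall>e>0. \<forall>x\<in>avgs. \<forall>y\<in>avgs. (\<forall>g\<in>lists I. Nsq g x \<le> m + e) \<and> (\<forall>g\<in>lists I. Nsq g y \<le> m + e) \<longrightarrow> (\<exists>g\<in>lists I. Dsq g x y \<le> 8 * e))"
  proof (rule midpoint_minimizing[where mid = mid_fun and ?b0.0 = "2 * C1\<^sup>2", OF idh _ nil])
    show "Nsq u (act [] id) \<le> 2 * C1\<^sup>2" if "u \<in> lists I" for u
      unfolding Nsq_def by (rule weighted_summable(2)[OF act_bound[OF that idh \<zeta>_in]])
    show "mid_fun \<phi> \<psi> \<in> avgs" if "\<phi> \<in> avgs" "\<psi> \<in> avgs" for \<phi> \<psi>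
      using that unfolding avgs_def by (rule midpoint_hull.mid)
    show "0 \<le> Nsq u \<phi>" if "u \<in> lists I" "\<phi> \<in> avgs" for u \<phi>
      unfolding Nsq_def by (intro suminf_nonneg sums_summable[OF Nsq_sums[OF that]]) auto
  qed (rule Nsq_mid_fun)
  then obtain m where m1: "\<forall>e>0. \<exists>x\<in>avgs. \<forall>g\<in>lists I. Nsq g x \<le> m + e"
    and m2: "\<forall>e>0. \<forall>x\<in>avgs. \<forall>y\<in>avgs. (\<forall>g\<in>lists I. Nsq g x \<le> m + e) \<and> (\<forall>g\<in>lists I. Nsq g y \<le> m + e)
      \<longrightarrow> (\<exists>g\<in>lists I. Dsq g x y \<le> 8 * e)"
    by (elim exE conjE)
  have pos: "0 < 1 / real (Suc k)" for k by simp
  have "\<exists>x. x \<in> avgs \<and> (\<forall>g\<in>lists I. Nsq g x \<le> m + 1 / real (Suc k))" for k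
    using m1[rule_format, OF pos[of k]] by blast
  then obtain x where x: "\<And>k. x k \<in> avgs" "\<And>k. \<forall>g\<in>lists I. Nsq g (x k) \<le> m + 1 / real (Suc k)" by metis
  have near: "\<exists>K. \<forall>k\<ge>K. \<forall>y\<in>avgs. (\<forall>g\<in>lists I. Nsq g y \<le> m + 1 / real (Suc K)) \<longrightarrow>
     (\<forall>z\<in>ball 0 \<rho>'. norm (x k z - y z) \<le> e)" if e: "0 < e" for e
  proof -
    obtain d where d: "0 < d" "\<forall>u\<in>lists I. \<forall>\<phi>\<in>avgs. \<forall>\<psi>\<in>avgs. Dsq u \<phi> \<psi> \<le> d \<longrightarrow> (\<forall>z\<in>ball 0 \<rho>'. norm (\<phi> z - \<psi> z) \<le> e)"
      using Dsq_small[OF e] by blast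
    have "0 < d / 8" using d(1) by simp
    then obtain K where K: "1 / real (Suc K) < d / 8" by (rule nat_approx_posE)
    have "\<forall>z\<in>ball 0 \<rho>'. norm (x k z - y z) \<le> e"
      if k: "k \<ge> K" and y: "y \<in> avgs" "\<forall>g\<in>lists I. Nsq g y \<le> m + 1 / real (Suc K)" for k y
    proof -
      have "1 / real (Suc k) \<le> 1 / real (Suc K)" using k by (simp add: frac_le)
      then have xk: "\<forall>g\<in>lists I. Nsq g (x k) \<le> m + 1 / real (Suc K)"
        using x(2)[of k] by (meson add_left_mono order_trans)
      obtain g where g: "g \<in> lists I" "Dsq g (x k) y \<le> 8 * (1 / real (Suc K))"
        using m2[rule_format, OF pos[of K] x(1)[of k] y(1)] xk y(2) by blast
      have "Dsq g (x k) y \<le> d" using g(2) K by linarith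
      then show ?thesis using d(2) g(1) x(1) y(1) by blast
    qed
    then show ?thesis by blast
  qed
  have Nmono: "\<forall>g\<in>lists I. Nsq g (x l) \<le> m + 1 / real (Suc K)" if "l \<ge> K" for l K
  proof -
    have "1 / real (Suc l) \<le> 1 / real (Suc K)" using that by (simp add: frac_le)
    then show ?thesis using x(2)[of l] by (meson add_left_mono order_trans)
  qed
  have "uniformly_Cauchy_on (ball 0 \<rho>') x"
    unfolding uniformly_Cauchy_on_def
  proof (intro allI impI)
    fix e :: real assume e: "0 < e"
    then obtain K where K: "\<forall>k\<ge>K. \<forall>y\<in>avgs. (\<forall>g\<in>lists I. Nsq g y \<le> m + 1 / real (Suc K)) \<longrightarrow>
       (\<forall>z\<in>ball 0 \<rho>'. norm (x k z - y z) \<le> e / 2)" using near[of "e / 2"] by auto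
    have "dist (x k z) (x l z) < e" if "z \<in> ball 0 \<rho>'" "k \<ge> K" "l \<ge> K" for z k l
    proof -
      have "norm (x k z - x l z) \<le> e / 2" using K x(1)[of l] Nmono[OF that(3)] that by blast
      then show ?thesis using e by (simp add: dist_norm)
    qed
    then show "\<exists>M. \<forall>z\<in>ball 0 \<rho>'. \<forall>m\<ge>M. \<forall>n\<ge>M. dist (x m z) (x n z) < e" by blast
  qed
  then obtain \<phi> where ul: "uniform_limit (ball 0 \<rho>') x \<phi> sequentially"
    using Cauchy_uniformly_convergent unfolding uniformly_convergent_on_def by blast
  have sub: "ball 0 \<rho>' \<subseteq> ball (0::'m cvec) \<rho>" using \<rho>'(2) by auto
  have hx: "holo_on (ball 0 \<rho>') (x k)" for k using avgs_props[OF x(1)[of k]] holo_on_subset[OF _ sub] by blast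
  have lim: "(\<lambda>k. x k z) \<longlonglongrightarrow> \<phi> z" if "z \<in> ball 0 \<rho>'" for z by (rule tendsto_uniform_limitI[OF ul that])
  have z0: "(0::'m cvec) \<in> ball 0 \<rho>'" using \<rho>'(1) by simp
  have "holo_on (ball 0 \<rho>') \<phi>" by (rule holo_on_uniform_limit(1)[OF hx ul])
  moreover have "\<phi> 0 = 0"
  proof -
    have "(\<lambda>k. x k 0) = (\<lambda>k. 0)" using avgs_props[OF x(1)] by auto
    then show ?thesis using lim[OF z0] LIMSEQ_const_iff by metis
  qed
  moreover have "jac \<phi> 0 = mat 1"
  proof -
    have "(\<lambda>k. jac (x k) 0) = (\<lambda>k. mat 1)" using avgs_props[OF x(1)] by auto
    then show ?thesis using holo_on_uniform_limit(2)[OF hx ul z0] LIMSEQ_const_iff by metis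
  qed
  moreover have "norm (\<phi> z) \<le> C1" if z: "z \<in> ball 0 \<rho>'" for z
  proof (rule Lim_bounded[OF tendsto_norm[OF lim[OF z]]])
    show "\<forall>k\<ge>0. norm (x k z) \<le> C1" using avgs_props[OF x(1)] z sub by blast
  qed
  moreover have "\<forall>\<^sub>F z in nhds 0. \<phi> (f i z) = jac (f i) 0 *v \<phi> z" if i: "i \<in> I" for i
  proof -
    have w: "[i] \<in> lists I" using i by simp
    have Ai: "Aw [i] = jac (f i) 0" by (simp add: Aw_def)
    have eq: "\<phi> (f i z) = jac (f i) 0 *v \<phi> z" if z: "z \<in> ball 0 \<rho>'" "f i z \<in> ball 0 \<rho>'" for z
    proof -
      have y: "act [i] (x k) \<in> avgs" for k by (rule act_avgs[OF w x(1)])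
      have yN: "\<forall>g\<in>lists I. Nsq g (act [i] (x k)) \<le> m + 1 / real (Suc K)" if "k \<ge> K" for k K
      proof
        fix g assume g: "g \<in> lists I"
        \<comment> \<open>Acting by a letter only lengthens the test word g to g @ [i], which is
          again a word over I.\<close>
        have "Nsq g (act [i] (x k)) = Nsq (g @ [i]) (x k)" unfolding Nsq_def act_act[OF g w] ..
        moreover have "g @ [i] \<in> lists I" using g w by simp
        ultimately show "Nsq g (act [i] (x k)) \<le> m + 1 / real (Suc K)" using Nmono[OF that] by simp
      qed
      have 0: "(\<lambda>k. x k z - act [i] (x k) z) \<longlonglongrightarrow> 0"
      proof (rule LIMSEQ_I)
        fix e :: real assume e: "0 < e"
        then obtain K where K: "\<forall>k\<ge>K. \<forall>y\<in>avgs. (\<forall>g\<in>lists I. Nsq g y \<le> m + 1 / real (Suc K)) \<longrightarrow>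
          (\<forall>z\<in>ball 0 \<rho>'. norm (x k z - y z) \<le> e / 2)" using near[of "e / 2"] by auto
        have "norm (x k z - act [i] (x k) z - 0) < e" if "k \<ge> K" for k
        proof -
          have "norm (x k z - act [i] (x k) z) \<le> e / 2" using K that y[of k] yN[OF that] z(1) by blast
          then show ?thesis using e by simp
        qed
        then show "\<exists>K. \<forall>k\<ge>K. norm (x k z - act [i] (x k) z - 0) < e" by blast
      qed
      have "(\<lambda>k. x k z - act [i] (x k) z) \<longlonglongrightarrow> \<phi> z - Bw [i] *v \<phi> (f i z)"
        unfolding act_def by (simp, intro tendsto_intros lim z)
      from LIMSEQ_unique[OF this 0] have "\<phi> z = Bw [i] *v \<phi> (f i z)" by simp
      then have "Aw [i] *v \<phi> z = (Aw [i] ** Bw [i]) *v \<phi> (f i z)" by (simp add: matrix_vector_mul_assoc)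
      then show ?thesis unfolding Bw(2)[OF w] by (simp add: Ai)
    qed
    have "isCont (f i) 0" using r_pos by (intro has_derivative_continuous[OF holo_on_has_derivative[OF hol[OF i]]]) simp
    then have "filterlim (f i) (nhds 0) (nhds 0)"
      using zero[OF i] tendsto_at_iff_tendsto_nhds[of "f i" 0] by (simp add: isCont_def)
    then have "\<forall>\<^sub>F z in nhds 0. f i z \<in> ball 0 \<rho>'" by (rule topological_tendstoD[OF _ open_ball z0])
    moreover have "\<forall>\<^sub>F z in nhds (0::'m cvec). z \<in> ball 0 \<rho>'" by (rule eventually_nhds_in_open[OF open_ball z0])
    ultimately show ?thesis by eventually_elim (rule eq)
  qed
  ultimately show ?thesis by blast
qed

end

section \<open>Random germs\<close>

lemma mprod_cong: "(\<And>i. i < n \<Longrightarrow> A i = B i) \<Longrightarrow> mprod A n = mprod B n"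
  by (induction n) auto

lemma cmod_det_mprod: "cmod (det (mprod A n)) = (\<Prod>i<n. cmod (det (A i)))"
  by (induction n) (auto simp: det_mul norm_mult mult.commute)

lemma opnorm_mprod_le:
  assumes "\<And>i. opnorm (A i) \<le> b"
  shows "opnorm (mprod A n :: 'm::finite cmat) \<le> b ^ n"
proof (induction n)
  case 0
  have "onorm (\<lambda>x::'m cvec. x) \<le> 1" by (rule onorm_bound) auto
  then show ?case by simp
next
  case (Suc n)
  have "opnorm (mprod A (Suc n)) \<le> opnorm (A n) * opnorm (mprod A n)" by (simp add: opnorm_mult_le)
  also have "\<dots> \<le> b * b ^ n"
    using Suc assms[of n] order_trans[OF opnorm_nonneg assms[of n]] by (intro mult_mono) (auto simp: opnorm_nonneg)
  finally show ?case by simp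
qed

lemma mprod_measurable:
  assumes "\<And>i. (\<lambda>x. A x i) \<in> borel_measurable M"
  shows "(\<lambda>x. mprod (A x) n :: 'm::finite cmat) \<in> borel_measurable M"
proof (induction n)
  case (Suc n)
  have "continuous_on UNIV (\<lambda>p :: 'm cmat \<times> 'm cmat. fst p ** snd p)" by (intro continuous_intros)
  from borel_measurable_continuous_Pair[OF assms Suc this] show ?case by simp
qed simp

text \<open>Since |det| = 1 bounds the inverse differentials, all iterates of the ball of radius v
  cover one ball of radius p. A point of it is \<open>comp \<omega> n y\<close>, and its orbit under
  the shifted sequence is a tail of the orbit of y.\<close>

lemma (in bdd_family) stays_shift:
  assumes \<omega>: "range \<omega> \<subseteq> I" and v: "stays v \<omega>" "0 < v"
    and unimod: "\<And>i. i \<in> I \<Longrightarrow> cmod (det (jac (f i) 0)) = 1"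
  shows "\<exists>p>0. \<forall>n. stays p (shift n \<omega>)"
proof -
  define C where "C = 2 * real CARD('m) * (r / 2) / v"
  obtain c where c: "0 < c" "\<And>A::'m cmat. opnorm A \<le> C \<Longrightarrow> cmod (det A) = 1 \<Longrightarrow> (\<forall>x. c * norm x \<le> norm (A *v x))"
    using unimodular_lower_bound[of C] by blast
  have r2: "0 < r / 2" using r_pos by simp
  obtain p where p: "0 < p" "\<And>g :: 'm cvec \<Rightarrow> 'm cvec. holo_on (ball 0 v) g \<and> g 0 = 0 \<and>
    (\<forall>w\<in>ball 0 v. norm (g w) \<le> r / 2) \<and> (\<forall>x. c * norm x \<le> norm (jac g 0 *v x)) \<Longrightarrow> ball 0 p \<subseteq> g ` ball 0 v"
    using holo_on_open_mapping[OF v(2) r2 c(1) v(2)] by metis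
  have "stays p (shift n \<omega>)" for n
    unfolding stays_def
  proof (intro allI ballI)
    fix k z assume z: "z \<in> ball (0::'m cvec) p"
    have "cmod (det (dcomp \<omega> n)) = 1"
      unfolding cmod_det_mprod using \<omega> by (intro prod.neutral) (auto intro: unimod)
    then have "\<forall>x. c * norm x \<le> norm (dcomp \<omega> n *v x)"
      using c(2) stays_dcomp_bound[OF \<omega> v, of n] by (simp add: C_def)
    then have "ball 0 p \<subseteq> comp \<omega> n ` ball 0 v"
      using stays_holo[OF \<omega> v(1)] comp_0[OF \<omega>] v(1) jac_comp_0(2)[OF \<omega>]
      by (intro p(2)) (auto simp: stays_def)
    then obtain y where y: "y \<in> ball 0 v" "z = comp \<omega> n y" using z by blast
    have "comp (shift n \<omega>) k z = comp \<omega> (k + n) y"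
      unfolding y(2) compo_add by simp
    then show "norm (comp (shift n \<omega>) k z) \<le> r / 2" using v(1) y(1) by (simp add: stays_def)
  qed
  then show ?thesis using p(1) by blast
qed

lemma norm_unitary:
  assumes "U \<in> unitary_grp"
  shows "norm (U *v x) = norm x"
proof -
  have "(norm (U *v x))\<^sup>2 = inner x ((adjointC U ** U) *v x)"
    by (simp add: power2_norm_eq_inner inner_adjointC matrix_vector_mul_assoc)
  also have "\<dots> = (norm x)\<^sup>2" using assms by (simp add: unitary_grp_def power2_norm_eq_inner)
  finally show ?thesis by simp
qed

lemma tendsto_powr_zeroD:
  fixes h :: "nat \<Rightarrow> real"
  assumes "(\<lambda>K. h K powr s) \<longlonglongrightarrow> 0" "\<And>K. 0 \<le> h K" "0 < s"
  shows "h \<longlonglongrightarrow> 0"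
proof -
  have "(\<lambda>K. (h K powr s) powr (1 / s)) \<longlonglongrightarrow> 0"
    by (rule tendsto_zero_powrI[OF assms(1) tendsto_const]) (use assms(3) in auto)
  then show ?thesis using assms by (simp add: powr_powr)
qed

section \<open>The random setting and its uniformly bounded representatives\<close>

locale germ_measure = radius_seq eps for eps :: "nat \<Rightarrow> real" +
  fixes \<nu> :: "('m::finite cvec \<Rightarrow> 'm cvec) set measure"
  assumes prob: "prob_space \<nu>"
    and borel: "sets \<nu> = sets (borel_of (germ_topology eps))"
    and cpt: "compactin (germ_topology eps) (supp_of (germ_topology eps) \<nu>)"
begin

abbreviation supp :: "('m cvec \<Rightarrow> 'm cvec) set set" where
  "supp \<equiv> supp_of (germ_topology eps) \<nu>"

definition lvl :: nat where
  "lvl = (SOME n. supp \<subseteq> germ_of ` bdd_fun n)"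

lemma supp_bdd: "supp \<subseteq> germ_of ` bdd_fun lvl"
  unfolding lvl_def by (rule someI_ex) (rule compact_germs_bdd[OF cpt])

definition fr :: "('m cvec \<Rightarrow> 'm cvec) set \<Rightarrow> 'm cvec \<Rightarrow> 'm cvec" where
  "fr = bdd_rep lvl"

abbreviation rr :: real where "rr \<equiv> eps lvl"

lemma fr:
  assumes "F \<in> supp"
  shows "fr F \<in> bdd_fun lvl" "germ_of (fr F) = F" "fr F \<in> F"
proof -
  have F: "F \<in> germ_of ` bdd_fun lvl" using supp_bdd assms by blast
  show "fr F \<in> bdd_fun lvl" "germ_of (fr F) = F" using bdd_rep[OF F] by (simp_all add: fr_def)
  then show "fr F \<in> F" using mem_germ_of[of "fr F" "fr F"] by simp
qed

text \<open>The added 1 keeps the bound positive also when \<open>lvl = 0\<close>.\<close>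

sublocale Fam: bdd_family supp fr rr "real lvl + 1"
proof
  show "0 < rr" by (rule eps_pos)
  fix F assume F: "F \<in> supp"
  show "holo_on (ball 0 rr) (fr F)" "fr F 0 = 0" using fr(1)[OF F] by (auto simp: bdd_fun_def Xsp_def)
  show "norm (fr F z) \<le> real lvl + 1" if "z \<in> ball 0 rr" for z
    using fr(1)[OF F] that unfolding bdd_fun_def by fastforce
qed simp

sublocale M: prob_space \<nu> by (rule prob)

sublocale Q: sequence_space \<nu> by unfold_locales

abbreviation \<Omega> :: "(nat \<Rightarrow> ('m cvec \<Rightarrow> 'm cvec) set) measure" where
  "\<Omega> \<equiv> PiM UNIV (\<lambda>_. \<nu>)"

abbreviation dprod :: "(nat \<Rightarrow> ('m cvec \<Rightarrow> 'm cvec) set) \<Rightarrow> nat \<Rightarrow> 'm cmat" where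
  "dprod \<omega> \<equiv> mprod (\<lambda>i. d0 (\<omega> i))"

lemma AE_supp: "AE \<omega> in \<Omega>. range \<omega> \<subseteq> supp"
proof -
  have "AE \<omega> in \<Omega>. \<forall>i. \<omega> i \<in> supp" by (rule Q.AE_all_coordinates[OF supp_of_germs_AE[OF borel]])
  then show ?thesis by eventually_elim blast
qed

lemma supp_ne: "supp \<noteq> {}"
proof
  assume "supp = {}"
  then have "AE F in \<nu>. False" using supp_of_germs_AE[OF borel] by simp
  then show False by simp
qed

lemma d0_measurable [measurable]: "d0 \<in> borel_measurable \<nu>"
proof (rule borel_measurableI)
  fix B :: "'m cmat set" assume "open B"
  then have "{F\<in>Germs. d0 F \<in> B} \<in> sets \<nu>"
    by (intro borel_of_germs(2)[OF borel] openin_germ_d0_vimage)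
  moreover have "d0 -` B \<inter> space \<nu> = {F\<in>Germs. d0 F \<in> B}" by (auto simp: borel_of_germs(1)[OF borel])
  ultimately show "d0 -` B \<inter> space \<nu> \<in> sets \<nu>" by simp
qed

lemma d0_fr: "F \<in> supp \<Longrightarrow> d0 F = jac (fr F) 0"
  using d0_germ_of[OF Fam.hol eps_pos] fr(2) by metis

lemma dprod_eq: "range \<omega> \<subseteq> supp \<Longrightarrow> dprod \<omega> n = Fam.dcomp \<omega> n"
  by (rule mprod_cong) (auto intro: d0_fr)

text \<open>The coordinatewise image of the product measure under \<open>d0\<close> is the product
  of the image laws, as is checked on cylinders. This carries the Lyapunov hypotheses from random
  matrices to random germs.\<close>

lemma AE_d0_sequence:
  assumes "AE A in PiM UNIV (\<lambda>_. distr \<nu> borel d0). P A"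
  shows "AE \<omega> in \<Omega>. P (\<lambda>i. d0 (\<omega> i))"
proof -
  let ?\<eta> = "distr \<nu> borel d0"
  let ?g = "\<lambda>\<omega> i. d0 (\<omega> i)"
  interpret \<eta>: prob_space ?\<eta> by (rule M.prob_space_distr) simp
  interpret E: sequence_space ?\<eta> by unfold_locales
  have g: "?g \<in> \<Omega> \<rightarrow>\<^sub>M PiM UNIV (\<lambda>_. ?\<eta>)"
  proof -
    have "(\<lambda>\<omega>. \<lambda>i\<in>UNIV. d0 (\<omega> i)) \<in> \<Omega> \<rightarrow>\<^sub>M PiM UNIV (\<lambda>_. ?\<eta>)"
      by (rule measurable_restrict) (auto intro!: measurable_compose[OF measurable_component_singleton])
    then show ?thesis by (simp add: restrict_def)
  qed
  have eq: "distr \<Omega> (PiM UNIV (\<lambda>_. ?\<eta>)) ?g = PiM UNIV (\<lambda>_. ?\<eta>)"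
  proof (rule E.PiM_eq)
    fix J and F :: "nat \<Rightarrow> 'm cmat set"
    assume J: "finite J" "J \<subseteq> UNIV" "\<And>j. j \<in> J \<Longrightarrow> F j \<in> sets ?\<eta>"
    let ?X = "prod_emb UNIV (\<lambda>_. ?\<eta>) J (\<Pi>\<^sub>E j\<in>J. F j)"
    have X: "?X \<in> sets (PiM UNIV (\<lambda>_. ?\<eta>))" using J by (intro sets_PiM_I) auto
    have D: "d0 -` F j \<inter> space \<nu> \<in> sets \<nu>" if "j \<in> J" for j
      using measurable_sets[OF d0_measurable] J(3)[OF that] by simp
    have eq: "?g -` ?X \<inter> space \<Omega> = {\<omega>\<in>space \<Omega>. \<forall>j\<in>J. \<omega> j \<in> d0 -` F j \<inter> space \<nu>}"
      by (auto simp: prod_emb_def space_PiM PiE_iff)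
    have "emeasure (distr \<Omega> (PiM UNIV (\<lambda>_. ?\<eta>)) ?g) ?X = emeasure \<Omega> {\<omega>\<in>space \<Omega>. \<forall>j\<in>J. \<omega> j \<in> d0 -` F j \<inter> space \<nu>}"
      using emeasure_distr[OF g X] unfolding eq .
    also have "\<dots> = (\<Prod>j\<in>J. emeasure \<nu> (d0 -` F j \<inter> space \<nu>))"
      by (rule Q.emeasure_PiM_Collect) (use J D in auto)
    also have "\<dots> = (\<Prod>j\<in>J. emeasure ?\<eta> (F j))"
      using J(3) by (intro prod.cong refl emeasure_distr[symmetric]) auto
    finally show "emeasure (distr \<Omega> (PiM UNIV (\<lambda>_. ?\<eta>)) ?g) ?X = (\<Prod>j\<in>J. emeasure ?\<eta> (F j))" .
  qed simp
  have "AE A in distr \<Omega> (PiM UNIV (\<lambda>_. ?\<eta>)) ?g. P A" unfolding eq by (rule assms)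
  then show ?thesis by (rule AE_distrD[OF g])
qed

lemma stays_imp_fatou:
  assumes \<omega>: "range \<omega> \<subseteq> supp" and v: "0 < v" "Fam.stays v \<omega>"
  shows "fatou_at_0 \<omega>"
    and "defined_on (ball 0 v) \<omega> (\<lambda>_. ball 0 rr) (\<lambda>k. fr (\<omega> k))"
proof -
  have b: "norm (Fam.comp \<omega> n z) \<le> rr / 2" if "z \<in> ball 0 v" for n z
    using v(2) that by (simp add: Fam.stays_def)
  have i: "Fam.comp \<omega> n z \<in> ball 0 rr" if "z \<in> ball 0 v" for n z
    using b[OF that, of n] eps_pos[of lvl] by simp
  have s: "\<omega> k \<in> supp" for k using \<omega> by blast
  show "fatou_at_0 \<omega>"
    by (rule fatou_at_0I[of "\<lambda>_. ball 0 rr" "\<lambda>k. fr (\<omega> k)" \<omega> v "rr / 2"])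
      (use s v b i in \<open>auto intro: Fam.hol fr(3) eps_pos\<close>)
  show "defined_on (ball 0 v) \<omega> (\<lambda>_. ball 0 rr) (\<lambda>k. fr (\<omega> k))"
    unfolding defined_on_def using i s by (auto intro: Fam.hol fr(3) eps_pos)
qed

section \<open>The attracting case\<close>

definition Cd :: real where
  "Cd = max 1 (2 * real CARD('m) * (real lvl + 1) / rr)"

lemma opnorm_d0_le:
  assumes "F \<in> supp"
  shows "opnorm (d0 F) \<le> Cd"
  using holo_on_cauchy_bound[OF Fam.hol[OF assms] eps_pos Fam.bd[OF assms]]
  by (simp add: d0_fr[OF assms] Cd_def)

lemma dprod_measurable [measurable]: "(\<lambda>\<omega>. dprod \<omega> n) \<in> borel_measurable \<Omega>"
proof (rule mprod_measurable)
  fix i :: nat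
  have "(\<lambda>\<omega>. \<omega> i) \<in> \<Omega> \<rightarrow>\<^sub>M \<nu>" by (rule measurable_component_singleton) simp
  then show "(\<lambda>\<omega>. d0 (\<omega> i)) \<in> borel_measurable \<Omega>" by (rule measurable_compose) (rule d0_measurable)
qed

lemma opnorm_dprod_measurable [measurable]: "(\<lambda>\<omega>. opnorm (dprod \<omega> n)) \<in> borel_measurable \<Omega>"
proof -
  have "continuous_on UNIV (opnorm :: 'm cmat \<Rightarrow> real)" by (intro continuous_intros)
  from borel_measurable_continuous_on[OF this dprod_measurable] show ?thesis .
qed

lemma AE_contracting_blocks:
  assumes "attracting \<nu>"
  shows "\<exists>N>0. \<exists>\<delta>>0. AE \<omega> in \<Omega>. (\<lambda>K. \<Prod>k<K. opnorm (dprod (shift (k * N) \<omega>) N) + \<delta>) \<longlonglongrightarrow> 0"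
proof -
  have Cd1: "1 \<le> Cd" by (simp add: Cd_def)
  \<comment> \<open>The truncation from below at exp (-1) handles an exponent minus infinity; the
    one from above at Cd makes X bounded on all sequences and not just on those in the
    support.\<close>
  define X where "X n \<omega> = ln (min (max (root n (opnorm (dprod \<omega> n))) (exp (-1))) Cd)" for n \<omega>
  have Xm [measurable]: "X n \<in> borel_measurable \<Omega>" for n unfolding X_def by measurable
  have arg: "exp (-1) \<le> min (max t (exp (-1))) Cd" "min (max t (exp (-1))) Cd \<le> Cd" for t :: real
    using Cd1 by (auto intro: order_trans[of _ 1])
  have Xlo: "- 1 \<le> X n \<omega>" and Xhi: "X n \<omega> \<le> ln Cd" for n \<omega>
  proof -
    have "ln (exp (-1)) \<le> X n \<omega>" unfolding X_def by (intro ln_mono arg less_le_trans[OF exp_gt_zero arg(1)]) auto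
    then show "- 1 \<le> X n \<omega>" by simp
    show "X n \<omega> \<le> ln Cd" unfolding X_def
      by (intro ln_mono arg less_le_trans[OF exp_gt_zero arg(1)])
  qed
  have XB: "\<bar>X n \<omega>\<bar> \<le> ln Cd + 1" for n \<omega>
    using Xlo[of n \<omega>] Xhi[of n \<omega>] ln_ge_zero[OF Cd1] unfolding abs_le_iff by linarith
  have "AE \<omega> in \<Omega>. \<exists>L. oseledets_lim (\<lambda>i. d0 (\<omega> i)) L \<and> (\<forall>c. eigenval L c \<longrightarrow> cmod c < 1)"
    using assms unfolding attracting_def attracting_mat_def by (rule AE_d0_sequence)
  then have "AE \<omega> in \<Omega>. \<exists>l<0. (\<lambda>n. X n \<omega>) \<longlonglongrightarrow> l"
  proof eventually_elim
    case (elim \<omega>)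
    then obtain L where L: "oseledets_lim (\<lambda>i. d0 (\<omega> i)) L" "\<And>c. eigenval L c \<Longrightarrow> cmod c < 1" by blast
    have "cmod (of_real (opnorm L)) < 1"
      by (rule L(2)[OF hermitian_psd_eigenval_opnorm[OF oseledets_lim_psd[OF L(1)]]])
    then have l1: "opnorm L < 1" by simp
    define l where "l = ln (min (max (opnorm L) (exp (-1))) Cd)"
    have p: "0 < min (max (opnorm L) (exp (-1))) Cd" using arg(1) by (rule less_le_trans[OF exp_gt_zero])
    have "(\<lambda>n. X n \<omega>) \<longlonglongrightarrow> l"
      unfolding X_def l_def using p by (intro tendsto_intros oseledets_lim_opnorm[OF L(1)]) auto
    moreover have "min (max (opnorm L) (exp (-1))) Cd < 1" using l1 by (simp add: min_less_iff_disj)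
    then have "l < 0" using p by (simp add: l_def ln_less_zero)
    ultimately show ?case by blast
  qed
  from Q.P.expectation_times_n_to_minus_infinity[of X, OF Xm XB this, of "ln 2"]
  obtain N where N: "0 < N" "real N * Q.P.expectation (X N) + ln 2 < 0" by blast
  \<comment> \<open>The N-th power of the truncation level exp (-1). Norm plus \<delta> is then at
    most twice the N-th power of the root truncated from below; the factor 2 costs ln 2, which the
    choice of N has already paid for.\<close>
  define \<delta> where "\<delta> = exp (- real N)"
  have \<delta>: "0 < \<delta>" "\<delta> \<le> 1" by (simp_all add: \<delta>_def)
  \<comment> \<open>The cap bounds Y everywhere. It is inactive on sequences in the support, where
    the norm is at most \<open>Cd ^ N\<close> and \<delta> is at most 1.\<close>
  define Y where "Y \<omega> = min (opnorm (dprod \<omega> N) + \<delta>) (2 * Cd ^ N)" for \<omega>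
  have Ym [measurable]: "Y \<in> borel_measurable \<Omega>" unfolding Y_def by measurable
  have CdN: "1 \<le> Cd ^ N" using Cd1 by simp
  have Ylo: "\<delta> \<le> Y \<omega>" for \<omega> using \<delta> CdN opnorm_nonneg[of "dprod \<omega> N"] by (simp add: Y_def)
  have Yhi: "Y \<omega> \<le> 2 * Cd ^ N" for \<omega> by (simp add: Y_def)
  have lnY: "ln (Y \<omega>) \<le> real N * X N \<omega> + ln 2" for \<omega>
  proof -
    let ?t = "root N (opnorm (dprod \<omega> N))"
    let ?m = "min (max ?t (exp (-1))) Cd"
    have m0: "0 < ?m" using arg(1) by (rule less_le_trans[OF exp_gt_zero])
    have t: "?t ^ N = opnorm (dprod \<omega> N)" using N(1) by (simp add: opnorm_nonneg)
    have t0: "0 \<le> ?t" by (simp add: opnorm_nonneg real_root_ge_zero)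
    have d: "exp (-1) ^ N = \<delta>" by (simp add: \<delta>_def exp_of_nat_mult[symmetric])
    let ?M = "max ?t (exp (-1))"
    have "?t ^ N \<le> ?M ^ N" using t0 by (intro power_mono) auto
    moreover have "exp (-1) ^ N \<le> ?M ^ N" by (intro power_mono) auto
    ultimately have le: "opnorm (dprod \<omega> N) + \<delta> \<le> 2 * ?M ^ N" unfolding t d by linarith
    have "Y \<omega> \<le> 2 * ?m ^ N"
    proof (cases "?M \<le> Cd")
      case True
      then have "?m = ?M" by (rule min_absorb1)
      then show ?thesis using le unfolding Y_def by linarith
    next
      case False
      then have "?m = Cd" by (intro min_absorb2) linarith
      then show ?thesis using Yhi[of \<omega>] by simp
    qed
    then have "ln (Y \<omega>) \<le> ln (2 * ?m ^ N)" using Ylo[of \<omega>] \<delta> by (intro ln_mono) auto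
    also have "\<dots> = ln 2 + real N * ln ?m"
    proof -
      have "ln (2 * x ^ N) = ln 2 + real N * ln x" if "0 < x" for x :: real
        using that by (simp add: ln_mult ln_realpow)
      from this[OF m0] show ?thesis .
    qed
    finally show ?thesis by (simp add: X_def)
  qed
  have Xint: "integrable \<Omega> (X N)"
    by (rule Q.P.integrable_const_bound[where B = "ln Cd + 1"]) (use XB in auto)
  have "\<bar>ln (Y \<omega>)\<bar> \<le> \<bar>ln \<delta>\<bar> + \<bar>ln (2 * Cd ^ N)\<bar>" for \<omega>
  proof -
    have "0 < Y \<omega>" using Ylo[of \<omega>] \<delta>(1) by linarith
    then have "ln (Y \<omega>) \<le> ln (2 * Cd ^ N)" "ln \<delta> \<le> ln (Y \<omega>)"
      using Yhi[of \<omega>] Ylo[of \<omega>] \<delta>(1) by (auto intro!: ln_mono)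
    then show ?thesis by linarith
  qed
  then have "integrable \<Omega> (\<lambda>\<omega>. ln (Y \<omega>))"
    by (intro Q.P.integrable_const_bound[where B = "\<bar>ln \<delta>\<bar> + \<bar>ln (2 * Cd ^ N)\<bar>"]) auto
  then have "Q.P.expectation (\<lambda>\<omega>. ln (Y \<omega>)) \<le> Q.P.expectation (\<lambda>\<omega>. real N * X N \<omega> + ln 2)"
    using lnY Xint by (intro integral_mono) auto
  also have "\<dots> = real N * Q.P.expectation (X N) + ln 2" using Xint Q.P.prob_space by simp
  finally have neg: "Q.P.expectation (\<lambda>\<omega>. ln (Y \<omega>)) < 0" using N(2) by linarith
  obtain s where s: "0 < s" "(\<integral>\<^sup>+\<omega>. ennreal (Y \<omega> powr s) \<partial>\<Omega>) < 1"
    using Q.P.powr_expectation_less_1[OF Ym Ylo Yhi \<delta>(1) neg] by blast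
  have "AE \<omega> in \<Omega>. (\<lambda>K. \<Prod>k<K. ennreal (Y (shift (k * N) \<omega>) powr s)) \<longlonglongrightarrow> 0"
  proof (rule Q.AE_block_prod_tendsto_0[OF _ _ s(2)])
    show "ennreal (Y (comb_seq N \<omega> \<omega>') powr s) = ennreal (Y \<omega> powr s)" for \<omega> \<omega>'
      unfolding Y_def by (subst mprod_cong[of N _ "\<lambda>i. d0 (\<omega> i)"]) (simp_all add: comb_seq_less)
  qed measurable
  then have "AE \<omega> in \<Omega>. (\<lambda>K. \<Prod>k<K. opnorm (dprod (shift (k * N) \<omega>) N) + \<delta>) \<longlonglongrightarrow> 0"
    using AE_supp
  proof eventually_elim
    case (elim \<omega>)
    have Y: "Y (shift k \<omega>) = opnorm (dprod (shift k \<omega>) N) + \<delta>" for k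
    proof -
      have "opnorm (dprod (shift k \<omega>) N) \<le> Cd ^ N"
        using elim(2) by (intro opnorm_mprod_le opnorm_d0_le) auto
      then show ?thesis using \<delta>(2) CdN by (simp add: Y_def)
    qed
    define h where "h K = (\<Prod>k<K. Y (shift (k * N) \<omega>))" for K
    have Y0: "0 \<le> Y \<omega>" for \<omega> using Ylo[of \<omega>] \<delta>(1) by linarith
    have h0: "0 \<le> h K" for K unfolding h_def using Y0 by (intro prod_nonneg) auto
    have "(\<Prod>k<K. ennreal (Y (shift (k * N) \<omega>) powr s)) = ennreal (h K powr s)" for K
      unfolding h_def using Y0 by (simp add: prod_ennreal prod_powr_distrib)
    then have "(\<lambda>K. ennreal (h K powr s)) \<longlonglongrightarrow> ennreal 0" using elim(1) by simp
    then have "(\<lambda>K. h K powr s) \<longlonglongrightarrow> 0" by (rule tendsto_ennrealD) auto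
    then have "h \<longlonglongrightarrow> 0" using h0 s(1) by (rule tendsto_powr_zeroD)
    then show ?case by (simp add: h_def[abs_def] Y)
  qed
  then show ?thesis using N(1) \<delta>(1) by blast
qed

lemma attracting_AE:
  assumes "attracting \<nu>"
  shows "AE \<omega> in \<Omega>. range \<omega> \<subseteq> supp \<and> (\<exists>v>0. Fam.stays v \<omega> \<and> (\<forall>z\<in>ball 0 v. (\<lambda>n. Fam.comp \<omega> n z) \<longlonglongrightarrow> 0))"
proof -
  obtain N \<delta> where N: "0 < N" "0 < \<delta>"
    "AE \<omega> in \<Omega>. (\<lambda>K. \<Prod>k<K. opnorm (dprod (shift (k * N) \<omega>) N) + \<delta>) \<longlonglongrightarrow> 0"
    using AE_contracting_blocks[OF assms] by blast
  show ?thesis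
    using N(3) AE_supp
  proof eventually_elim
    case (elim \<omega>)
    have "dprod (shift k \<omega>) N = Fam.dcomp (shift k \<omega>) N" for k
      by (rule dprod_eq[OF Fam.range_shift[OF elim(2)]])
    then show ?case using Fam.comp_tendsto_0[OF elim(2) N(2,1)] elim by simp
  qed
qed

section \<open>The repelling and neutral cases\<close>

lemma fatou_AE_stays:
  assumes "random_fatou_0 \<nu>"
  shows "AE \<omega> in \<Omega>. range \<omega> \<subseteq> supp \<and> (\<exists>v>0. Fam.stays v \<omega>)"
  using assms[unfolded random_fatou_0_def] AE_supp
proof eventually_elim
  case (elim \<omega>)
  have "\<omega> k = germ_of (fr (\<omega> k))" for k using fr(2)[of "\<omega> k"] elim(2) by auto
  then show ?case using Fam.fatou_imp_stays[OF elim(2) _ elim(1)] elim(2) by blast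
qed

lemma repelling_not_fatou:
  assumes "repelling \<nu>"
  shows "\<not> random_fatou_0 \<nu>"
proof
  assume "random_fatou_0 \<nu>"
  note st = fatou_AE_stays[OF this]
  have "AE \<omega> in \<Omega>. \<exists>L. oseledets_lim (\<lambda>i. d0 (\<omega> i)) L \<and> (\<exists>c. eigenval L c \<and> cmod c > 1)"
    using assms unfolding repelling_def repelling_mat_def by (rule AE_d0_sequence)
  then have "AE \<omega> in \<Omega>. False"
    using st
  proof eventually_elim
    case (elim \<omega>)
    then obtain L c v where L: "oseledets_lim (\<lambda>i. d0 (\<omega> i)) L" "eigenval L c" "1 < cmod c"
      and v: "0 < v" "Fam.stays v \<omega>" and \<omega>: "range \<omega> \<subseteq> supp" by blast
    define C where "C = max 1 (2 * real CARD('m) * (rr / 2) / v)"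
    have C: "opnorm (dprod \<omega> n) \<le> C" for n
      using Fam.stays_dcomp_bound[OF \<omega> v(2,1), of n] by (simp add: dprod_eq[OF \<omega>] C_def)
    have "opnorm L \<le> 1"
    proof (rule LIMSEQ_le[OF oseledets_lim_opnorm[OF L(1)]])
      show "(\<lambda>n. root n C) \<longlonglongrightarrow> 1" by (rule LIMSEQ_root_const) (simp add: C_def)
      show "\<exists>N. \<forall>n\<ge>N. root n (opnorm (dprod \<omega> n)) \<le> root n C"
        using C by (intro exI[of _ 1]) (simp add: real_root_le_mono)
    qed
    then show False using eigenval_le_opnorm[OF L(2)] L(3) by linarith
  qed
  then show False by simp
qed

text \<open>Read through \<phi>, all germs of the support become linear isometries of the norm |P
  w|. A small ball of that norm, pulled back by \<phi>, is therefore mapped into itself, for every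
  sequence in the support.\<close>

lemma fatou_if_linearizable_unitary:
  assumes lin: "simult_linearizable supp" and un: "conj_to_unitary (dS supp)"
    and \<omega>: "range \<omega> \<subseteq> supp"
  shows "fatou_at_0 \<omega>"
proof -
  obtain \<phi> \<psi> r1 s1 where r1: "0 < r1" "0 < s1" and \<phi>: "holo_on (ball 0 r1) \<phi>" "\<phi> 0 = 0"
    and \<psi>: "holo_on (ball 0 s1) \<psi>" "\<psi> 0 = 0"
    and inv1: "\<forall>\<^sub>F z in nhds 0. \<psi> (\<phi> z) = z" and inv2: "\<forall>\<^sub>F w in nhds 0. \<phi> (\<psi> w) = w"
    and conj: "\<And>F f. F \<in> supp \<Longrightarrow> f \<in> F \<Longrightarrow> \<forall>\<^sub>F z in nhds 0. \<phi> (f z) = d0 F *v \<phi> z"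
    using lin unfolding simult_linearizable_def by blast
  obtain P Q :: "'m cmat" where P: "P ** Q = mat 1" "Q ** P = mat 1"
    and PU: "\<And>A. A \<in> dS supp \<Longrightarrow> P ** A ** Q \<in> unitary_grp"
    using un unfolding conj_to_unitary_def by blast
  have isom: "norm (P *v (d0 F *v w)) = norm (P *v w)" if F: "F \<in> supp" for F w
  proof -
    have "d0 F = dmat (compo (\<lambda>k. rep ((\<lambda>_. F) k)) 1)" by (simp add: d0_def)
    then have "d0 F \<in> dS supp" unfolding dS_def using F by (intro CollectI exI[of _ "\<lambda>_. F"] exI[of _ "1::nat"]) simp
    from norm_unitary[OF PU[OF this], of "P *v w"]
    show ?thesis by (simp add: matrix_vector_mul_assoc P flip: matrix_mul_assoc)
  qed
  have "isCont \<psi> 0" using r1 by (intro has_derivative_continuous[OF holo_on_has_derivative[OF \<psi>(1)]]) simp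
  then have "filterlim \<psi> (nhds 0) (nhds 0)"
    using \<psi>(2) tendsto_at_iff_tendsto_nhds[of \<psi> 0] by (simp add: isCont_def)
  then have "\<forall>\<^sub>F w in nhds 0. \<psi> w \<in> ball 0 r1"
    by (rule topological_tendstoD[OF _ open_ball]) (use r1 in simp)
  moreover have "\<forall>\<^sub>F w in nhds (0::'m cvec). w \<in> ball 0 s1"
    by (rule eventually_nhds_in_open[OF open_ball]) (use r1 in simp)
  ultimately have "\<forall>\<^sub>F w in nhds 0. \<psi> w \<in> ball 0 r1 \<and> w \<in> ball 0 s1 \<and> \<phi> (\<psi> w) = w"
    using inv2 by eventually_elim blast
  then obtain b where b: "0 < b" "\<And>w. norm w < b \<Longrightarrow> \<psi> w \<in> ball 0 r1 \<and> w \<in> ball 0 s1 \<and> \<phi> (\<psi> w) = w"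
    unfolding eventually_nhds_metric by (auto simp: dist_norm)
  \<comment> \<open>Chosen so that |P w| < \<kappa> forces |w| < b, the region where \<psi> is
    defined and inverted by \<phi>.\<close>
  define \<kappa> where "\<kappa> = b / (opnorm Q + 1)"
  have q: "0 < opnorm Q + 1" using opnorm_nonneg[of Q] by linarith
  have \<kappa>: "0 < \<kappa>" using b(1) q by (simp add: \<kappa>_def)
  have lt: "norm w < b" if "norm (P *v w) < \<kappa>" for w
  proof -
    have "norm w = norm (Q *v (P *v w))" by (simp add: matrix_vector_mul_assoc P)
    also have "\<dots> \<le> opnorm Q * norm (P *v w)" by (rule norm_mult_le_opnorm)
    also have "\<dots> \<le> (opnorm Q + 1) * norm (P *v w)" by (intro mult_right_mono) auto
    also have "\<dots> < (opnorm Q + 1) * \<kappa>" using that q by (rule mult_strict_left_mono)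
    also have "\<dots> = b" using q by (simp add: \<kappa>_def)
    finally show ?thesis .
  qed
  define U where "U = ball 0 r1 \<inter> (\<lambda>z. norm (P *v \<phi> z)) -` {..<\<kappa>}"
  have U: "open U" unfolding U_def
    by (rule continuous_open_preimage[OF _ open_ball open_lessThan])
      (intro continuous_intros holo_on_imp_continuous_on[OF \<phi>(1)])
  have U0: "0 \<in> U" using r1 \<phi>(2) \<kappa> by (simp add: U_def)
  \<comment> \<open>Representatives adapted to U: near 0 they agree with the given germs, and by
    construction they map U into itself.\<close>
  define g where "g k z = \<psi> (d0 (\<omega> k) *v \<phi> z)" for k z
  have sup: "\<omega> k \<in> supp" for k using \<omega> by blast
  have small: "norm (d0 (\<omega> k) *v \<phi> z) < b" if "z \<in> U" for k z
    using that isom[OF sup] by (intro lt) (simp add: U_def)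
  have gU: "g k z \<in> U" if z: "z \<in> U" for k z
    using b(2)[OF small[OF z, of k]] isom[OF sup] z by (simp add: U_def g_def)
  have hol: "holo_on U (g k)" for k
    unfolding g_def
  proof (rule holo_on_compose[OF _ \<psi>(1)])
    show "holo_on U (\<lambda>z. d0 (\<omega> k) *v \<phi> z)"
      by (rule holo_on_compose[OF holo_on_subset[OF \<phi>(1)] holo_on_matrix_vector[of UNIV]]) (auto simp: U_def)
    show "d0 (\<omega> k) *v \<phi> z \<in> ball 0 s1" if "z \<in> U" for z using b(2)[OF small[OF that]] by blast
  qed
  have germ: "g k \<in> \<omega> k" for k
  proof -
    let ?f = "fr (\<omega> k)"
    have "isCont ?f 0"
      using eps_pos[of lvl] by (intro has_derivative_continuous[OF holo_on_has_derivative[OF Fam.hol[OF sup]]]) simp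
    then have "filterlim ?f (nhds 0) (nhds 0)"
      using Fam.zero[OF sup] tendsto_at_iff_tendsto_nhds[of ?f 0] by (simp add: isCont_def)
    from eventually_compose_filterlim[OF inv1 this]
    have "\<forall>\<^sub>F z in nhds 0. \<psi> (\<phi> (?f z)) = ?f z" .
    then have "\<forall>\<^sub>F z in nhds 0. g k z = ?f z"
      using conj[OF sup fr(3)[OF sup], of k] by eventually_elim (simp add: g_def)
    then have "g k \<in> germ_of ?f" by (simp add: mem_germ_of)
    then show ?thesis by (simp add: fr(2)[OF sup])
  qed
  obtain v where v: "0 < v" "ball 0 v \<subseteq> U" using U U0 open_contains_ball by blast
  have inU: "compo g n z \<in> U" if "z \<in> ball 0 v" for n z
    using that v(2) gU by (induction n) auto
  have bd: "norm (compo g n z) \<le> r1" if "z \<in> ball 0 v" for n z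
    using inU[OF that, of n] by (simp add: U_def)
  show ?thesis
    by (rule fatou_at_0I[of "\<lambda>_. U" g \<omega> v r1]) (use U U0 hol germ v inU bd in auto)
qed

text \<open>Stability bounds the differentials and neutrality gives |det| growth rate one, so
  \<open>AE_eq_1_of_bounded_products\<close> yields |det| = 1 almost surely. The exceptional set is
  open and null, hence misses the support.\<close>

lemma neutral_unimodular:
  assumes neu: "neutral \<nu>" and fat: "random_fatou_0 \<nu>" and F: "F \<in> supp"
  shows "cmod (det (d0 F)) = 1"
proof (rule ccontr)
  assume ne: "cmod (det (d0 F)) \<noteq> 1"
  \<comment> \<open>The random walk lemma wants positive factors everywhere. The substitute 2
    differs from 1, so a = 1 still excludes a vanishing determinant.\<close>
  define a where "a G = (if det (d0 G) = 0 then 2 else cmod (det (d0 G)))" for G :: "('m cvec \<Rightarrow> 'm cvec) set"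
  have cdet: "continuous_on UNIV (det :: 'm cmat \<Rightarrow> complex)" by (intro continuous_intros)
  have dm [measurable]: "(\<lambda>G. det (d0 G)) \<in> borel_measurable \<nu>"
    by (rule borel_measurable_continuous_on[OF cdet d0_measurable])
  have am [measurable]: "a \<in> borel_measurable \<nu>" unfolding a_def by measurable
  have "AE \<omega> in \<Omega>. \<exists>L. oseledets_lim (\<lambda>i. d0 (\<omega> i)) L \<and> (\<forall>c. eigenval L c \<longrightarrow> c = 1)"
    using neu unfolding neutral_def neutral_mat_def by (rule AE_d0_sequence)
  then have rt: "AE \<omega> in \<Omega>. (\<forall>n. (\<Prod>i<n. a (\<omega> i)) = cmod (det (dprod \<omega> n))) \<and>
      (\<lambda>n. root n (\<Prod>i<n. a (\<omega> i))) \<longlonglongrightarrow> 1"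
  proof eventually_elim
    case (elim \<omega>)
    then have lim: "(\<lambda>n. root n (cmod (det (dprod \<omega> n)))) \<longlonglongrightarrow> 1"
      using oseledets_lim_neutral_det by blast
    have nz: "det (d0 (\<omega> i)) \<noteq> 0" for i
    proof
      assume z: "det (d0 (\<omega> i)) = 0"
      have "\<forall>\<^sub>F n in sequentially. 0 < root n (cmod (det (dprod \<omega> n)))"
        using order_tendstoD(1)[OF lim, of 0] by simp
      then obtain n where n: "n > i" "0 < root n (cmod (det (dprod \<omega> n)))"
        unfolding eventually_sequentially by (meson le_Suc_ex less_add_Suc1 nat_le_linear le_trans le_SucI less_Suc_eq_le)
      have "cmod (det (dprod \<omega> n)) = 0"
        unfolding cmod_det_mprod using n(1) z by (intro prod_zero) auto
      then show False using n(2) by simp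
    qed
    have eq: "(\<Prod>i<n. a (\<omega> i)) = cmod (det (dprod \<omega> n))" for n
      unfolding cmod_det_mprod using nz by (simp add: a_def)
    show ?case unfolding eq using lim by simp
  qed
  have "AE x in \<nu>. a x = 1"
  proof (rule Q.AE_eq_1_of_bounded_products[OF am])
    show "0 < a x" for x by (simp add: a_def)
    show "AE \<omega> in \<Omega>. (\<lambda>n. root n (\<Prod>i<n. a (\<omega> i))) \<longlonglongrightarrow> 1" using rt by eventually_elim blast
    show "AE \<omega> in \<Omega>. \<exists>C. \<forall>n. (\<Prod>i<n. a (\<omega> i)) \<le> C"
      using rt fatou_AE_stays[OF fat]
    proof eventually_elim
      case (elim \<omega>)
      then obtain v where v: "0 < v" "Fam.stays v \<omega>" and \<omega>: "range \<omega> \<subseteq> supp" by blast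
      define C where "C = 2 * real CARD('m) * (rr / 2) / v"
      have C: "opnorm (dprod \<omega> n) \<le> C" for n
        using Fam.stays_dcomp_bound[OF \<omega> v(2,1), of n] by (simp add: dprod_eq[OF \<omega>] C_def)
      have "norm (dprod \<omega> n) \<le> (real CARD('m))\<^sup>2 * C" for n
        using norm_le_opnorm[of "dprod \<omega> n"] mult_left_mono[OF C[of n] zero_le_power2[of "real CARD('m)"]]
        by (rule order_trans)
      then have mem: "dprod \<omega> n \<in> cball 0 ((real CARD('m))\<^sup>2 * C)" for n by simp
      have "bounded (det ` cball (0::'m cmat) ((real CARD('m))\<^sup>2 * C))"
        by (intro compact_imp_bounded compact_continuous_image continuous_on_subset[OF cdet]) auto
      then obtain D where "\<And>A. A \<in> cball (0::'m cmat) ((real CARD('m))\<^sup>2 * C) \<Longrightarrow> cmod (det A) \<le> D"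
        unfolding bounded_iff by blast
      then have "\<forall>n. cmod (det (dprod \<omega> n)) \<le> D" using mem by blast
      then show ?case using elim by auto
    qed
  qed
  then have ae: "AE x in \<nu>. cmod (det (d0 x)) = 1"
    by eventually_elim (auto simp: a_def split: if_splits)
  let ?B = "{A::'m cmat. cmod (det A) \<noteq> 1}"
  have "open ?B" by (intro open_Collect_neq continuous_intros)
  from openin_germ_d0_vimage[OF this]
  have op: "openin (germ_topology eps) {G\<in>Germs. d0 G \<in> ?B}" .
  have "F \<in> Germs" using F by (auto simp: supp_of_def topspace_germ)
  then have "0 < emeasure \<nu> {G\<in>Germs. d0 G \<in> ?B}"
    using F op ne unfolding supp_of_def by blast
  moreover have "{G\<in>Germs. d0 G \<in> ?B} = {x\<in>space \<nu>. \<not> cmod (det (d0 x)) = 1}"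
    by (simp add: borel_of_germs(1)[OF borel])
  moreover have "emeasure \<nu> {x\<in>space \<nu>. \<not> cmod (det (d0 x)) = 1} = 0"
    using ae by (subst (asm) AE_iff_measurable[OF _ refl]) measurable
  ultimately show False by simp
qed

text \<open>Almost every orbit comes close to every word in the support, and by the open mapping property
  one typical orbit controls all its shifts; so a single radius works for all words.\<close>

lemma uniform_stability:
  assumes neu: "neutral \<nu>" and fat: "random_fatou_0 \<nu>"
  shows "\<exists>p>0. \<forall>\<omega>. range \<omega> \<subseteq> supp \<longrightarrow> Fam.stays p \<omega>"
proof (rule ccontr)
  assume no: "\<not> ?thesis"
  have unimod: "cmod (det (jac (fr i) 0)) = 1" if "i \<in> supp" for i
    using neutral_unimodular[OF neu fat that] by (simp add: d0_fr[OF that])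
  \<comment> \<open>Without a common radius, each 1 / (k + 1) is violated by some sequence, in a way
    visible on finitely many letters. Neighbourhoods of these letters have positive measure, so
    almost every orbit follows them closely from some time n on, for p steps.\<close>
  have ev: "AE \<omega> in \<Omega>. \<exists>n. range \<omega> \<subseteq> supp \<longrightarrow> \<not> Fam.stays (1 / real (Suc k)) (shift n \<omega>)" for k
  proof -
    have "0 < 1 / real (Suc k)" by simp
    then obtain \<omega>0 where \<omega>0: "range \<omega>0 \<subseteq> supp" "\<not> Fam.stays (1 / real (Suc k)) \<omega>0" using no by blast
    obtain d p where d: "0 < d" "\<And>\<eta>. (\<forall>i<p. \<forall>w\<in>ball 0 (3/4 * rr). norm (fr (\<eta> i) w - fr (\<omega>0 i) w) < d)
        \<Longrightarrow> \<not> Fam.stays (1 / real (Suc k)) \<eta>"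
      using Fam.not_stays_perturb[OF \<omega>0] by blast
    have s: "0 < 3/4 * rr" "3/4 * rr < rr" using eps_pos[of lvl] by auto
    have "\<exists>U. openin (germ_topology eps) U \<and> \<omega>0 i \<in> U \<and>
        (\<forall>G\<in>U \<inter> supp. \<forall>z\<in>ball 0 (3/4 * rr). norm (fr G z - fr (\<omega>0 i) z) < d)" for i
      unfolding fr_def using \<omega>0(1)
      by (intro closed_bdd_germs_nhd[OF closedin_supp_of supp_bdd s d(1)]) blast
    then obtain U where U: "\<And>i. openin (germ_topology eps) (U i)" "\<And>i. \<omega>0 i \<in> U i"
      "\<And>i. \<forall>G\<in>U i \<inter> supp. \<forall>z\<in>ball 0 (3/4 * rr). norm (fr G z - fr (\<omega>0 i) z) < d" by metis
    have "AE \<omega> in \<Omega>. \<exists>n. \<forall>i<p. \<omega> (i + n) \<in> U i"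
    proof (rule Q.AE_visits)
      show "U i \<in> sets \<nu>" for i by (rule borel_of_germs(2)[OF borel U(1)])
      show "0 < emeasure \<nu> (U i)" for i
      proof -
        have "\<omega>0 i \<in> supp" using \<omega>0(1) by blast
        then show ?thesis using U(1,2)[of i] unfolding supp_of_def by blast
      qed
    qed
    then show ?thesis
    proof eventually_elim
      case (elim \<omega>)
      then obtain n where n: "\<forall>i<p. \<omega> (i + n) \<in> U i" by blast
      have "\<not> Fam.stays (1 / real (Suc k)) (shift n \<omega>)" if "range \<omega> \<subseteq> supp"
        using n U(3) that by (intro d(2)) blast
      then show ?case by blast
    qed
  qed
  have "AE \<omega> in \<Omega>. \<forall>k. \<exists>n. range \<omega> \<subseteq> supp \<longrightarrow> \<not> Fam.stays (1 / real (Suc k)) (shift n \<omega>)"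
    unfolding AE_all_countable by (rule allI) (rule ev)
  then have "AE \<omega> in \<Omega>. False"
    using fatou_AE_stays[OF fat]
  proof eventually_elim
    case (elim \<omega>)
    then obtain v where v: "0 < v" "Fam.stays v \<omega>" and \<omega>: "range \<omega> \<subseteq> supp" by blast
    \<comment> \<open>For a single typical orbit one radius p serves all shifts, a contradiction
      once 1 / (k + 1) < p.\<close>
    obtain p where p: "0 < p" "\<And>n. Fam.stays p (shift n \<omega>)"
      using Fam.stays_shift[OF \<omega> v(2,1) unimod] by blast
    obtain k where k: "1 / real (Suc k) < p" using p(1) by (rule nat_approx_posE)
    obtain n where "\<not> Fam.stays (1 / real (Suc k)) (shift n \<omega>)" using elim(1) \<omega> by blast
    then show False using Fam.stays_mono[OF p(2)[of n]] k by simp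
  qed
  then show False by simp
qed

lemma neutral_fatou_imp:
  assumes neu: "neutral \<nu>" and fat: "random_fatou_0 \<nu>"
  shows "simult_linearizable supp" "conj_to_unitary (dS supp)"
proof -
  obtain p where p: "0 < p" "\<And>\<omega>. range \<omega> \<subseteq> supp \<Longrightarrow> Fam.stays p \<omega>"
    using uniform_stability[OF neu fat] by blast
  interpret St: stable_family supp fr rr "real lvl + 1" p
    by unfold_locales (use p supp_ne neutral_unimodular[OF neu fat] d0_fr in auto)
  obtain \<phi> where \<phi>: "holo_on (ball 0 St.\<rho>') \<phi>" "\<phi> 0 = 0" "jac \<phi> 0 = mat 1"
    "\<And>z. z \<in> ball 0 St.\<rho>' \<Longrightarrow> norm (\<phi> z) \<le> St.C1"
    "\<And>F. F \<in> supp \<Longrightarrow> \<forall>\<^sub>F z in nhds 0. \<phi> (fr F z) = jac (fr F) 0 *v \<phi> z"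
    using St.linearizing_map by blast
  obtain \<psi> t where \<psi>: "0 < t" "holo_on (ball 0 t) \<psi>" "\<psi> 0 = 0"
    "\<forall>\<^sub>F z in nhds 0. \<psi> (\<phi> z) = z" "\<forall>\<^sub>F w in nhds 0. \<phi> (\<psi> w) = w"
    by (rule holo_on_local_inverse[OF \<phi>(1,4) St.\<rho>'(1) \<phi>(2,3)])
  have conj: "\<forall>\<^sub>F z in nhds 0. \<phi> (f z) = d0 F *v \<phi> z" if F: "F \<in> supp" "f \<in> F" for F f
  proof -
    have "f \<in> germ_of (fr F)" using F fr(2) by simp
    then have "\<forall>\<^sub>F z in nhds 0. f z = fr F z" by (simp add: mem_germ_of)
    then show ?thesis using \<phi>(5)[OF F(1)] by eventually_elim (simp add: d0_fr[OF F(1)])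
  qed
  show "simult_linearizable supp"
    unfolding simult_linearizable_def
    by (rule exI[of _ \<phi>], rule exI[of _ \<psi>], rule exI[of _ "St.\<rho>'"], rule exI[of _ t])
      (use \<phi>(1,2) \<psi> St.\<rho>'(1) conj in blast)
  obtain P P' :: "'m cmat" where P: "P ** P' = mat 1" "P' ** P = mat 1"
    "\<forall>ws\<in>lists supp. P ** St.Aw ws ** P' \<in> unitary_grp"
    using St.semigroup_unitary by (elim exE conjE)
  have "P ** A ** P' \<in> unitary_grp" if "A \<in> dS supp" for A
  proof -
    from that obtain \<omega> n where \<omega>: "\<And>i. \<omega> i \<in> supp" "A = dmat (compo (\<lambda>k. rep (\<omega> k)) n)"
      unfolding dS_def by blast
    have rng: "range \<omega> \<subseteq> supp" using \<omega>(1) by blast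
    \<comment> \<open>\<open>dS\<close> is built from arbitrary representatives. They share with
      \<open>fr\<close> the value and the derivative at 0, and these determine the derivative of the
      composition.\<close>
    have rep: "rep (\<omega> k) 0 = 0" "(rep (\<omega> k) has_derivative (*v) (jac (fr (\<omega> k)) 0)) (at 0)" for k
    proof -
      have "(fr (\<omega> k) has_derivative (*v) (jac (fr (\<omega> k)) 0)) (at 0)"
        using eps_pos[of lvl] by (intro holo_on_has_derivative[OF Fam.hol[OF \<omega>(1)]]) simp
      from has_derivative_rep_germ_of[OF this]
      show "(rep (\<omega> k) has_derivative (*v) (jac (fr (\<omega> k)) 0)) (at 0)" by (simp add: fr(2)[OF \<omega>(1)])
      show "rep (\<omega> k) 0 = 0"
        using eventually_nhds_x_imp_x[OF eventually_rep_germ_of[of "fr (\<omega> k)"]]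
        by (simp add: fr(2)[OF \<omega>(1)] Fam.zero[OF \<omega>(1)])
    qed
    have "A = Fam.dcomp \<omega> n"
      unfolding \<omega>(2) dmat_eq_jac
      by (rule jac_eqI[OF compo_has_derivative_0[of "\<lambda>k. rep (\<omega> k)", OF rep(2,1)]])
    also have "\<dots> = St.Aw (map \<omega> [0..<n])" by (rule St.dcomp_eq_Aw)
    finally have "A = St.Aw (map \<omega> [0..<n])" .
    moreover have "map \<omega> [0..<n] \<in> lists supp" using \<omega>(1) by auto
    ultimately show ?thesis using P(3) by simp
  qed
  then show "conj_to_unitary (dS supp)" unfolding conj_to_unitary_def
    by (intro exI[of _ P] exI[of _ P'] conjI ballI P(1,2))
qed

end

theorem mainTheorem1:
  fixes eps :: "nat \<Rightarrow> real"
    and \<nu> :: "('m::finite cvec \<Rightarrow> 'm cvec) set measure"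
  assumes eps_decr: "\<And>n. eps (Suc n) < eps n"
    and eps_lim: "eps \<longlonglongrightarrow> 0"
    and prob: "prob_space \<nu>"
    and borel: "sets \<nu> = sets (borel_of (germ_topology eps))"
    and cpt_supp: "compactin (germ_topology eps) (supp_of (germ_topology eps) \<nu>)"
  shows "(attracting \<nu> \<longrightarrow>
            random_fatou_0 \<nu> \<and>
            (AE \<omega> in PiM UNIV (\<lambda>_. \<nu>). \<exists>V U g. open V \<and> 0 \<in> V \<and> defined_on V \<omega> U g \<and>
                 (\<forall>z\<in>V. (\<lambda>n. compo g n z) \<longlonglongrightarrow> 0)))
       \<and> (repelling \<nu> \<longrightarrow> \<not> random_fatou_0 \<nu>)
       \<and> (neutral \<nu> \<longrightarrow>
            (random_fatou_0 \<nu> \<longleftrightarrow>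
               simult_linearizable (supp_of (germ_topology eps) \<nu>) \<and>
               conj_to_unitary (dS (supp_of (germ_topology eps) \<nu>))))"
proof (intro conjI impI)
  interpret germ_measure eps \<nu>
    by (intro germ_measure.intro germ_measure_axioms.intro radius_seq.intro) (fact assms)+
  {
    assume att: "attracting \<nu>"
    show "random_fatou_0 \<nu>"
      unfolding random_fatou_0_def using attracting_AE[OF att]
      by eventually_elim (blast intro: stays_imp_fatou(1))
    show "AE \<omega> in PiM UNIV (\<lambda>_. \<nu>). \<exists>V U g. open V \<and> 0 \<in> V \<and> defined_on V \<omega> U g \<and>
        (\<forall>z\<in>V. (\<lambda>n. compo g n z) \<longlonglongrightarrow> 0)"
      using attracting_AE[OF att]
    proof eventually_elim
      case (elim \<omega>)
      then obtain v where v: "0 < v" "Fam.stays v \<omega>" "\<forall>z\<in>ball 0 v. (\<lambda>n. Fam.comp \<omega> n z) \<longlonglongrightarrow> 0"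
        and \<omega>: "range \<omega> \<subseteq> supp" by blast
      then show ?case
        using stays_imp_fatou(2)[OF \<omega> v(1,2)]
        by (intro exI[of _ "ball 0 v"] exI[of _ "\<lambda>_. ball 0 rr"] exI[of _ "\<lambda>k. fr (\<omega> k)"]) simp
    qed
  }
  show "\<not> random_fatou_0 \<nu>" if "repelling \<nu>" by (rule repelling_not_fatou[OF that])
  show "random_fatou_0 \<nu> \<longleftrightarrow> simult_linearizable supp \<and> conj_to_unitary (dS supp)" if neu: "neutral \<nu>"
  proof
    show "simult_linearizable supp \<and> conj_to_unitary (dS supp)" if "random_fatou_0 \<nu>"
      using neutral_fatou_imp[OF neu that] ..
    show "random_fatou_0 \<nu>" if "simult_linearizable supp \<and> conj_to_unitary (dS supp)"
      unfolding random_fatou_0_def using AE_supp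
      by eventually_elim (use that fatou_if_linearizable_unitary in blast)
  qed
qed

end
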